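(* Let $K$ be an algebraically closed field of characteristic zero. Let $I=(f_1,f_2,f_3,f_4)\subset K[x_1,x_2,x_3,x_4]$ be an ideal such that either $f_1,\ldots,f_4$ is a generic (regular) sequence of homogeneous polynomials of degree $3$, or $f_1,\ldots,f_4$ is a regular sequence of homogeneous polynomials of degree $3$ with $f_i\in K[x_i,\ldots,x_4]$ for $i=1,\ldots,4$. Then the generic initial ideal $J=\mathrm{Gin}(I)$ of $I$ with respect to the reverse lexicographic order has one of the following two forms: (I) \[J=(\{x_1,x_2\}^3,\ x_3^2\{x_1,x_2\}^2,\ x_3^4\{x_1,x_2,x_3\},\ x_4x_3^3\{x_1,x_2,x_3\},\] \[x_4^3x_3\{x_1,x_2\}^2,\ x_4^3x_3^2\{x_1,x_2\},\ x_4^3x_3^3,\ x_4^5\{x_1,x_2,x_3\}^2,\ x_4^7\{x_1,x_2,x_3\},\ x_4^9);\] (II) \[J=(\{x_1,x_2\}^3,\ x_3^2x_1\{x_1,x_2,x_3\},\ x_3^3x_2^2,\ x_3^4x_2,\ x_3^5,\ x_4x_3^2x_2^2,\ x_4x_3^3x_2,\ x_4x_3^4,\] \[x_4^3x_3\{x_1,x_2\}^2,\ x_4^3x_3^2\{x_1,x_2\},\ x_4^3x_3^3,\ x_4^5\{x_1,x_2,x_3\}^2,\ x_4^7\{x_1,x_2,x_3\},\ x_4^9).\]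
   Context: The reverse lexicographic (revlex) order is the graded reverse lexicographic order with $x_1>x_2>x_3>x_4$. The generic initial ideal $\mathrm{Gin}(I)$ of a homogeneous ideal $I\subset S=K[x_1,\ldots,x_4]$ is the initial ideal, with respect to this order, of $g(I)$ for a generic linear change of coordinates $g$: there is a nonempty Zariski open subset of $GL_4(K)$ on which $\mathrm{in}(g(I))$ is constant, and $\mathrm{Gin}(I)$ is this common value. Notation: for a set of variables $\{x_1,\ldots,x_m\}$ and an integer $a\ge 1$, $\{x_1,\ldots,x_m\}^a$ denotes the set of all monomials of degree $a$ in $x_1,\ldots,x_m$ (with $\{x_1,\ldots,x_m\}^1=\{x_1,\ldots,x_m\}$), and for a monomial $u$, $u\{x_1,\ldots,x_m\}^a$ is the set of all products $uv$ with $v\in\{x_1,\ldots,x_m\}^a$. A list of monomials and sets of monomials in parentheses denotes the ideal generated by all of them. A property holds for a generic sequence of homogeneous polynomials of degrees $d_1,\ldots,d_m$ if there is a nonempty Zariski open subset $U\subset S_{d_1}\times\cdots\times S_{d_m}$ such that the property holds for every tuple $(f_1,\ldots,f_m)\in U$. *)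

theory Defs
  imports
    "HOL-Analysis.Analysis"
    "HOL-Library.Poly_Mapping"
    "HOL-Library.Set_Algebras"
    "HOL-Computational_Algebra.Polynomial"
begin

section \<open>Polynomials in variables indexed by a type\<close>

type_synonym ('x, 'a) mpoly = "('x \<Rightarrow>\<^sub>0 nat) \<Rightarrow>\<^sub>0 'a"

definition mono_deg :: "('x \<Rightarrow>\<^sub>0 nat) \<Rightarrow> nat" where
  "mono_deg m = (\<Sum>x\<in>Poly_Mapping.keys m. Poly_Mapping.lookup m x)"

definition Const :: "'a \<Rightarrow> ('x, 'a::zero) mpoly" where
  "Const c = Poly_Mapping.single 0 c"

definition Monom :: "('x \<Rightarrow>\<^sub>0 nat) \<Rightarrow> ('x, 'a::zero_neq_one) mpoly" where
  "Monom m = Poly_Mapping.single m 1"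

definition Var :: "'x \<Rightarrow> ('x, 'a::zero_neq_one) mpoly" where
  "Var x = Monom (Poly_Mapping.single x 1)"

definition vars :: "('x, 'a::zero) mpoly \<Rightarrow> 'x set" where
  "vars p = (\<Union>m\<in>Poly_Mapping.keys p. Poly_Mapping.keys m)"

(* The zero polynomial is homogeneous of every degree, so that the homogeneous
   polynomials of degree d form the vector space S_d. *)
definition homogeneous :: "nat \<Rightarrow> ('x, 'a::zero) mpoly \<Rightarrow> bool" where
  "homogeneous d p \<longleftrightarrow> (\<forall>m\<in>Poly_Mapping.keys p. mono_deg m = d)"

(* Substitute s x for each variable x, mapping coefficients by h. *)
definition eval_hom ::
    "('a::zero \<Rightarrow> 'b::comm_semiring_1) \<Rightarrow> ('x \<Rightarrow> 'b) \<Rightarrow> ('x, 'a) mpoly \<Rightarrow> 'b" where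
  "eval_hom h s p = (\<Sum>m\<in>Poly_Mapping.keys p. h (Poly_Mapping.lookup p m) * (\<Prod>x\<in>Poly_Mapping.keys m. s x ^ Poly_Mapping.lookup m x))"

abbreviation eval_at :: "('x \<Rightarrow> 'a) \<Rightarrow> ('x, 'a::comm_semiring_1) mpoly \<Rightarrow> 'a" where
  "eval_at \<equiv> eval_hom (\<lambda>c. c)"


section \<open>Ideals and regular sequences\<close>

definition ideal_gen :: "'r::comm_ring_1 set \<Rightarrow> 'r set" where
  "ideal_gen = module.span (*)"

definition regular_sequence :: "'r::comm_ring_1 list \<Rightarrow> bool" where
  "regular_sequence fs \<longleftrightarrow>
     (\<forall>i<length fs. \<forall>p. fs ! i * p \<in> ideal_gen (set (take i fs))
        \<longrightarrow> p \<in> ideal_gen (set (take i fs)))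
     \<and> ideal_gen (set fs) \<noteq> UNIV"


section \<open>Zariski open sets and genericity\<close>

(* U is Zariski open in X, where X is viewed as a subset of affine space through the
   coordinate functions \<phi>, with the subspace topology.  The index type of the coordinates
   may be infinite. *)
definition zariski_open_in ::
    "('p \<Rightarrow> 'c \<Rightarrow> 'a::comm_semiring_1) \<Rightarrow> 'p set \<Rightarrow> 'p set \<Rightarrow> bool" where
  "zariski_open_in \<phi> X U \<longleftrightarrow>
     (\<exists>F :: ('c, 'a) mpoly set. U = {x \<in> X. \<exists>p\<in>F. eval_at (\<phi> x) p \<noteq> 0})"

(* Coordinates on the product of the S_(d j) are the coefficients.  Those of monomials of
   degree other than d j vanish identically there, hence do not affect the topology. *)
definition generic_forms ::
    "('j \<Rightarrow> nat) \<Rightarrow> (('j \<Rightarrow> ('x, 'a::comm_semiring_1) mpoly) \<Rightarrow> bool) \<Rightarrow> bool" where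
  "generic_forms d P \<longleftrightarrow>
     (\<exists>U. U \<noteq> {}
        \<and> zariski_open_in (\<lambda>f (j, m). Poly_Mapping.lookup (f j) m) {f. \<forall>j. homogeneous (d j) (f j)} U
        \<and> (\<forall>f\<in>U. P f))"

definition GL :: "('a::field ^ 'n ^ 'n) set" where
  "GL = {A. invertible A}"

(* x_j is sent to the linear form whose coefficients are the j-th column of A. *)
definition lin_change ::
    "'a::field ^ 'n ^ 'n \<Rightarrow> ('n::finite, 'a) mpoly \<Rightarrow> ('n, 'a) mpoly" where
  "lin_change A = eval_hom Const (\<lambda>j. \<Sum>i\<in>UNIV. Const (A $ i $ j) * Var i)"


section \<open>Generic initial ideals in four variables\<close>

(* The variables are indexed by 1, 2, 3, 4 :: 4.  As 4 = 0 in this type, its built-in order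
   is not the order of the indices and is not used. *)

definition revlex_less :: "(4 \<Rightarrow>\<^sub>0 nat) \<Rightarrow> (4 \<Rightarrow>\<^sub>0 nat) \<Rightarrow> bool" where
  "revlex_less s t \<longleftrightarrow>
     mono_deg s < mono_deg t
     \<or> mono_deg s = mono_deg t \<and>
       (Poly_Mapping.lookup t 4 < Poly_Mapping.lookup s 4
        \<or> Poly_Mapping.lookup t 4 = Poly_Mapping.lookup s 4 \<and>
          (Poly_Mapping.lookup t 3 < Poly_Mapping.lookup s 3
           \<or> Poly_Mapping.lookup t 3 = Poly_Mapping.lookup s 3 \<and> Poly_Mapping.lookup t 2 < Poly_Mapping.lookup s 2))"

definition is_lead_mono :: "(4, 'a::zero) mpoly \<Rightarrow> (4 \<Rightarrow>\<^sub>0 nat) \<Rightarrow> bool" where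
  "is_lead_mono p m \<longleftrightarrow> m \<in> Poly_Mapping.keys p \<and> (\<forall>n\<in>Poly_Mapping.keys p. n \<noteq> m \<longrightarrow> revlex_less n m)"

definition initial_ideal :: "(4, 'a::field) mpoly set \<Rightarrow> (4, 'a) mpoly set" where
  "initial_ideal I = ideal_gen {Monom m | m. \<exists>p\<in>I. is_lead_mono p m}"

definition Gin :: "(4, 'a::field) mpoly set \<Rightarrow> (4, 'a) mpoly set" where
  "Gin I = (THE J. \<exists>U. U \<noteq> {}
              \<and> zariski_open_in (\<lambda>A (i, j). A $ i $ j) GL U
              \<and> (\<forall>A\<in>U. initial_ideal (lin_change A ` I) = J))"


section \<open>The two monomial ideals\<close>

definition Monoms :: "'x set \<Rightarrow> nat \<Rightarrow> ('x, 'a::zero_neq_one) mpoly set" where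
  "Monoms V a = {Monom m | m. Poly_Mapping.keys m \<subseteq> V \<and> mono_deg m = a}"

definition gin_form_I :: "(4, 'a::field) mpoly set" where
  "gin_form_I = ideal_gen (
       Monoms {1, 2} 3
     \<union> (Var 3 ^ 2) *o Monoms {1, 2} 2
     \<union> (Var 3 ^ 4) *o Monoms {1, 2, 3} 1
     \<union> (Var 4 * Var 3 ^ 3) *o Monoms {1, 2, 3} 1
     \<union> (Var 4 ^ 3 * Var 3) *o Monoms {1, 2} 2
     \<union> (Var 4 ^ 3 * Var 3 ^ 2) *o Monoms {1, 2} 1
     \<union> {Var 4 ^ 3 * Var 3 ^ 3}
     \<union> (Var 4 ^ 5) *o Monoms {1, 2, 3} 2
     \<union> (Var 4 ^ 7) *o Monoms {1, 2, 3} 1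
     \<union> {Var 4 ^ 9})"

definition gin_form_II :: "(4, 'a::field) mpoly set" where
  "gin_form_II = ideal_gen (
       Monoms {1, 2} 3
     \<union> (Var 3 ^ 2 * Var 1) *o Monoms {1, 2, 3} 1
     \<union> {Var 3 ^ 3 * Var 2 ^ 2, Var 3 ^ 4 * Var 2, Var 3 ^ 5}
     \<union> {Var 4 * Var 3 ^ 2 * Var 2 ^ 2, Var 4 * Var 3 ^ 3 * Var 2, Var 4 * Var 3 ^ 4}
     \<union> (Var 4 ^ 3 * Var 3) *o Monoms {1, 2} 2
     \<union> (Var 4 ^ 3 * Var 3 ^ 2) *o Monoms {1, 2} 1
     \<union> {Var 4 ^ 3 * Var 3 ^ 3}
     \<union> (Var 4 ^ 5) *o Monoms {1, 2, 3} 2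
     \<union> (Var 4 ^ 7) *o Monoms {1, 2, 3} 1
     \<union> {Var 4 ^ 9})"

end

theory Submission
  imports Defs
begin

text \<open>
  The leading monomials of an ideal generated by four cubics are governed by three conditions on the
  coordinates, which together are called good position: multiplication by $x_4^{2d-8}$ maps degree
  $8-d$ of the quotient ring onto degree \<open>d\<close> for $5\le d\le9$ (where $d=9$ means that degree 9 of the
  quotient vanishes); the cubics span all binary cubics after $x_3$ and $x_4$ are set to zero; and
  modulo $x_4$ the ideal together with $x_3^4$, $x_3^3x_2$, $x_3^2x_2^2$ spans degree 4.  Each of them
  says that the coefficients of elements of the ideal can be prescribed on a certain set of monomials,
  and so provides leading monomials (\<open>nonstandard_subset_LM\<close>).  What is left open is whether modulo
  $x_4$ the monomials $x_3^4$, $x_3^3x_2$, $x_3^3x_1$ complete the ideal in degree 4 as well.  If they do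
  for some coordinates, then they do for generic ones, and form (I) results; if they never do, a dimension
  count modulo $x_4$ makes $x_3^3x_1$ a leading monomial, and form (II) results
  (\<open>degenerate_lead_mono\<close>, \<open>Gin_of_good_position\<close>).

  That there are no further leading monomials follows by counting (\<open>LM_eqI\<close>): the Koszul syzygies bound
  the dimension of the ideal in degrees up to 8 by the number of leading monomials found already.

  Good position amounts to the solvability of linear systems, hence is open in all parameters
  (\<open>solvable_open\<close>, \<open>good_position_open\<close>), and it suffices to find one point where it holds.  That point
  is given by the cubes of the variables in explicit coordinates with $x_4$ the sum of the variables
  (\<open>good_position_base\<close>); the first condition is the strong Lefschetz property of a monomial complete
  intersection, proved with a representation of sl2 (\<open>strong_Lefschetz\<close>), and the other two are
  explicit systems of equations.  Openness in the cubics settles generic sequences (\<open>generic_Gin\<close>).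
  For a regular sequence of cubics $f_i\in K[x_i,\dots,x_4]$ the coefficient of $x_i^3$ in $f_i$ does
  not vanish (\<open>triangular_regular_sequence\<close>), so a one-parameter torus degenerates the sequence to
  multiples of the cubes of the variables; since its other members differ from the given ideal by a change of
  coordinates only, the given ideal is in good position in some coordinates (\<open>triangular_good_position\<close>).
  Finally, \<open>GL_opens_meet\<close> makes the generic initial ideal well defined.
\<close>

section \<open>Polynomials and substitution\<close>

abbreviation lookup :: "('b \<Rightarrow>\<^sub>0 'c::zero) \<Rightarrow> 'b \<Rightarrow> 'c" where "lookup \<equiv> Poly_Mapping.lookup"
abbreviation keys :: "('b \<Rightarrow>\<^sub>0 'c::zero) \<Rightarrow> 'b set" where "keys \<equiv> Poly_Mapping.keys"

lemma Const_0 [simp]: "Const 0 = 0"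
  and Const_1 [simp]: "Const 1 = 1"
  by (simp_all add: Const_def)

lemma Const_add: "Const (a + b) = Const a + Const b"
  by (simp add: Const_def single_add)

lemma Const_uminus: "Const (- a) = - Const (a :: 'a::comm_ring_1)"
  by (simp add: Const_def single_uminus)

lemma Const_diff: "Const (a - b) = Const a - Const (b :: 'a::comm_ring_1)"
  by (simp add: Const_def single_diff)

lemma Const_mult: "Const (a * b) = Const a * Const b"
  by (simp add: Const_def mult_single)

lemma Const_power: "Const (a ^ n) = Const a ^ n"
  by (induction n) (simp_all add: Const_mult)

lemma Const_numeral [simp]: "Const (numeral n) = numeral n"
  by (simp add: Const_def)

lemma Const_sum: "Const (sum f A) = (\<Sum>i\<in>A. Const (f i))"
  by (induction A rule: infinite_finite_induct) (simp_all add: Const_add)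

lemma Const_prod: "Const (prod f A) = (\<Prod>i\<in>A. Const (f i))"
  by (induction A rule: infinite_finite_induct) (simp_all add: Const_mult)

lemma Monom_0 [simp]: "Monom 0 = 1"
  by (simp add: Monom_def)

lemma Monom_add: "Monom (m + n) = (Monom m * Monom n :: ('x, 'a::comm_semiring_1) mpoly)"
  by (simp add: Monom_def mult_single)

lemma Const_times_Monom: "Const c * Monom m = Poly_Mapping.single m (c :: 'a::comm_semiring_1)"
  by (simp add: Const_def Monom_def mult_single)

lemma Monom_eq_iff [simp]: "(Monom m :: ('x, 'a::zero_neq_one) mpoly) = Monom n \<longleftrightarrow> m = n"
  unfolding Monom_def by (metis lookup_single_eq lookup_single_not_eq zero_neq_one)

lemma keys_Monom [simp]: "keys (Monom m :: ('x, 'a::zero_neq_one) mpoly) = {m}"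
  by (simp add: Monom_def)

lemma lookup_Monom: "lookup (Monom m :: ('x, 'a::zero_neq_one) mpoly) n = (if n = m then 1 else 0)"
  by (simp add: Monom_def lookup_single when_def)

lemma mpoly_eq_sum:
  assumes "finite F" "keys p \<subseteq> F"
  shows "p = (\<Sum>m\<in>F. Const (lookup p m) * Monom m :: ('x, 'a::comm_semiring_1) mpoly)"
proof (rule poly_mapping_eqI)
  fix k
  have "lookup (\<Sum>m\<in>F. Const (lookup p m) * Monom m) k = (\<Sum>m\<in>F. if m = k then lookup p k else 0)"
    unfolding lookup_sum Const_times_Monom
    by (rule sum.cong) (auto simp: lookup_single when_def)
  also have "\<dots> = lookup p k"
    using assms by (auto simp: sum.delta in_keys_iff)
  finally show "lookup p k = lookup (\<Sum>m\<in>F. Const (lookup p m) * Monom m) k" by simp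
qed

lemma mpoly_induct [case_names add monom]:
  fixes p :: "('x, 'a::comm_semiring_1) mpoly"
  assumes add: "\<And>p q. P p \<Longrightarrow> P q \<Longrightarrow> P (p + q)"
    and monom: "\<And>c m. P (Const c * Monom m)"
  shows "P p"
proof -
  have "P 0" using monom[of 0] by simp
  then have "P (\<Sum>m\<in>F. Const (lookup p m) * Monom m)" for F
    by (induction F rule: infinite_finite_induct) (auto intro: add monom)
  then show ?thesis by (subst mpoly_eq_sum[of "keys p" p]) simp_all
qed

lemma lookup_Const_times [simp]:
  "lookup (Const c * p) m = c * lookup p (m :: 'x \<Rightarrow>\<^sub>0 nat)" for c :: "'a::comm_semiring_1"
  by (induction p rule: mpoly_induct)
    (simp_all add: distrib_left lookup_add Const_times_Monom lookup_single when_def,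
      simp_all add: Const_def Monom_def mult_single lookup_single when_def)

lemma lookup_Monom_times_add [simp]:
  "lookup (Monom k * p) (k + m) = lookup p (m :: 'x \<Rightarrow>\<^sub>0 nat)" for p :: "('x, 'a::comm_semiring_1) mpoly"
  by (induction p rule: mpoly_induct)
    (simp_all add: distrib_left lookup_add Const_times_Monom lookup_single when_def,
      simp_all add: Const_def Monom_def mult_single lookup_single when_def)

lemma lookup_Monom_times_eq_0:
  assumes "\<And>m. n \<noteq> k + m"
  shows "lookup (Monom k * p) n = (0 :: 'a::comm_semiring_1)"
proof -
  have "n \<notin> keys (Monom k * p)"
    using assms keys_mult[of "Monom k" p] by auto
  then show ?thesis by (simp add: in_keys_iff)
qed

definition monom_value :: "('x \<Rightarrow> 'b::comm_semiring_1) \<Rightarrow> ('x \<Rightarrow>\<^sub>0 nat) \<Rightarrow> 'b" where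
  "monom_value s m = (\<Prod>x\<in>keys m. s x ^ lookup m x)"

lemma monom_value_superset:
  assumes "finite F" "keys m \<subseteq> F"
  shows "monom_value s m = (\<Prod>x\<in>F. s x ^ lookup m x)"
  unfolding monom_value_def using assms
  by (intro prod.mono_neutral_left) (auto simp: in_keys_iff)

lemma monom_value_0 [simp]: "monom_value s 0 = 1"
  by (simp add: monom_value_def)

lemma monom_value_add: "monom_value s (m + n) = monom_value s m * monom_value s n"
proof -
  define F where "F = keys m \<union> keys n"
  have F: "finite F" "keys m \<subseteq> F" "keys n \<subseteq> F" "keys (m + n) \<subseteq> F"
    using keys_add[of m n] by (auto simp: F_def)
  show ?thesis
    by (simp add: monom_value_superset[of F] F lookup_add power_add prod.distrib)
qed

lemma monom_value_single [simp]: "monom_value s (Poly_Mapping.single x n) = s x ^ n"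
  by (simp add: monom_value_def)

text \<open>Substitution respects products as soon as the coefficients are mapped by a homomorphism of
  semirings.  The identity gives evaluation at a point, and \<^const>\<open>Const\<close> gives the substitution
  of polynomials for the variables.\<close>

locale coeff_hom =
  fixes h :: "'a::comm_semiring_1 \<Rightarrow> 'b::comm_semiring_1"
  assumes h_0: "h 0 = 0" and h_1: "h 1 = 1"
    and h_add: "h (x + y) = h x + h y" and h_mult: "h (x * y) = h x * h y"
begin

lemma eval_superset:
  assumes "finite F" "keys p \<subseteq> F"
  shows "eval_hom h s p = (\<Sum>m\<in>F. h (lookup p m) * monom_value s m)"
  unfolding eval_hom_def monom_value_def using assms
  by (intro sum.mono_neutral_left) (auto simp: in_keys_iff h_0)

lemma eval_add: "eval_hom h s (p + q) = eval_hom h s p + eval_hom h s q"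
proof -
  define F where "F = keys p \<union> keys q"
  have F: "finite F" "keys p \<subseteq> F" "keys q \<subseteq> F" "keys (p + q) \<subseteq> F"
    using keys_add[of p q] by (auto simp: F_def)
  show ?thesis
    by (simp add: eval_superset[of F] F lookup_add h_add distrib_right sum.distrib)
qed

lemma eval_term: "eval_hom h s (Const c * Monom m) = h c * monom_value s m"
  by (subst eval_superset[of "{m}"]) (auto simp: Const_times_Monom)

lemma eval_mult: "eval_hom h s (p * q) = eval_hom h s p * eval_hom h s q"
proof (induction p rule: mpoly_induct)
  case (add p p')
  then show ?case by (simp add: distrib_right eval_add)
next
  case (monom c m)
  show ?case
  proof (induction q rule: mpoly_induct)
    case (add q q')
    then show ?case by (simp add: distrib_left eval_add)
  next
    case (monom d n)
    have "Const c * Monom m * (Const d * Monom n) = (Const (c * d) * Monom (m + n) :: ('c, 'a) mpoly)"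
      by (simp add: Const_mult Monom_add ac_simps)
    then show ?case by (simp add: eval_term h_mult monom_value_add ac_simps)
  qed
qed

lemma eval_0 [simp]: "eval_hom h s 0 = 0"
  by (simp add: eval_hom_def)

lemma eval_Monom: "eval_hom h s (Monom m) = monom_value s m"
  using eval_term[of s 1 m] by (simp add: h_1)

lemma eval_Const: "eval_hom h s (Const c) = h c"
  using eval_term[of s c 0] by simp

lemma eval_Var: "eval_hom h s (Var x) = s x"
  by (simp add: Var_def eval_Monom)

lemma eval_1 [simp]: "eval_hom h s 1 = 1"
  using eval_Const[of s 1] by (simp add: h_1)

lemma eval_power: "eval_hom h s (p ^ n) = eval_hom h s p ^ n"
  by (induction n) (simp_all add: eval_mult)

lemma eval_sum: "eval_hom h s (sum f A) = (\<Sum>i\<in>A. eval_hom h s (f i))"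
  by (induction A rule: infinite_finite_induct) (simp_all add: eval_add)

lemma eval_prod: "eval_hom h s (prod f A) = (\<Prod>i\<in>A. eval_hom h s (f i))"
  by (induction A rule: infinite_finite_induct) (simp_all add: eval_mult)

end

lemma coeff_hom_id: "coeff_hom (\<lambda>c. c)"
  by unfold_locales auto

interpretation Const: coeff_hom Const
  by unfold_locales (simp_all add: Const_add Const_mult)

lemma eval_uminus:
  assumes "coeff_hom (h :: 'a::comm_ring_1 \<Rightarrow> 'b::comm_ring_1)"
  shows "eval_hom h s (- p) = - eval_hom h s p"
proof -
  interpret coeff_hom h by fact
  have "eval_hom h s (- p) + eval_hom h s p = 0"
    by (simp flip: eval_add)
  then show ?thesis by (simp add: eq_neg_iff_add_eq_0)
qed

lemma Monom_eq_monom_value: "Monom m = monom_value (Var :: 'x \<Rightarrow> ('x, 'a::comm_semiring_1) mpoly) m"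
proof (induction m rule: update_induct)
  case const
  then show ?case by simp
next
  case (update f a b)
  have eq: "Poly_Mapping.update a b f = f + Poly_Mapping.single a b"
    using update by (intro poly_mapping_eqI) (auto simp: lookup_update lookup_add lookup_single when_def in_keys_iff)
  have "Monom (Poly_Mapping.single a n) = (Var a ^ n :: ('x, 'a) mpoly)" for n
  proof (induction n)
    case (Suc n)
    have "Poly_Mapping.single a (Suc n) = Poly_Mapping.single a 1 + Poly_Mapping.single a n"
      by (simp flip: single_add)
    then show ?case using Suc by (simp add: Var_def Monom_add)
  qed simp
  then show ?case
    using update by (simp add: eq Monom_add monom_value_add)
qed

lemma eval_hom_Const_Var: "eval_hom Const Var p = (p :: ('x, 'a::comm_semiring_1) mpoly)"
  by (induction p rule: mpoly_induct) (simp_all add: Const.eval_add Const.eval_term flip: Monom_eq_monom_value)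

lemma eval_hom_compose:
  fixes p :: "('x, 'a::comm_semiring_1) mpoly" and s :: "'x \<Rightarrow> ('y, 'a) mpoly" and t :: "'y \<Rightarrow> ('z, 'a) mpoly"
  shows "eval_hom Const t (eval_hom Const s p) = eval_hom Const (\<lambda>x. eval_hom Const t (s x)) p"
proof (induction p rule: mpoly_induct)
  case (monom c m)
  show ?case
    by (simp add: Const.eval_term Const.eval_Monom Const.eval_mult Const.eval_Const monom_value_def Const.eval_prod Const.eval_power)
qed (simp add: Const.eval_add)

section \<open>Monomials of bounded degree\<close>

lemma mono_deg_UNIV: "mono_deg m = (\<Sum>x\<in>UNIV. lookup (m :: 'x::finite \<Rightarrow>\<^sub>0 nat) x)"
  unfolding mono_deg_def by (intro sum.mono_neutral_left) (auto simp: in_keys_iff)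

lemma mono_deg_superset: "finite F \<Longrightarrow> keys m \<subseteq> F \<Longrightarrow> mono_deg m = (\<Sum>x\<in>F. lookup m x)"
  unfolding mono_deg_def by (intro sum.mono_neutral_left) (auto simp: in_keys_iff)

lemma mono_deg_0 [simp]: "mono_deg 0 = 0"
  by (simp add: mono_deg_def)

lemma mono_deg_add [simp]: "mono_deg (m + n) = mono_deg m + mono_deg n"
proof -
  define F where "F = keys m \<union> keys n"
  have F: "finite F" "keys m \<subseteq> F" "keys n \<subseteq> F" "keys (m + n) \<subseteq> F"
    using keys_add[of m n] by (auto simp: F_def)
  show ?thesis
    by (simp add: mono_deg_superset[of F] F lookup_add sum.distrib)
qed

lemma mono_deg_single [simp]: "mono_deg (Poly_Mapping.single x n) = n"
  by (simp add: mono_deg_def)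

lemma finite_mono_deg_le [simp]: "finite {m :: 'x::finite \<Rightarrow>\<^sub>0 nat. mono_deg m \<le> d}"
proof (rule finite_subset)
  show "{m :: 'x \<Rightarrow>\<^sub>0 nat. mono_deg m \<le> d} \<subseteq> Poly_Mapping.lookup -` (UNIV \<rightarrow> {..d})"
  proof clarsimp
    fix m :: "'x \<Rightarrow>\<^sub>0 nat" and x assume "mono_deg m \<le> d"
    then show "lookup m x \<le> d"
      unfolding mono_deg_UNIV using member_le_sum[of x UNIV "lookup m"] by simp
  qed
  show "finite (Poly_Mapping.lookup -` (UNIV \<rightarrow> {..d}) :: ('x \<Rightarrow>\<^sub>0 nat) set)"
    by (intro finite_vimageI) (auto simp: inj_on_def poly_mapping.lookup_inject
        intro: finite_PiE[of UNIV "\<lambda>_. {..d}", unfolded PiE_UNIV_domain])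
qed

lemma finite_mono_deg_eq [simp]: "finite {m :: 'x::finite \<Rightarrow>\<^sub>0 nat. mono_deg m = d}"
  by (rule finite_subset[OF _ finite_mono_deg_le[of d]]) auto

lemma homogeneous_lookup: "homogeneous d p \<Longrightarrow> lookup p m \<noteq> 0 \<Longrightarrow> mono_deg m = d"
  by (auto simp: homogeneous_def in_keys_iff)

lemma homogeneous_add: "homogeneous d p \<Longrightarrow> homogeneous d q \<Longrightarrow> homogeneous d (p + q)"
  using keys_add[of p q] by (fastforce simp: homogeneous_def)

lemma homogeneous_0 [simp]: "homogeneous d 0"
  by (simp add: homogeneous_def)

lemma homogeneous_sum: "(\<And>i. i \<in> A \<Longrightarrow> homogeneous d (f i)) \<Longrightarrow> homogeneous d (sum f A)"
  by (induction A rule: infinite_finite_induct) (auto intro: homogeneous_add)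

lemma homogeneous_mult: "homogeneous d p \<Longrightarrow> homogeneous e q \<Longrightarrow> homogeneous (d + e) (p * q :: ('x, 'a::comm_semiring_1) mpoly)"
  using keys_mult[of p q] by (fastforce simp: homogeneous_def)

lemma homogeneous_Const [simp]: "homogeneous 0 (Const c)"
  by (simp add: homogeneous_def Const_def)

lemma homogeneous_1 [simp]: "homogeneous 0 (1 :: ('x, 'a::comm_semiring_1) mpoly)"
  by (simp add: homogeneous_def)

lemma homogeneous_Monom: "homogeneous (mono_deg m) (Monom m)"
  by (simp add: homogeneous_def)

lemma homogeneous_Var: "homogeneous 1 (Var x)"
  by (simp add: homogeneous_def Var_def)

lemma homogeneous_Const_times: "homogeneous d p \<Longrightarrow> homogeneous d (Const c * p :: ('x, 'a::comm_semiring_1) mpoly)"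
  using homogeneous_mult[OF homogeneous_Const] by fastforce

lemma homogeneous_power: "homogeneous d p \<Longrightarrow> homogeneous (n * d) (p ^ n :: ('x, 'a::comm_semiring_1) mpoly)"
  by (induction n) (auto dest: homogeneous_mult)

lemma homogeneous_prod:
  "(\<And>i. i \<in> A \<Longrightarrow> homogeneous (d i) (f i)) \<Longrightarrow> finite A \<Longrightarrow> homogeneous (sum d A) (prod f A :: ('x, 'a::comm_semiring_1) mpoly)"
proof (induction A rule: infinite_finite_induct)
  case (insert a A)
  then show ?case using homogeneous_mult[of "d a" "f a" "sum d A" "prod f A"] by auto
qed auto

lemma homogeneous_monom_value:
  assumes "\<And>x. homogeneous 1 (s x :: ('x, 'a::comm_semiring_1) mpoly)"
  shows "homogeneous (mono_deg m) (monom_value s m)"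
  unfolding mono_deg_def monom_value_def
  using assms homogeneous_power[of 1] by (intro homogeneous_prod) auto

lemma homogeneous_eval_hom:
  assumes "\<And>x. homogeneous 1 (s x :: ('y, 'a::comm_semiring_1) mpoly)" "homogeneous d p"
  shows "homogeneous d (eval_hom Const s p)"
  unfolding eval_hom_def monom_value_def[symmetric]
  using assms homogeneous_monom_value[of s]
  by (intro homogeneous_sum homogeneous_Const_times) (auto simp: homogeneous_def)

section \<open>Systems of linear equations\<close>

definition solvable :: "('i \<Rightarrow> 'c \<Rightarrow> 'k::field) \<Rightarrow> 'i set \<Rightarrow> 'c set \<Rightarrow> bool" where
  "solvable a N C \<longleftrightarrow> (\<forall>y. \<exists>x. \<forall>c\<in>C. (\<Sum>i\<in>N. a i c * x i) = y c)"

text \<open>Each equation that is not void expresses one unknown through the others.\<close>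

lemma more_unknowns_than_equations:
  fixes a :: "'i \<Rightarrow> 'c \<Rightarrow> 'k::field"
  assumes "finite C" "finite N" "card C < card N"
  shows "\<exists>x. (\<exists>i\<in>N. x i \<noteq> 0) \<and> (\<forall>c\<in>C. (\<Sum>i\<in>N. a i c * x i) = 0)"
  using assms
proof (induction C arbitrary: N a rule: finite_induct)
  case empty
  then have "N \<noteq> {}" by auto
  then show ?case by (intro exI[of _ "\<lambda>_. 1"]) auto
next
  case (insert c C)
  show ?case
  proof (cases "\<forall>i\<in>N. a i c = 0")
    case True
    obtain x where "\<exists>i\<in>N. x i \<noteq> 0" "\<forall>c\<in>C. (\<Sum>i\<in>N. a i c * x i) = 0"
      using insert.IH[of N a] insert.prems insert.hyps by auto
    with True show ?thesis by (intro exI[of _ x]) simp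
  next
    case False
    then obtain j where j: "j \<in> N" "a j c \<noteq> 0" by auto
    define M where "M = N - {j}"
    have M: "N = insert j M" "j \<notin> M" "finite M"
      using j insert.prems by (auto simp: M_def)
    define b where "b = (\<lambda>i c'. a j c * a i c' - a i c * a j c')"
    have "card C < card M"
      using insert M by simp
    with insert.IH[of M b] M obtain x
      where x: "\<exists>i\<in>M. x i \<noteq> 0" "\<And>c'. c' \<in> C \<Longrightarrow> (\<Sum>i\<in>M. b i c' * x i) = 0" by auto
    define x' where "x' = (\<lambda>i. if i = j then - (\<Sum>i\<in>M. a i c * x i) else a j c * x i)"
    have x'_j: "x' j = - (\<Sum>i\<in>M. a i c * x i)"
      by (simp add: x'_def)
    have sum_M: "(\<Sum>i\<in>M. f i * x' i) = a j c * (\<Sum>i\<in>M. f i * x i)" for f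
      unfolding sum_distrib_left using M by (intro sum.cong) (auto simp: x'_def)
    have "(\<Sum>i\<in>N. a i c' * x' i) = 0" if "c' \<in> insert c C" for c'
    proof (cases "c' = c")
      case True
      then show ?thesis using M by (simp add: sum_M x'_j)
    next
      case False
      with that have "c' \<in> C" by simp
      have "(\<Sum>i\<in>N. a i c' * x' i) = a j c' * x' j + a j c * (\<Sum>i\<in>M. a i c' * x i)"
        using M by (simp add: sum_M)
      also have "\<dots> = (\<Sum>i\<in>M. b i c' * x i)"
        by (simp add: x'_j b_def sum_distrib_left algebra_simps sum_subtractf)
      finally have "(\<Sum>i\<in>N. a i c' * x' i) = (\<Sum>i\<in>M. b i c' * x i)" .
      with x(2)[OF \<open>c' \<in> C\<close>] show ?thesis by simp
    qed
    moreover have "\<exists>i\<in>N. x' i \<noteq> 0"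
      using x(1) M j by (auto simp: x'_def)
    ultimately show ?thesis by blast
  qed
qed

text \<open>A kernel vector would make one column superfluous.  The remaining columns are too few, hence
  annihilated by some nonzero combination of the rows, and this combination would annihilate every
  right-hand side.\<close>

lemma solvable_imp_trivial_kernel:
  fixes a :: "'i \<Rightarrow> 'c \<Rightarrow> 'k::field"
  assumes fin: "finite C" "finite N" "card N \<le> card C"
    and solv: "solvable a N C"
    and x: "\<And>c. c \<in> C \<Longrightarrow> (\<Sum>i\<in>N. a i c * x i) = 0" and j: "j \<in> N"
  shows "x j = 0"
proof (rule ccontr)
  assume xj: "x j \<noteq> 0"
  define M where "M = N - {j}"
  have M: "N = insert j M" "j \<notin> M" "finite M"
    using j fin by (auto simp: M_def)
  have "card M < card C" using M fin by simp
  then obtain y c0 where c0: "c0 \<in> C" "y c0 \<noteq> 0" and y: "\<And>i. i \<in> M \<Longrightarrow> (\<Sum>c\<in>C. a i c * y c) = 0"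
    using more_unknowns_than_equations[of M C "\<lambda>c i. a i c"] M fin by auto
  have swap: "(\<Sum>c\<in>C. y c * (\<Sum>i\<in>N. a i c * z i)) = (\<Sum>i\<in>N. z i * (\<Sum>c\<in>C. a i c * y c))" for z
    unfolding sum_distrib_left by (subst sum.swap) (simp add: ac_simps)
  have "0 = (\<Sum>i\<in>N. x i * (\<Sum>c\<in>C. a i c * y c))"
    using swap[of x] x by simp
  also have "\<dots> = x j * (\<Sum>c\<in>C. a j c * y c)"
    using M y by simp
  finally have "(\<Sum>c\<in>C. a i c * y c) = 0" if "i \<in> N" for i
    using xj y that M by auto
  moreover obtain z where z: "\<And>c. c \<in> C \<Longrightarrow> (\<Sum>i\<in>N. a i c * z i) = (if c = c0 then 1 else 0)"
    using solv[unfolded solvable_def, rule_format, of "\<lambda>c. if c = c0 then 1 else 0"] by auto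
  ultimately have "(\<Sum>c\<in>C. y c * (if c = c0 then 1 else 0)) = 0"
    using swap[of z] by simp
  moreover have "(\<Sum>c\<in>C. y c * (if c = c0 then 1 else 0)) = y c0"
    using c0 fin by (simp add: if_distrib[of "(*) _"] cong: if_cong)
  ultimately show False using c0 by simp
qed

text \<open>A right-hand side that is not attained, added as a further column, cannot occur in a kernel
  vector of the enlarged system, which exists because there are now more columns than rows.\<close>

lemma not_solvable_imp_kernel:
  fixes a :: "'i \<Rightarrow> 'c \<Rightarrow> 'k::field"
  assumes fin: "finite C" "finite N" "card C \<le> card N" and "\<not> solvable a N C"
  shows "\<exists>x. (\<exists>i\<in>N. x i \<noteq> 0) \<and> (\<forall>c\<in>C. (\<Sum>i\<in>N. a i c * x i) = 0)"
proof -
  obtain y where y: "\<And>x. \<exists>c\<in>C. (\<Sum>i\<in>N. a i c * x i) \<noteq> y c"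
    using assms(4) unfolding solvable_def by auto
  define a' where "a' = (\<lambda>i c. case i of None \<Rightarrow> - y c | Some i \<Rightarrow> a i c)"
  have N': "finite (insert None (Some ` N))" "card C < card (insert None (Some ` N))"
    using fin by (simp_all add: card_image)
  obtain x where x: "\<exists>i\<in>insert None (Some ` N). x i \<noteq> 0"
    "\<And>c. c \<in> C \<Longrightarrow> (\<Sum>i\<in>insert None (Some ` N). a' i c * x i) = 0"
    using more_unknowns_than_equations[OF fin(1) N', of a'] by auto
  have eq: "(\<Sum>i\<in>N. a i c * x (Some i)) = y c * x None" if "c \<in> C" for c
    using x(2)[OF that] fin by (simp add: a'_def sum.reindex)
  have "x None = 0"
  proof (rule ccontr)
    assume "x None \<noteq> 0"
    then have "(\<Sum>i\<in>N. a i c * (x (Some i) / x None)) = y c" if "c \<in> C" for c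
      using eq[OF that] by (simp add: field_simps flip: sum_divide_distrib)
    with y[of "\<lambda>i. x (Some i) / x None"] show False by auto
  qed
  with x(1) eq show ?thesis by (intro exI[of _ "\<lambda>i. x (Some i)"]) auto
qed

section \<open>Openness of solvability\<close>

text \<open>The predicate singles out the functions that are regular on the parameter set \<open>X\<close>,
  a property of their values on \<open>X\<close>.  The instances below are the polynomial functions of one variable and
  the restrictions of polynomials in the coordinates of an affine space.\<close>

locale function_algebra =
  fixes R :: "('p \<Rightarrow> 'k::field) \<Rightarrow> bool" and X :: "'p set"
  assumes R_const: "R (\<lambda>_. c)"
    and R_add: "R f \<Longrightarrow> R g \<Longrightarrow> R (\<lambda>x. f x + g x)"
    and R_mult: "R f \<Longrightarrow> R g \<Longrightarrow> R (\<lambda>x. f x * g x)"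
    and R_cong: "R f \<Longrightarrow> (\<And>x. x \<in> X \<Longrightarrow> f x = g x) \<Longrightarrow> R g"
begin

lemma R_diff: "R f \<Longrightarrow> R g \<Longrightarrow> R (\<lambda>x. f x - g x)"
  using R_add[of f "\<lambda>x. -1 * g x"] R_mult[OF R_const[of "-1"], of g] by simp

lemma R_sum: "(\<And>i. i \<in> A \<Longrightarrow> R (f i)) \<Longrightarrow> R (\<lambda>x. \<Sum>i\<in>A. f i x)"
  by (induction A rule: infinite_finite_induct) (auto intro: R_const R_add)

lemma R_prod: "(\<And>i. i \<in> A \<Longrightarrow> R (f i)) \<Longrightarrow> R (\<lambda>x. \<Prod>i\<in>A. f i x)"
  by (induction A rule: infinite_finite_induct) (auto intro: R_const R_mult)

lemma R_power: "R f \<Longrightarrow> R (\<lambda>x. f x ^ n)"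
  by (induction n) (auto intro: R_const R_mult)

text \<open>Gaussian elimination without divisions; the witness is the product of the pivots.\<close>

lemma solvable_open:
  assumes "finite C" "finite N"
    and "\<And>i c. i \<in> N \<Longrightarrow> c \<in> C \<Longrightarrow> R (\<lambda>x. a x i c)" and "solvable (a p) N C"
  shows "\<exists>F. R F \<and> F p \<noteq> 0 \<and> (\<forall>x. F x \<noteq> 0 \<longrightarrow> solvable (a x) N C)"
  using assms
proof (induction C arbitrary: a rule: finite_induct)
  case empty
  show ?case by (intro exI[of _ "\<lambda>_. 1"]) (simp add: R_const solvable_def)
next
  case (insert c C)
  obtain z where z: "(\<Sum>i\<in>N. a p i c * z i) = 1"
    using insert.prems(3)[unfolded solvable_def, rule_format, of "\<lambda>_. 1"] by auto
  have "\<exists>j\<in>N. a p j c \<noteq> 0"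
  proof (rule ccontr)
    assume "\<not> ?thesis"
    then have "(\<Sum>i\<in>N. a p i c * z i) = 0" by simp
    with z show False by simp
  qed
  then obtain j where j: "j \<in> N" "a p j c \<noteq> 0" by auto
  define b where "b = (\<lambda>x i c'. a x j c * a x i c' - a x i c * a x j c')"
  have sum_b: "(\<Sum>i\<in>N. b x i c' * z i) = a x j c * (\<Sum>i\<in>N. a x i c' * z i) - (\<Sum>i\<in>N. a x i c * z i) * a x j c'"
    for x c' z
    by (simp add: b_def algebra_simps sum_subtractf sum_distrib_left)
  have "solvable (b p) N C"
    unfolding solvable_def
  proof
    fix y
    obtain z where z: "\<And>c'. c' \<in> insert c C \<Longrightarrow> (\<Sum>i\<in>N. a p i c' * z i) = (if c' = c then 0 else y c' / a p j c)"
      using insert.prems(3)[unfolded solvable_def, rule_format, of "\<lambda>c'. if c' = c then 0 else y c' / a p j c"] by blast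
    have "(\<Sum>i\<in>N. b p i c' * z i) = y c'" if "c' \<in> C" for c'
      using that insert.hyps j by (simp add: sum_b z) auto
    then show "\<exists>z. \<forall>c'\<in>C. (\<Sum>i\<in>N. b p i c' * z i) = y c'" by blast
  qed
  moreover have "R (\<lambda>x. b x i c')" if "i \<in> N" "c' \<in> C" for i c'
    using that j insert.prems unfolding b_def by (intro R_diff R_mult) auto
  ultimately obtain F where F: "R F" "F p \<noteq> 0" "\<And>x. F x \<noteq> 0 \<Longrightarrow> solvable (b x) N C"
    using insert.IH[of b] insert.prems(1) by blast
  have "solvable (a x) N (insert c C)" if "F x \<noteq> 0" "a x j c \<noteq> 0" for x
    unfolding solvable_def
  proof
    have bx: "solvable (b x) N C" using F(3) that by simp
    fix y
    obtain z where z: "\<And>c'. c' \<in> C \<Longrightarrow> (\<Sum>i\<in>N. b x i c' * z i) = a x j c * y c' - y c * a x j c'"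
      using bx[unfolded solvable_def, rule_format, of "\<lambda>c'. a x j c * y c' - y c * a x j c'"] by blast
    define s where "s = (y c - (\<Sum>i\<in>N. a x i c * z i)) / a x j c"
    define z' where "z' = (\<lambda>i. z i + (if i = j then s else 0))"
    have z': "(\<Sum>i\<in>N. a x i c' * z' i) = (\<Sum>i\<in>N. a x i c' * z i) + a x j c' * s" for c'
      using j insert.prems(1) by (simp add: z'_def distrib_left sum.distrib if_distrib[of "(*) _"] cong: if_cong)
    have "(\<Sum>i\<in>N. a x i c' * z' i) = y c'" if "c' \<in> insert c C" for c'
    proof (cases "c' = c")
      case True
      then show ?thesis using \<open>a x j c \<noteq> 0\<close> by (simp add: z' s_def)
    next
      case False
      then have "a x j c * (\<Sum>i\<in>N. a x i c' * z i) - (\<Sum>i\<in>N. a x i c * z i) * a x j c' = a x j c * y c' - y c * a x j c'"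
        using z[of c'] that by (simp add: sum_b)
      moreover have "a x j c * s = y c - (\<Sum>i\<in>N. a x i c * z i)"
        using \<open>a x j c \<noteq> 0\<close> by (simp add: s_def)
      ultimately have "a x j c * ((\<Sum>i\<in>N. a x i c' * z i) + a x j c' * s) = a x j c * y c'"
        by (algebra)
      with \<open>a x j c \<noteq> 0\<close> show ?thesis by (simp add: z')
    qed
    then show "\<exists>z. \<forall>c'\<in>insert c C. (\<Sum>i\<in>N. a x i c' * z i) = y c'" by blast
  qed
  with F j insert.prems show ?case
    by (intro exI[of _ "\<lambda>x. F x * a x j c"]) (auto intro: R_mult)
qed

definition R_poly :: "('p \<Rightarrow> ('x, 'k) mpoly) \<Rightarrow> bool" where
  "R_poly P \<longleftrightarrow> (\<forall>m. R (\<lambda>x. lookup (P x) m))"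

lemma R_poly_const: "R_poly (\<lambda>_. q)"
  by (simp add: R_poly_def R_const)

lemma R_poly_sum: "(\<And>i. i \<in> A \<Longrightarrow> R_poly (P i)) \<Longrightarrow> R_poly (\<lambda>x. \<Sum>i\<in>A. P i x)"
  by (simp add: R_poly_def lookup_sum R_sum)

lemma R_poly_Const_times: "R f \<Longrightarrow> R_poly P \<Longrightarrow> R_poly (\<lambda>x. Const (f x) * P x)"
  by (simp add: R_poly_def R_mult)

lemma R_poly_Monom_times:
  assumes "R_poly P"
  shows "R_poly (\<lambda>x. Monom k * P x)"
  unfolding R_poly_def
proof
  fix n
  show "R (\<lambda>x. lookup (Monom k * P x) n)"
  proof (cases "\<exists>m. n = k + m")
    case True
    then show ?thesis using assms by (auto simp: R_poly_def)
  next
    case False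
    then show ?thesis by (simp add: lookup_Monom_times_eq_0 R_const)
  qed
qed

lemma R_poly_linear_times:
  assumes "\<And>i. R (\<lambda>x. a x i)" "R_poly P"
  shows "R_poly (\<lambda>x. (\<Sum>i\<in>B. Const (a x i) * Var i) * P x)"
  unfolding sum_distrib_right mult.assoc Var_def
  by (intro R_poly_sum R_poly_Const_times R_poly_Monom_times assms)

lemma R_poly_monom_value:
  fixes P :: "'p \<Rightarrow> ('v, 'k) mpoly" and a :: "'p \<Rightarrow> 'v \<Rightarrow> 'j \<Rightarrow> 'k" and B :: "'v set"
  assumes "\<And>i j. R (\<lambda>x. a x i j)" "R_poly P"
  shows "R_poly (\<lambda>x. monom_value (\<lambda>j. \<Sum>i\<in>B. Const (a x i j) * Var i) m * P x)"
proof -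
  have pow: "R_poly (\<lambda>x. (\<Sum>i\<in>B. Const (a x i j) * Var i) ^ n * Q x)" if "R_poly Q" for j n and Q :: "'p \<Rightarrow> ('v, 'k) mpoly"
    by (induction n) (simp_all add: that mult.assoc R_poly_linear_times assms(1))
  have "R_poly (\<lambda>x. (\<Prod>j\<in>K. (\<Sum>i\<in>B. Const (a x i j) * Var i) ^ lookup m j) * P x)" for K
    by (induction K rule: infinite_finite_induct) (simp_all add: assms(2) mult.assoc pow)
  then show ?thesis by (simp add: monom_value_def)
qed

text \<open>The terms of \<open>f x\<close> vary with \<open>x\<close>; homogeneity allows a sum over all monomials of degree \<open>d\<close>
  instead.\<close>

lemma R_poly_lin_change:
  fixes f :: "'p \<Rightarrow> ('n::finite, 'k) mpoly"
  assumes A: "\<And>i j. R (\<lambda>x. A x $ i $ j)" and f: "R_poly f" and hom: "\<And>x. x \<in> X \<Longrightarrow> homogeneous d (f x)"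
  shows "R_poly (\<lambda>x. lin_change (A x) (f x))"
proof -
  define P where "P = (\<lambda>x. \<Sum>m\<in>{m. mono_deg m = d}. Const (lookup (f x) m) * 
    (monom_value (\<lambda>j. \<Sum>i\<in>UNIV. Const (A x $ i $ j) * Var i) m * 1))"
  have "R_poly P"
    unfolding P_def using f
    by (intro R_poly_sum R_poly_Const_times R_poly_monom_value R_poly_const A) (auto simp: R_poly_def)
  moreover have "P x = lin_change (A x) (f x)" if "x \<in> X" for x
    unfolding lin_change_def P_def using hom[OF that]
    by (subst Const.eval_superset[of "{m. mono_deg m = d}"]) (auto simp: homogeneous_def)
  ultimately show ?thesis
    unfolding R_poly_def using R_cong by (metis (no_types, lifting))
qed

end

section \<open>Ideals\<close>

lemma module_times: "module ((*) :: 'r::comm_ring_1 \<Rightarrow> 'r \<Rightarrow> 'r)"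
  by unfold_locales (simp_all add: algebra_simps)

abbreviation is_ideal :: "'r::comm_ring_1 set \<Rightarrow> bool" where
  "is_ideal \<equiv> module.subspace (*)"

lemma is_ideal_ideal_gen [simp]: "is_ideal (ideal_gen S)"
  unfolding ideal_gen_def by (rule module.subspace_span[OF module_times])

lemmas ideal_zero = module.subspace_0[OF module_times]
  and ideal_add = module.subspace_add[OF module_times]
  and ideal_mult = module.subspace_scale[OF module_times]
  and ideal_diff = module.subspace_diff[OF module_times]
  and ideal_sum = module.subspace_sum[OF module_times]

lemma ideal_mult_right: "is_ideal I \<Longrightarrow> p \<in> I \<Longrightarrow> p * q \<in> I"
  by (metis ideal_mult mult.commute)

lemma ideal_gen_base: "x \<in> S \<Longrightarrow> x \<in> ideal_gen S"
  unfolding ideal_gen_def by (rule module.span_base[OF module_times])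

lemma ideal_gen_minimal: "S \<subseteq> I \<Longrightarrow> is_ideal I \<Longrightarrow> ideal_gen S \<subseteq> I"
  unfolding ideal_gen_def by (rule module.span_minimal[OF module_times])

lemma ideal_gen_subset: "S \<subseteq> ideal_gen T \<Longrightarrow> ideal_gen S \<subseteq> ideal_gen T"
  by (rule ideal_gen_minimal) simp_all

lemma ideal_gen_image:
  fixes h :: "'i \<Rightarrow> 'r::comm_ring_1"
  assumes "finite N"
  shows "ideal_gen (h ` N) = {\<Sum>i\<in>N. q i * h i | q. True}" (is "_ = ?S")
proof
  show "ideal_gen (h ` N) \<subseteq> ?S"
  proof (rule ideal_gen_minimal)
    have "h j \<in> ?S" if "j \<in> N" for j
      using that assms by (intro CollectI exI[of _ "\<lambda>i. if i = j then 1 else 0"])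
        (simp add: if_distrib[of "\<lambda>x. x * _"] cong: if_cong)
    then show "h ` N \<subseteq> ?S" by blast
    show "is_ideal ?S"
    proof (rule module.subspaceI[OF module_times])
      show "0 \<in> ?S" by (intro CollectI exI[of _ "\<lambda>_. 0"]) simp
    next
      fix x y assume "x \<in> ?S" "y \<in> ?S"
      then obtain q r where "x = (\<Sum>i\<in>N. q i * h i)" "y = (\<Sum>i\<in>N. r i * h i)" by blast
      then have "x + y = (\<Sum>i\<in>N. (q i + r i) * h i)"
        by (simp add: distrib_right sum.distrib)
      then show "x + y \<in> ?S" by (intro CollectI exI[of _ "\<lambda>i. q i + r i"]) simp
    next
      fix c x assume "x \<in> ?S"
      then obtain q where "x = (\<Sum>i\<in>N. q i * h i)" by blast
      then have "c * x = (\<Sum>i\<in>N. (c * q i) * h i)"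
        by (simp add: sum_distrib_left mult.assoc)
      then show "c * x \<in> ?S" by (intro CollectI exI[of _ "\<lambda>i. c * q i"]) simp
    qed
  qed
  show "?S \<subseteq> ideal_gen (h ` N)"
  proof clarify
    fix q
    show "(\<Sum>i\<in>N. q i * h i) \<in> ideal_gen (h ` N)"
      by (intro ideal_sum[OF is_ideal_ideal_gen] ideal_mult[OF is_ideal_ideal_gen] ideal_gen_base) simp
  qed
qed

lemma range_4: "range f = {f 1, f 2, f 3, f (4::4)}"
  by (auto simp: UNIV_4)

section \<open>Linear changes of coordinates\<close>

lemma lin_change_add: "lin_change A (p + q) = lin_change A p + lin_change A q"
  and lin_change_mult: "lin_change A (p * q) = lin_change A p * lin_change A q"
  and lin_change_power: "lin_change A (p ^ n) = lin_change A p ^ n"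
  and lin_change_sum: "lin_change A (sum f B) = (\<Sum>i\<in>B. lin_change A (f i))"
  and lin_change_Const [simp]: "lin_change A (Const c) = Const c"
  and lin_change_0 [simp]: "lin_change A 0 = 0"
  and lin_change_Var: "lin_change A (Var j) = (\<Sum>i\<in>UNIV. Const (A $ i $ j) * Var i)"
  by (simp_all add: lin_change_def Const.eval_add Const.eval_mult Const.eval_sum Const.eval_Const
      Const.eval_Var Const.eval_power)

lemma lin_change_uminus: "lin_change A (- p) = - lin_change A p"
  unfolding lin_change_def by (rule eval_uminus) (rule Const.coeff_hom_axioms)

lemma lin_change_diff: "lin_change A (p - q) = lin_change A p - lin_change A q"
  using lin_change_add[of A p "- q"] by (simp add: lin_change_uminus)

lemma lin_change_Monom: "lin_change A (Monom m) = monom_value (\<lambda>j. lin_change A (Var j)) m"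
  by (simp add: lin_change_def Const.eval_Monom Const.eval_Var)

lemma lin_change_lin_change: "lin_change A (lin_change B p) = lin_change (A ** B) p"
proof -
  have "lin_change A (lin_change B (Var j)) = lin_change (A ** B) (Var j)" for j
  proof -
    have "lin_change A (lin_change B (Var j)) = (\<Sum>i\<in>UNIV. \<Sum>k\<in>UNIV. Const (A $ k $ i * B $ i $ j) * Var k)"
      by (simp add: lin_change_Var lin_change_sum lin_change_mult Const_mult sum_distrib_left ac_simps)
    also have "\<dots> = lin_change (A ** B) (Var j)"
      by (subst sum.swap) (simp add: lin_change_Var matrix_matrix_mult_def Const_sum sum_distrib_right)
    finally show ?thesis .
  qed
  then show ?thesis
    by (simp add: lin_change_def eval_hom_compose Const.eval_Var)
qed

lemma lin_change_mat_1: "lin_change (mat 1) p = p"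
proof -
  have "(\<Sum>i\<in>UNIV. Const (mat 1 $ i $ j) * Var i) = (Var j :: ('a, 'b) mpoly)" for j
    by (simp add: mat_def if_distrib[of Const] if_distrib[of "\<lambda>x. x * _"] cong: if_cong)
  then show ?thesis by (simp add: lin_change_def eval_hom_Const_Var)
qed

lemma homogeneous_lin_form: "homogeneous 1 (\<Sum>i\<in>B. Const (c i) * Var i :: ('x, 'a::comm_semiring_1) mpoly)"
  by (intro homogeneous_sum homogeneous_Const_times homogeneous_Var)

lemma homogeneous_lin_change: "homogeneous d p \<Longrightarrow> homogeneous d (lin_change A p)"
  unfolding lin_change_def by (intro homogeneous_eval_hom homogeneous_lin_form)

lemma GL_lin_change_onto:
  assumes "A \<in> GL" "homogeneous d p"
  obtains q where "homogeneous d q" "p = lin_change A q"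
proof -
  from assms obtain B where "A ** B = mat 1" by (auto simp: GL_def invertible_def)
  then have "p = lin_change A (lin_change B p)"
    by (simp add: lin_change_lin_change lin_change_mat_1)
  with that assms show ?thesis by (auto intro: homogeneous_lin_change)
qed

text \<open>An invertible substitution is an automorphism of the polynomial ring.\<close>

lemma lin_change_ideal_gen:
  fixes S :: "('n::finite, 'a::field) mpoly set"
  assumes "A \<in> GL"
  shows "lin_change A ` ideal_gen S = ideal_gen (lin_change A ` S)"
proof -
  from assms obtain B where AB: "A ** B = mat 1" and BA: "B ** A = mat 1"
    by (auto simp: GL_def invertible_def)
  have sub: "is_ideal (lin_change C ` I)" if "C ** D = mat 1" "is_ideal I" for C D and I :: "('n, 'a) mpoly set"
  proof (rule module.subspaceI[OF module_times])
    show "0 \<in> lin_change C ` I" using that(2) by (metis ideal_zero image_eqI lin_change_0)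
  next
    fix x y assume "x \<in> lin_change C ` I" "y \<in> lin_change C ` I"
    then show "x + y \<in> lin_change C ` I"
      using ideal_add[OF that(2)] by (auto simp flip: lin_change_add)
  next
    fix c x assume "x \<in> lin_change C ` I"
    then obtain y where "y \<in> I" "x = lin_change C y" by auto
    moreover have "c = lin_change C (lin_change D c)"
      by (simp add: lin_change_lin_change lin_change_mat_1 that)
    ultimately have "c * x = lin_change C (lin_change D c * y)" by (simp add: lin_change_mult)
    then show "c * x \<in> lin_change C ` I"
      using ideal_mult[OF that(2) \<open>y \<in> I\<close>] by auto
  qed
  have AB': "lin_change A (lin_change B p) = p" and BA': "lin_change B (lin_change A p) = p" for p
    by (simp_all add: lin_change_lin_change lin_change_mat_1 AB BA)
  show ?thesis
  proof
    have "ideal_gen S \<subseteq> lin_change B ` ideal_gen (lin_change A ` S)"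
    proof (rule ideal_gen_minimal)
      show "S \<subseteq> lin_change B ` ideal_gen (lin_change A ` S)"
      proof
        fix s assume "s \<in> S"
        then have "lin_change A s \<in> ideal_gen (lin_change A ` S)" by (intro ideal_gen_base) auto
        then show "s \<in> lin_change B ` ideal_gen (lin_change A ` S)" by (metis BA' image_eqI)
      qed
    qed (rule sub[OF BA], simp)
    then show "lin_change A ` ideal_gen S \<subseteq> ideal_gen (lin_change A ` S)"
      using AB' by auto
  next
    show "ideal_gen (lin_change A ` S) \<subseteq> lin_change A ` ideal_gen S"
      by (intro ideal_gen_minimal sub[OF AB]) (auto intro: ideal_gen_base)
  qed
qed

section \<open>Zariski open sets and polynomial functions\<close>

definition poly_fun :: "('k \<Rightarrow> 'k::field) \<Rightarrow> bool" where
  "poly_fun f \<longleftrightarrow> (\<exists>P. \<forall>s. f s = poly P s)"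

interpretation poly_fun: function_algebra poly_fun UNIV
proof
  show "poly_fun (\<lambda>_. c :: 'a)" for c unfolding poly_fun_def by (intro exI[of _ "[:c:]"]) simp
  fix f g :: "'a \<Rightarrow> 'a"
  assume "poly_fun f" "poly_fun g"
  then obtain P Q where "\<And>s. f s = poly P s" "\<And>s. g s = poly Q s" unfolding poly_fun_def by auto
  then show "poly_fun (\<lambda>x. f x + g x)" "poly_fun (\<lambda>x. f x * g x)"
    unfolding poly_fun_def by (auto intro: exI[of _ "P + Q"] exI[of _ "P * Q"])
next
  fix f g :: "'a \<Rightarrow> 'a"
  assume "poly_fun f" "\<And>x. x \<in> UNIV \<Longrightarrow> f x = g x"
  then show "poly_fun g" by (simp add: poly_fun_def)
qed

lemma poly_fun_id: "poly_fun (\<lambda>s. s)"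
  unfolding poly_fun_def by (intro exI[of _ "[:0, 1:]"]) simp

lemma finite_zeros_poly_fun:
  assumes "poly_fun f" "f t \<noteq> 0"
  shows "finite {s. f s = 0}"
proof -
  obtain P where P: "\<And>s. f s = poly P s" using assms unfolding poly_fun_def by auto
  with assms(2) have "P \<noteq> 0" by auto
  then show ?thesis using poly_roots_finite[of P] by (simp add: P)
qed

definition zariski_fun :: "('p \<Rightarrow> 'c \<Rightarrow> 'k::field) \<Rightarrow> 'p set \<Rightarrow> ('p \<Rightarrow> 'k) \<Rightarrow> bool" where
  "zariski_fun \<phi> X f \<longleftrightarrow> (\<exists>P. \<forall>x\<in>X. f x = eval_at (\<phi> x) P)"

interpretation eval_at: coeff_hom "\<lambda>c :: 'a::comm_semiring_1. c"
  by (rule coeff_hom_id)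

lemma function_algebra_zariski_fun: "function_algebra (zariski_fun \<phi> X) X"
proof
  show "zariski_fun \<phi> X (\<lambda>_. c)" for c
    unfolding zariski_fun_def by (intro exI[of _ "Const c"]) (simp add: eval_at.eval_Const)
  fix f g
  assume "zariski_fun \<phi> X f" "zariski_fun \<phi> X g"
  then obtain P Q where "\<And>x. x \<in> X \<Longrightarrow> f x = eval_at (\<phi> x) P" "\<And>x. x \<in> X \<Longrightarrow> g x = eval_at (\<phi> x) Q"
    unfolding zariski_fun_def by auto
  then have "\<forall>x\<in>X. f x + g x = eval_at (\<phi> x) (P + Q)" "\<forall>x\<in>X. f x * g x = eval_at (\<phi> x) (P * Q)"
    by (simp_all add: eval_at.eval_add eval_at.eval_mult)
  then show "zariski_fun \<phi> X (\<lambda>x. f x + g x)" "zariski_fun \<phi> X (\<lambda>x. f x * g x)"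
    unfolding zariski_fun_def by blast+
next
  fix f g assume "zariski_fun \<phi> X f" "\<And>x. x \<in> X \<Longrightarrow> f x = g x"
  then show "zariski_fun \<phi> X g" by (auto simp: zariski_fun_def)
qed

lemma zariski_fun_coord: "zariski_fun \<phi> X (\<lambda>x. \<phi> x c)"
  unfolding zariski_fun_def by (intro exI[of _ "Var c"]) (simp add: eval_at.eval_Var)

lemma zariski_open_nonzero:
  assumes "zariski_fun \<phi> X f"
  shows "zariski_open_in \<phi> X {x \<in> X. f x \<noteq> 0}"
proof -
  obtain P where "\<And>x. x \<in> X \<Longrightarrow> f x = eval_at (\<phi> x) P" using assms unfolding zariski_fun_def by auto
  then show ?thesis unfolding zariski_open_in_def by (intro exI[of _ "{P}"]) auto
qed

lemma zariski_open_basis: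
  assumes "zariski_open_in \<phi> X U" "x \<in> U"
  obtains P where "eval_at (\<phi> x) P \<noteq> 0" "\<And>y. y \<in> X \<Longrightarrow> eval_at (\<phi> y) P \<noteq> 0 \<Longrightarrow> y \<in> U"
  using assms unfolding zariski_open_in_def by blast

text \<open>Irreducibility of \<^term>\<open>GL\<close>: on the line through two matrices each of the relevant
  polynomials, the determinant included, has only finitely many zeros.\<close>

lemma GL_opens_meet:
  fixes U V :: "('k::field_char_0 ^ 'n ^ 'n) set"
  assumes U: "zariski_open_in (\<lambda>A (i, j). A $ i $ j) GL U" "U \<noteq> {}"
    and V: "zariski_open_in (\<lambda>A (i, j). A $ i $ j) GL V" "V \<noteq> {}"
  shows "U \<inter> V \<noteq> {}"
proof -
  let ?\<phi> = "\<lambda>(A :: 'k ^ 'n ^ 'n) (i, j). A $ i $ j"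
  obtain A B where A: "A \<in> U" and B: "B \<in> V" using U V by auto
  obtain P where P: "eval_at (?\<phi> A) P \<noteq> 0" "\<And>C. C \<in> GL \<Longrightarrow> eval_at (?\<phi> C) P \<noteq> 0 \<Longrightarrow> C \<in> U"
    using zariski_open_basis[OF U(1) A] by blast
  obtain Q where Q: "eval_at (?\<phi> B) Q \<noteq> 0" "\<And>C. C \<in> GL \<Longrightarrow> eval_at (?\<phi> C) Q \<noteq> 0 \<Longrightarrow> C \<in> V"
    using zariski_open_basis[OF V(1) B] by blast
  have "A \<in> GL" using A U(1) by (auto simp: zariski_open_in_def)
  define C where "C = (\<lambda>s. \<chi> i j. A $ i $ j + s * (B $ i $ j - A $ i $ j))"
  have C0: "C 0 = A" and C1: "C 1 = B" by (simp_all add: C_def vec_eq_iff)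
  have coord: "poly_fun (\<lambda>s. C s $ i $ j)" for i j
    unfolding C_def by (simp, intro poly_fun.R_add poly_fun.R_mult poly_fun.R_const poly_fun_id)
  have ev: "poly_fun (\<lambda>s. eval_at (?\<phi> (C s)) R)" for R
  proof -
    have "poly_fun (\<lambda>s. ?\<phi> (C s) x)" for x
      by (cases x) (simp add: coord)
    then show ?thesis
      unfolding eval_hom_def
      by (intro poly_fun.R_sum poly_fun.R_mult poly_fun.R_prod poly_fun.R_power poly_fun.R_const)
  qed
  have det: "poly_fun (\<lambda>s. det (C s))"
    unfolding det_def by (intro poly_fun.R_sum poly_fun.R_mult poly_fun.R_prod poly_fun.R_const coord)
  have "finite ({s. eval_at (?\<phi> (C s)) P = 0} \<union> {s. eval_at (?\<phi> (C s)) Q = 0} \<union> {s. det (C s) = 0})"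
    using P(1) Q(1) \<open>A \<in> GL\<close> C0 C1
    by (intro finite_UnI finite_zeros_poly_fun[OF ev, of 0] finite_zeros_poly_fun[OF ev, of 1] finite_zeros_poly_fun[OF det, of 0])
      (simp_all add: GL_def invertible_det_nz)
  then obtain s where "s \<notin> {s. eval_at (?\<phi> (C s)) P = 0} \<union> {s. eval_at (?\<phi> (C s)) Q = 0} \<union> {s. det (C s) = 0}"
    using ex_new_if_finite[OF infinite_UNIV_char_0] by meson
  then have "C s \<in> U \<inter> V"
    using P(2)[of "C s"] Q(2)[of "C s"] by (simp add: GL_def invertible_det_nz)
  then show ?thesis by blast
qed

text \<open>The common value is unique because any two nonempty open sets of matrices meet.\<close>

lemma Gin_eqI:
  fixes I :: "(4, 'k::field_char_0) mpoly set"
  assumes "zariski_open_in (\<lambda>A (i, j). A $ i $ j) GL U" "U \<noteq> {}"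
    and "\<And>A. A \<in> U \<Longrightarrow> initial_ideal (lin_change A ` I) = J"
  shows "Gin I = J"
  unfolding Gin_def
proof (rule the_equality)
  show "\<exists>U. U \<noteq> {} \<and> zariski_open_in (\<lambda>A (i, j). A $ i $ j) GL U
      \<and> (\<forall>A\<in>U. initial_ideal (lin_change A ` I) = J)"
    using assms by blast
next
  fix J' assume "\<exists>V. V \<noteq> {} \<and> zariski_open_in (\<lambda>A (i, j). A $ i $ j) GL V
      \<and> (\<forall>A\<in>V. initial_ideal (lin_change A ` I) = J')"
  then obtain V where V: "V \<noteq> {}" "zariski_open_in (\<lambda>A (i, j). A $ i $ j) GL V"
    "\<And>A. A \<in> V \<Longrightarrow> initial_ideal (lin_change A ` I) = J'" by auto
  then obtain A where "A \<in> U" "A \<in> V" using GL_opens_meet[OF assms(1,2) V(2,1)] by auto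
  with assms(3) V(3) show "J' = J" by metis
qed

section \<open>Regular sequences\<close>

text \<open>The syzygies of a regular sequence are generated by the Koszul syzygies; only the consequence
  for a single coefficient is recorded.\<close>

lemma regular_sequence_syzygy:
  assumes reg: "regular_sequence fs" and "k \<le> length fs"
    and "(\<Sum>j<k. g j * fs ! j) = 0" "i < k"
  shows "g i \<in> ideal_gen ((!) fs ` ({..<k} - {i}))"
  using assms(2-)
proof (induction k arbitrary: g i)
  case (Suc k)
  have take: "set (take k fs) = (!) fs ` {..<k}"
    using Suc.prems(1) nth_image[of k fs] by (simp add: atLeast0LessThan)
  have "fs ! k * g k = (\<Sum>j<k. (- g j) * fs ! j)"
    using Suc.prems(2) by (simp add: sum_negf eq_neg_iff_add_eq_0 ac_simps)
  then have "fs ! k * g k \<in> ideal_gen (set (take k fs))"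
    unfolding take ideal_gen_image[OF finite_lessThan] by (intro CollectI exI[of _ "\<lambda>j. - g j"]) simp
  then have gk: "g k \<in> ideal_gen ((!) fs ` {..<k})"
    using reg Suc.prems(1) unfolding regular_sequence_def take[symmetric] by auto
  show ?case
  proof (cases "i = k")
    case True
    then have "{..<Suc k} - {i} = {..<k}" by auto
    with gk True show ?thesis by simp
  next
    case False
    with Suc.prems have "i < k" by simp
    obtain c where c: "g k = (\<Sum>j<k. c j * fs ! j)"
      using gk unfolding ideal_gen_image[OF finite_lessThan] by blast
    have "(\<Sum>j<k. (g j + c j * fs ! k) * fs ! j) = (\<Sum>j<k. g j * fs ! j) + g k * fs ! k"
      unfolding c by (simp add: distrib_right distrib_left sum.distrib sum_distrib_left ac_simps)
    also have "\<dots> = 0" using Suc.prems(2) by simp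
    finally have IH: "g i + c i * fs ! k \<in> ideal_gen ((!) fs ` ({..<k} - {i}))"
      using Suc.IH[of "\<lambda>j. g j + c j * fs ! k"] Suc.prems(1) \<open>i < k\<close> by simp
    let ?J = "ideal_gen ((!) fs ` ({..<Suc k} - {i}))"
    have "ideal_gen ((!) fs ` ({..<k} - {i})) \<subseteq> ?J"
      by (intro ideal_gen_subset) (auto intro!: ideal_gen_base)
    moreover have "c i * fs ! k \<in> ?J"
      using \<open>i < k\<close> by (intro ideal_mult[OF is_ideal_ideal_gen] ideal_gen_base) auto
    ultimately have "(g i + c i * fs ! k) - c i * fs ! k \<in> ?J"
      using IH by (intro ideal_diff[OF is_ideal_ideal_gen]) auto
    then show ?thesis by simp
  qed
qed simp

text \<open>The hypothesis is a syzygy in which \<open>p\<close> is the coefficient of the \<open>i\<close>-th element.\<close>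

lemma regular_sequence_cancel:
  assumes reg: "regular_sequence fs" and i: "i < length fs"
    and "fs ! i * p \<in> ideal_gen ((!) fs ` ({..<length fs} - {i}))"
  shows "p \<in> ideal_gen ((!) fs ` ({..<length fs} - {i}))"
proof -
  obtain q where q: "fs ! i * p = (\<Sum>j\<in>{..<length fs} - {i}. q j * fs ! j)"
    using assms(3) unfolding ideal_gen_image[OF finite_Diff[OF finite_lessThan]] by blast
  define g where "g = (\<lambda>j. if j = i then p else - q j)"
  have "(\<Sum>j<length fs. g j * fs ! j) = g i * fs ! i + (\<Sum>j\<in>{..<length fs} - {i}. g j * fs ! j)"
    using i by (intro sum.remove) auto
  also have "(\<Sum>j\<in>{..<length fs} - {i}. g j * fs ! j) = - (\<Sum>j\<in>{..<length fs} - {i}. q j * fs ! j)"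
    by (simp add: g_def flip: sum_negf)
  finally have "(\<Sum>j<length fs. g j * fs ! j) = 0"
    by (simp add: g_def flip: q)
  from regular_sequence_syzygy[OF reg order_refl this i] show ?thesis by (simp add: g_def)
qed

definition ideal_radical :: "'r::comm_ring_1 set \<Rightarrow> 'r set" where
  "ideal_radical I = {p. \<exists>n. p ^ n \<in> I}"

lemma is_ideal_ideal_radical:
  assumes "is_ideal I"
  shows "is_ideal (ideal_radical I)"
proof (rule module.subspaceI[OF module_times])
  have "0 ^ 1 \<in> I" using assms by (simp add: ideal_zero)
  then show "0 \<in> ideal_radical I" unfolding ideal_radical_def by blast
next
  fix p q assume "p \<in> ideal_radical I" "q \<in> ideal_radical I"
  then obtain m n where mn: "p ^ m \<in> I" "q ^ n \<in> I" by (auto simp: ideal_radical_def)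
  have "of_nat (m + n choose k) * p ^ k * q ^ (m + n - k) \<in> I" for k
  proof (cases "k < m")
    case True
    then have "m + n - k = n + (m - k)" by simp
    then have "q ^ (m + n - k) = q ^ n * q ^ (m - k)" by (simp only: power_add)
    then show ?thesis using mn(2) by (simp only: ideal_mult[OF assms] ideal_mult_right[OF assms])
  next
    case False
    then have "p ^ k = p ^ m * p ^ (k - m)" by (simp flip: power_add)
    then show ?thesis using mn(1) by (simp only: ideal_mult[OF assms] ideal_mult_right[OF assms])
  qed
  then have "(p + q) ^ (m + n) \<in> I"
    unfolding binomial_ring by (intro ideal_sum[OF assms])
  then show "p + q \<in> ideal_radical I" unfolding ideal_radical_def by blast
next
  fix c p assume "p \<in> ideal_radical I"
  then obtain n where "p ^ n \<in> I" by (auto simp: ideal_radical_def)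
  then have "(c * p) ^ n \<in> I" by (auto simp: power_mult_distrib intro: ideal_mult[OF assms])
  then show "c * p \<in> ideal_radical I" unfolding ideal_radical_def by blast
qed

lemma subset_radical: "p \<in> I \<Longrightarrow> p \<in> ideal_radical I"
  unfolding ideal_radical_def by (auto intro: exI[of _ 1])

lemma radical_power: "p ^ n \<in> ideal_radical I \<Longrightarrow> p \<in> ideal_radical I"
  unfolding ideal_radical_def by (auto simp flip: power_mult)

lemma regular_sequence_not_in_radical:
  assumes reg: "regular_sequence fs" and i: "i < length fs"
  shows "fs ! i \<notin> ideal_radical (ideal_gen ((!) fs ` ({..<length fs} - {i})))"
proof
  let ?K = "ideal_gen ((!) fs ` ({..<length fs} - {i}))"
  assume "fs ! i \<in> ideal_radical ?K"
  then obtain n where "(fs ! i) ^ n \<in> ?K" by (auto simp: ideal_radical_def)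
  then have "1 \<in> ?K"
    by (induction n) (auto dest: regular_sequence_cancel[OF reg i])
  moreover have "?K \<subseteq> ideal_gen (set fs)"
    by (intro ideal_gen_subset) (auto intro!: ideal_gen_base)
  ultimately have "x \<in> ideal_gen (set fs)" for x
    using ideal_mult[OF is_ideal_ideal_gen, of 1 "set fs" x] by auto
  with reg show False by (auto simp: regular_sequence_def)
qed

lemma Monom_eq_Var_times:
  assumes "y \<in> keys m"
  shows "Monom m = (Var y * Monom (m - Poly_Mapping.single y 1) :: ('x, 'a::comm_semiring_1) mpoly)"
proof -
  have "m = Poly_Mapping.single y 1 + (m - Poly_Mapping.single y 1)"
    using assms by (intro poly_mapping_eqI) (auto simp: lookup_add lookup_minus lookup_single when_def in_keys_iff)
  then show ?thesis unfolding Var_def by (metis Monom_add)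
qed

lemma keys_subset_singleton: "keys m \<subseteq> {x} \<Longrightarrow> m = Poly_Mapping.single x (mono_deg m)"
  by (intro poly_mapping_eqI)
    (use mono_deg_superset[of "{x}" m] in \<open>auto simp: lookup_single when_def in_keys_iff\<close>)

lemma Monom_single: "Monom (Poly_Mapping.single x n) = (Var x ^ n :: ('x, 'a::comm_semiring_1) mpoly)"
  by (simp add: Monom_eq_monom_value)

text \<open>Any other monomial of the form contains one of the other variables.\<close>

lemma form_minus_pure_power:
  fixes f :: "('x, 'a::comm_ring_1) mpoly"
  assumes P: "is_ideal P" and f: "homogeneous d f" "vars f \<subseteq> V"
    and V: "\<And>y. y \<in> V \<Longrightarrow> y \<noteq> x \<Longrightarrow> Var y \<in> P"
  shows "f - Const (lookup f (Poly_Mapping.single x d)) * Var x ^ d \<in> P"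
proof -
  let ?s = "Poly_Mapping.single x d"
  let ?F = "insert ?s (keys f)"
  have sub: "a = b + c \<Longrightarrow> a - b = c" for a b c :: "('x, 'a) mpoly" by simp
  have "f = (\<Sum>m\<in>?F. Const (lookup f m) * Monom m)"
    by (rule mpoly_eq_sum) auto
  also have "\<dots> = Const (lookup f ?s) * Monom ?s + (\<Sum>m\<in>?F - {?s}. Const (lookup f m) * Monom m)"
    by (rule sum.remove) auto
  finally have "f - Const (lookup f ?s) * Var x ^ d = (\<Sum>m\<in>?F - {?s}. Const (lookup f m) * Monom m)"
    unfolding Monom_single by (rule sub)
  also have "\<dots> \<in> P"
  proof (intro ideal_sum[OF P] ideal_mult[OF P])
    fix m assume m: "m \<in> ?F - {?s}"
    then have "mono_deg m = d" "keys m \<subseteq> V" using f by (auto simp: homogeneous_def vars_def)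
    moreover have "\<not> keys m \<subseteq> {x}" using m keys_subset_singleton[of m x] \<open>mono_deg m = d\<close> by auto
    ultimately obtain y where "y \<in> keys m" "y \<noteq> x" "y \<in> V" by auto
    then show "Monom m \<in> P"
      using ideal_mult_right[OF P V] by (simp add: Monom_eq_Var_times)
  qed
  finally show ?thesis .
qed

lemma Var_in_radical:
  fixes f :: "('x, 'a::field) mpoly"
  assumes P: "is_ideal I" and f: "homogeneous d f" "vars f \<subseteq> V"
    and V: "\<And>y. y \<in> V \<Longrightarrow> y \<noteq> x \<Longrightarrow> Var y \<in> ideal_radical I"
    and "f \<in> I" "lookup f (Poly_Mapping.single x d) \<noteq> 0"
  shows "Var x \<in> ideal_radical I"
proof -
  let ?c = "lookup f (Poly_Mapping.single x d)"
  have R: "is_ideal (ideal_radical I)" by (rule is_ideal_ideal_radical[OF P])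
  have "f - (f - Const ?c * Var x ^ d) \<in> ideal_radical I"
    by (intro ideal_diff[OF R] form_minus_pure_power[OF R f V] subset_radical assms)
  then have "Const ?c * Var x ^ d \<in> ideal_radical I" by simp
  then have "Const (inverse ?c) * (Const ?c * Var x ^ d) \<in> ideal_radical I"
    by (rule ideal_mult[OF R])
  also have "Const (inverse ?c) * (Const ?c * Var x ^ d) = Var x ^ d"
    using assms(6) by (simp flip: mult.assoc Const_mult)
  finally show ?thesis by (rule radical_power)
qed

text \<open>If the coefficient of the pure power vanishes, then the form is a combination of the later
  variables, which are nilpotent modulo the later forms.\<close>

lemma triangular_regular_sequence:
  fixes f1 f2 f3 f4 :: "(4, 'a::field) mpoly"
  assumes hom: "homogeneous d f1" "homogeneous d f2" "homogeneous d f3" "homogeneous d f4"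
    and vars: "vars f1 \<subseteq> {1, 2, 3, 4}" "vars f2 \<subseteq> {2, 3, 4}" "vars f3 \<subseteq> {3, 4}" "vars f4 \<subseteq> {4}"
    and reg: "regular_sequence [f1, f2, f3, f4]"
  shows "lookup f1 (Poly_Mapping.single 1 d) \<noteq> 0" "lookup f2 (Poly_Mapping.single 2 d) \<noteq> 0"
    "lookup f3 (Poly_Mapping.single 3 d) \<noteq> 0" "lookup f4 (Poly_Mapping.single 4 d) \<noteq> 0"
proof -
  let ?fs = "[f1, f2, f3, f4]"
  define K where "K = (\<lambda>i. ideal_gen ((!) ?fs ` ({..<length ?fs} - {i})))"
  have K: "is_ideal (K i)" for i by (simp add: K_def)
  have R: "is_ideal (ideal_radical (K i))" for i by (rule is_ideal_ideal_radical[OF K])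
  have mem: "f1 \<in> K i" if "i \<in> {1, 2, 3}" for i
    unfolding K_def using that by (intro ideal_gen_base image_eqI[of _ _ 0]) auto
  have mem2: "f2 \<in> K i" if "i \<in> {0, 2, 3}" for i
    unfolding K_def using that by (intro ideal_gen_base image_eqI[of _ _ 1]) auto
  have mem3: "f3 \<in> K i" if "i \<in> {0, 1, 3}" for i
    unfolding K_def using that by (intro ideal_gen_base image_eqI[of _ _ 2]) auto
  have mem4: "f4 \<in> K i" if "i \<in> {0, 1, 2}" for i
    unfolding K_def using that by (intro ideal_gen_base image_eqI[of _ _ 3]) auto
  have coeff: "lookup (?fs ! i) (Poly_Mapping.single x d) \<noteq> 0"
    if "i < 4" "homogeneous d (?fs ! i)" "vars (?fs ! i) \<subseteq> V"
      "\<And>y. y \<in> V \<Longrightarrow> y \<noteq> x \<Longrightarrow> Var y \<in> ideal_radical (K i)" for i x V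
  proof
    assume "lookup (?fs ! i) (Poly_Mapping.single x d) = 0"
    then have "?fs ! i \<in> ideal_radical (K i)"
      using form_minus_pure_power[OF R that(2,3), of x] that(4) by simp
    with regular_sequence_not_in_radical[OF reg, of i] that(1) show False
      by (simp add: K_def)
  qed
  show c4: "lookup f4 (Poly_Mapping.single 4 d) \<noteq> 0"
    using coeff[of 3 "{4}" 4] hom vars by simp
  have x4: "Var 4 \<in> ideal_radical (K i)" if "i \<in> {0, 1, 2}" for i
    by (rule Var_in_radical[OF K hom(4) vars(4) _ mem4[OF that] c4]) auto
  show c3: "lookup f3 (Poly_Mapping.single 3 d) \<noteq> 0"
    using coeff[of 2 "{3, 4}" 3] hom vars x4[of 2] by auto
  have x3: "Var 3 \<in> ideal_radical (K i)" if "i \<in> {0, 1}" for i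
    by (rule Var_in_radical[OF K hom(3) vars(3) _ _ c3]) (use that x4 mem3 in auto)
  show c2: "lookup f2 (Poly_Mapping.single 2 d) \<noteq> 0"
    using coeff[of 1 "{2, 3, 4}" 2] hom vars x3[of 1] x4[of 1] by auto
  have x2: "Var 2 \<in> ideal_radical (K 0)"
    by (rule Var_in_radical[OF K hom(2) vars(2) _ _ c2]) (use x3 x4 mem2 in auto)
  show "lookup f1 (Poly_Mapping.single 1 d) \<noteq> 0"
    using coeff[of 0 "{1, 2, 3, 4}" 1] hom vars x2 x3[of 0] x4[of 0] by auto
qed

section \<open>Exponents in four variables\<close>

definition mon4 :: "nat \<Rightarrow> nat \<Rightarrow> nat \<Rightarrow> nat \<Rightarrow> 4 \<Rightarrow>\<^sub>0 nat" where
  "mon4 a b c e = Poly_Mapping.single 1 a + Poly_Mapping.single 2 b + Poly_Mapping.single 3 c + Poly_Mapping.single 4 e"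

lemma lookup_mon4 [simp]:
  "lookup (mon4 a b c e) 1 = a" "lookup (mon4 a b c e) 2 = b"
  "lookup (mon4 a b c e) 3 = c" "lookup (mon4 a b c e) 4 = e"
  by (simp_all add: mon4_def lookup_add lookup_single when_def)

lemma exponents_eqI:
  "lookup m 1 = lookup n 1 \<Longrightarrow> lookup m 2 = lookup n 2 \<Longrightarrow> lookup m 3 = lookup n 3 \<Longrightarrow>
    lookup m 4 = lookup n 4 \<Longrightarrow> m = (n :: 4 \<Rightarrow>\<^sub>0 nat)"
  by (rule poly_mapping_eqI) (metis exhaust_4)

lemma mon4_lookup: "mon4 (lookup m 1) (lookup m 2) (lookup m 3) (lookup m 4) = m"
  by (rule exponents_eqI) simp_all

lemma mon4_eq_iff: "mon4 a b c e = m \<longleftrightarrow> a = lookup m 1 \<and> b = lookup m 2 \<and> c = lookup m 3 \<and> e = lookup m 4"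
  using mon4_lookup by auto

lemma mono_deg_4: "mono_deg m = lookup m 1 + lookup m 2 + lookup m 3 + lookup m (4::4)"
  by (simp add: mono_deg_UNIV sum_4)

lemma mon4_add: "mon4 a b c e + mon4 a' b' c' e' = mon4 (a + a') (b + b') (c + c') (e + e')"
  by (rule exponents_eqI) (simp_all add: lookup_add)

lemma card_exponents:
  assumes "\<And>a b c. P a b c \<Longrightarrow> a < k \<and> b < k \<and> c < (k::nat)"
  shows "card {m. P (lookup m 1) (lookup m 2) (lookup m 3) \<and> lookup m (4::4) < f (lookup m 1) (lookup m 2) (lookup m 3)}
    = (\<Sum>a<k. \<Sum>b<k. \<Sum>c<k. if P a b c then f a b c else 0)" (is "card ?S = _")
proof -
  let ?T = "SIGMA a:{..<k}. SIGMA b:{..<k}. SIGMA c:{..<k}. if P a b c then {..<f a b c} else {}"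
  have "bij_betw (\<lambda>(a, b, c, e). mon4 a b c e) ?T ?S"
    by (rule bij_betw_byWitness[where f' = "\<lambda>m. (lookup m 1, lookup m 2, lookup m 3, lookup m 4)"])
      (auto simp: mon4_lookup split: if_splits dest: assms)
  then have "card ?S = card ?T" by (simp add: bij_betw_same_card)
  also have "\<dots> = (\<Sum>a<k. \<Sum>b<k. \<Sum>c<k. if P a b c then f a b c else 0)"
    by (subst card_SigmaI; (intro ballI finite_SigmaI)?; simp)+ (intro sum.cong refl, simp)
  finally show ?thesis .
qed

lemma revlex_less_add: "revlex_less (k + m) (k + n) \<longleftrightarrow> revlex_less m n"
  by (auto simp: revlex_less_def lookup_add)

lemma revlex_less_irrefl: "\<not> revlex_less m m"
  by (auto simp: revlex_less_def)

lemma revlex_less_trans: "revlex_less m n \<Longrightarrow> revlex_less n k \<Longrightarrow> revlex_less m k"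
  by (auto simp: revlex_less_def)

section \<open>Leading monomials\<close>

definition LM :: "(4, 'a::field) mpoly set \<Rightarrow> (4 \<Rightarrow>\<^sub>0 nat) set" where
  "LM I = {m. \<exists>p\<in>I. is_lead_mono p m}"

lemma initial_ideal_LM: "initial_ideal I = ideal_gen (Monom ` LM I)"
  unfolding initial_ideal_def LM_def by (rule arg_cong[of _ _ ideal_gen]) auto

lemma LM_add:
  assumes "is_ideal I" "m \<in> LM I"
  shows "k + m \<in> LM I"
proof -
  obtain p where p: "p \<in> I" "is_lead_mono p m" using assms(2) by (auto simp: LM_def)
  have "keys (Monom k * p) \<subseteq> (+) k ` keys p"
    using keys_mult[of "Monom k" p] by auto
  moreover have "k + m \<in> keys (Monom k * p)"
    using p(2) by (simp add: in_keys_iff is_lead_mono_def)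
  ultimately have "is_lead_mono (Monom k * p) (k + m)"
    using p(2) by (fastforce simp: is_lead_mono_def revlex_less_add)
  moreover have "Monom k * p \<in> I" by (rule ideal_mult[OF assms(1) p(1)])
  ultimately show ?thesis by (auto simp: LM_def)
qed

text \<open>The largest leading monomial that occurs with a nonzero factor cannot cancel.\<close>

lemma lead_monos_independent:
  assumes "finite M" and lead: "\<And>m. m \<in> M \<Longrightarrow> is_lead_mono (p m) m"
    and sum: "(\<Sum>m\<in>M. Const (x m) * p m) = (0 :: (4, 'a::field) mpoly)" and "m \<in> M"
  shows "x m = 0"
proof (rule ccontr)
  assume "x m \<noteq> 0"
  define S where "S = {m \<in> M. x m \<noteq> 0}"
  have "finite S" "S \<noteq> {}" using assms(1) \<open>x m \<noteq> 0\<close> \<open>m \<in> M\<close> by (auto simp: S_def)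
  moreover have "asymp_on S revlex_less" "transp_on S revlex_less"
    by (auto intro!: asymp_onI transp_onI dest: revlex_less_trans simp: revlex_less_irrefl)
  ultimately obtain m0 where m0: "m0 \<in> S" "\<And>n. n \<in> S \<Longrightarrow> n \<noteq> m0 \<Longrightarrow> \<not> revlex_less m0 n"
    using Finite_Set.bex_max_element[of S revlex_less] by blast
  have "x n * lookup (p n) m0 = 0" if "n \<in> M - {m0}" for n
  proof (rule ccontr)
    assume "x n * lookup (p n) m0 \<noteq> 0"
    then have "n \<in> S" "m0 \<in> keys (p n)" using that by (auto simp: S_def in_keys_iff)
    with lead[of n] m0(2)[of n] that show False by (auto simp: is_lead_mono_def)
  qed
  then have "(\<Sum>n\<in>M - {m0}. x n * lookup (p n) m0) = 0"
    by (rule sum.neutral[OF ballI])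
  then have "(\<Sum>n\<in>M. x n * lookup (p n) m0) = x m0 * lookup (p m0) m0"
    using assms(1) m0(1) by (subst sum.remove[of M m0]) (auto simp: S_def)
  also have "\<dots> \<noteq> 0"
    using m0(1) lead[of m0] by (auto simp: S_def is_lead_mono_def in_keys_iff)
  also have "(\<Sum>n\<in>M. x n * lookup (p n) m0) = lookup (\<Sum>m\<in>M. Const (x m) * p m) m0"
    by (simp add: lookup_sum)
  finally show False by (simp add: sum)
qed

section \<open>Ideals of four cubics\<close>

text \<open>The set \<open>M\<close> may leave out the monomials that do not divide \<open>c\<close>: when \<open>c\<close> does not contain
  $x_4$, only multiples of \<open>h\<close> by monomials without $x_4$ matter.\<close>

lemma lookup_mult_homogeneous:
  fixes h :: "('x::finite, 'a::comm_semiring_1) mpoly"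
  assumes h: "homogeneous 3 h" and M: "M \<subseteq> {\<mu>. mono_deg \<mu> + 3 = mono_deg c}"
    and out: "\<And>\<mu>. mono_deg \<mu> + 3 = mono_deg c \<Longrightarrow> \<mu> \<notin> M \<Longrightarrow> \<forall>m. c \<noteq> \<mu> + m"
  shows "lookup (q * h) c = (\<Sum>\<mu>\<in>M. lookup q \<mu> * lookup (Monom \<mu> * h) c)"
proof -
  have fin: "finite M" by (rule finite_subset[OF _ finite_mono_deg_le[of "mono_deg c"]]) (use M in auto)
  have zero: "lookup (Monom \<mu> * h) c = 0" if "\<mu> \<notin> M" for \<mu>
  proof (rule ccontr)
    assume "lookup (Monom \<mu> * h) c \<noteq> 0"
    moreover from this obtain m where m: "c = \<mu> + m" using lookup_Monom_times_eq_0 by metis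
    ultimately have "mono_deg m = 3" using h homogeneous_lookup by fastforce
    with m out[of \<mu>] that show False by auto
  qed
  let ?F = "keys q \<union> M"
  have "q * h = (\<Sum>\<mu>\<in>?F. Const (lookup q \<mu>) * Monom \<mu>) * h"
    using mpoly_eq_sum[of ?F q] fin by simp
  then have "lookup (q * h) c = (\<Sum>\<mu>\<in>?F. lookup q \<mu> * lookup (Monom \<mu> * h) c)"
    by (simp add: sum_distrib_right lookup_sum mult.assoc)
  also have "\<dots> = (\<Sum>\<mu>\<in>M. lookup q \<mu> * lookup (Monom \<mu> * h) c)"
    using fin zero by (intro sum.mono_neutral_right) auto
  finally show ?thesis .
qed

text \<open>For an ideal generated by forms this yields leading monomials: $m\in C$ is one if the monomials of its
  degree outside \<open>C\<close> are smaller.  On the other hand it is the solvability of a linear system, hence an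
  open condition on the generators.\<close>

definition prescribable :: "('x, 'a::field) mpoly set \<Rightarrow> ('x \<Rightarrow>\<^sub>0 nat) set \<Rightarrow> bool" where
  "prescribable I C \<longleftrightarrow> (\<forall>y. \<exists>g\<in>I. \<forall>c\<in>C. lookup g c = y c)"

locale cubics =
  fixes h :: "4 \<Rightarrow> (4, 'k::field) mpoly"
  assumes cubic: "homogeneous 3 (h i)"
begin

abbreviation I where "I \<equiv> ideal_gen (range h)"

lemma I_eq: "I = {\<Sum>i\<in>UNIV. q i * h i | q. True}"
  by (rule ideal_gen_image) simp

lemma comb_in_I: "(\<Sum>i\<in>UNIV. q i * h i) \<in> I"
  unfolding I_eq by blast

lemma prescribable_iff_solvable:
  assumes C: "\<And>c. c \<in> C \<Longrightarrow> mono_deg c = d + 3" and M: "M \<subseteq> {\<mu>. mono_deg \<mu> = d}"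
    and out: "\<And>\<mu> c. mono_deg \<mu> = d \<Longrightarrow> \<mu> \<notin> M \<Longrightarrow> c \<in> C \<Longrightarrow> \<forall>m. c \<noteq> \<mu> + m"
  shows "prescribable I C \<longleftrightarrow> solvable (\<lambda>(i, \<mu>) c. lookup (Monom \<mu> * h i) c) (UNIV \<times> M) C"
proof -
  have lookup: "lookup (\<Sum>i\<in>UNIV. q i * h i) c = (\<Sum>(i, \<mu>)\<in>UNIV \<times> M. lookup (Monom \<mu> * h i) c * lookup (q i) \<mu>)"
    if "c \<in> C" for q c
  proof -
    have "lookup (q i * h i) c = (\<Sum>\<mu>\<in>M. lookup (q i) \<mu> * lookup (Monom \<mu> * h i) c)" for i
      by (rule lookup_mult_homogeneous[OF cubic]) (use C[OF that] M out that in auto)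
    then show ?thesis
      by (simp add: lookup_sum sum.cartesian_product mult.commute)
  qed
  have finM: "finite M" using M by (rule finite_subset) simp
  show ?thesis
  proof
    assume pre: "prescribable I C"
    show "solvable (\<lambda>(i, \<mu>) c. lookup (Monom \<mu> * h i) c) (UNIV \<times> M) C"
      unfolding solvable_def
    proof
      fix y
      obtain q where q: "\<And>c. c \<in> C \<Longrightarrow> lookup (\<Sum>i\<in>UNIV. q i * h i) c = y c"
        using pre unfolding prescribable_def I_eq by blast
      have "\<forall>c\<in>C. (\<Sum>z\<in>UNIV \<times> M. (case z of (i, \<mu>) \<Rightarrow> lookup (Monom \<mu> * h i)) c * (case z of (i, \<mu>) \<Rightarrow> lookup (q i) \<mu>)) = y c"
        using q lookup by (auto simp: case_prod_unfold)
      then show "\<exists>x. \<forall>c\<in>C. (\<Sum>z\<in>UNIV \<times> M. (case z of (i, \<mu>) \<Rightarrow> lookup (Monom \<mu> * h i)) c * x z) = y c"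
        by blast
    qed
  next
    assume solv: "solvable (\<lambda>(i, \<mu>) c. lookup (Monom \<mu> * h i) c) (UNIV \<times> M) C"
    show "prescribable I C"
      unfolding prescribable_def
    proof
      fix y
      obtain x where x: "\<And>c. c \<in> C \<Longrightarrow> (\<Sum>z\<in>UNIV \<times> M. (case z of (i, \<mu>) \<Rightarrow> lookup (Monom \<mu> * h i)) c * x z) = y c"
        using solv unfolding solvable_def by blast
      define q where "q = (\<lambda>i. \<Sum>\<mu>\<in>M. Const (x (i, \<mu>)) * Monom \<mu>)"
      have "lookup (q i) \<mu> = x (i, \<mu>)" if "\<mu> \<in> M" for i \<mu>
        using that finM by (simp add: q_def lookup_sum lookup_Monom if_distrib[of "(*) _"] cong: if_cong)
      then have "lookup (\<Sum>i\<in>UNIV. q i * h i) c = y c" if "c \<in> C" for c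
        unfolding lookup[OF that] x[OF that, symmetric] by (intro sum.cong) auto
      with comb_in_I show "\<exists>g\<in>I. \<forall>c\<in>C. lookup g c = y c" by blast
    qed
  qed
qed

text \<open>An ideal generated by forms of one degree contains the homogeneous components of its elements,
  and the cofactors may be taken homogeneous as well.\<close>

lemma homogeneous_part:
  assumes "g \<in> I" "m \<in> keys g"
  obtains w where "\<And>i. homogeneous (mono_deg m - 3) (w i)" "mono_deg m \<ge> 3" "homogeneous (mono_deg m) (\<Sum>i\<in>UNIV. w i * h i)"
    "\<And>c. mono_deg c = mono_deg m \<Longrightarrow> lookup (\<Sum>i\<in>UNIV. w i * h i) c = lookup g c"
proof -
  define d where "d = mono_deg m"
  define M where "M = {\<mu> :: 4 \<Rightarrow>\<^sub>0 nat. mono_deg \<mu> + 3 = d}"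
  obtain q where q: "g = (\<Sum>i\<in>UNIV. q i * h i)" using assms(1) unfolding I_eq by blast
  have "finite M" unfolding M_def by (rule finite_subset[OF _ finite_mono_deg_le[of d]]) auto
  define w where "w = (\<lambda>i. \<Sum>\<mu>\<in>M. Const (lookup (q i) \<mu>) * Monom \<mu>)"
  have w: "lookup (w i) \<mu> = lookup (q i) \<mu>" if "\<mu> \<in> M" for i \<mu>
    using that \<open>finite M\<close> by (simp add: w_def lookup_sum lookup_Monom if_distrib[of "(*) _"] cong: if_cong)
  have lookup: "lookup (p * h i) c = (\<Sum>\<mu>\<in>M. lookup p \<mu> * lookup (Monom \<mu> * h i) c)" if "mono_deg c = d" for p i c
    by (rule lookup_mult_homogeneous[OF cubic]) (auto simp: M_def that)
  have eq: "lookup (\<Sum>i\<in>UNIV. w i * h i) c = lookup g c" if "mono_deg c = d" for c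
  proof -
    have "lookup (w i * h i) c = lookup (q i * h i) c" for i
      unfolding lookup[OF that, of "w i"] lookup[OF that, of "q i"] by (intro sum.cong refl) (simp add: w)
    then show ?thesis by (simp add: q lookup_sum)
  qed
  have "M \<noteq> {}"
  proof
    assume "M = {}"
    then have "lookup g m = 0" using lookup[of m] by (simp add: q lookup_sum d_def)
    with assms(2) show False by (simp add: in_keys_iff)
  qed
  then have d3: "d \<ge> 3" by (auto simp: M_def)
  have hw: "homogeneous (d - 3) (w i)" for i
    unfolding w_def
  proof (intro homogeneous_sum homogeneous_Const_times)
    fix \<mu> assume "\<mu> \<in> M"
    then have "mono_deg \<mu> = d - 3" by (auto simp: M_def)
    then show "homogeneous (d - 3) (Monom \<mu>)" using homogeneous_Monom by metis
  qed
  have "homogeneous (d - 3 + 3) (\<Sum>i\<in>UNIV. w i * h i)"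
    by (intro homogeneous_sum homogeneous_mult hw cubic)
  with that[of w] hw eq d3 show ?thesis by (simp add: d_def)
qed

lemma LM_witness:
  assumes "m \<in> LM I"
  obtains w where "\<And>i. homogeneous (mono_deg m - 3) (w i)" "mono_deg m \<ge> 3" "is_lead_mono (\<Sum>i\<in>UNIV. w i * h i) m"
proof -
  obtain g where g: "g \<in> I" "is_lead_mono g m" using assms by (auto simp: LM_def)
  then have "m \<in> keys g" by (auto simp: is_lead_mono_def)
  from homogeneous_part[OF g(1) this] obtain w where
    w: "\<And>i. homogeneous (mono_deg m - 3) (w i)" "mono_deg m \<ge> 3" "homogeneous (mono_deg m) (\<Sum>i\<in>UNIV. w i * h i)"
    "\<And>c. mono_deg c = mono_deg m \<Longrightarrow> lookup (\<Sum>i\<in>UNIV. w i * h i) c = lookup g c" by blast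
  have "keys (\<Sum>i\<in>UNIV. w i * h i) \<subseteq> keys g"
  proof
    fix c assume c: "c \<in> keys (\<Sum>i\<in>UNIV. w i * h i)"
    then have "mono_deg c = mono_deg m" using w(3) by (auto simp: homogeneous_def)
    from w(4)[OF this] c show "c \<in> keys g" by (simp add: in_keys_iff)
  qed
  moreover have "m \<in> keys (\<Sum>i\<in>UNIV. w i * h i)"
    using w(4)[of m] \<open>m \<in> keys g\<close> by (simp add: in_keys_iff)
  ultimately have "is_lead_mono (\<Sum>i\<in>UNIV. w i * h i) m"
    using g(2) by (auto simp: is_lead_mono_def)
  with that w show ?thesis by blast
qed

lemma prescribable_imp_LM:
  assumes pre: "prescribable I C" and m: "m \<in> C"
    and less: "\<And>n. mono_deg n = mono_deg m \<Longrightarrow> n \<notin> C \<Longrightarrow> revlex_less n m"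
  shows "m \<in> LM I"
proof -
  obtain g where g: "g \<in> I" "\<And>c. c \<in> C \<Longrightarrow> lookup g c = (if c = m then 1 else 0)"
    using pre[unfolded prescribable_def, rule_format, of "\<lambda>c. if c = m then 1 else 0"] by blast
  have "m \<in> keys g" using g(2)[OF m] by (simp add: in_keys_iff)
  from homogeneous_part[OF g(1) this] obtain w where
    w': "\<And>i. homogeneous (mono_deg m - 3) (w i)" "mono_deg m \<ge> 3" "homogeneous (mono_deg m) (\<Sum>i\<in>UNIV. w i * h i)"
    "\<And>c. mono_deg c = mono_deg m \<Longrightarrow> lookup (\<Sum>i\<in>UNIV. w i * h i) c = lookup g c" by blast
  note w = w'(3,4)
  let ?p = "\<Sum>i\<in>UNIV. w i * h i"
  have "revlex_less n m" if "n \<in> keys ?p" "n \<noteq> m" for n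
  proof -
    have "mono_deg n = mono_deg m" using w(1) that by (auto simp: homogeneous_def)
    moreover from this have "n \<notin> C" using w(2)[of n] g(2)[of n] that by (auto simp: in_keys_iff)
    ultimately show ?thesis by (rule less)
  qed
  moreover have "m \<in> keys ?p" using w(2)[of m] g(2)[OF m] by (simp add: in_keys_iff)
  ultimately have "is_lead_mono ?p m" by (auto simp: is_lead_mono_def)
  with comb_in_I show ?thesis by (auto simp: LM_def)
qed

end

section \<open>Counting leading monomials\<close>

abbreviation deg_le :: "nat \<Rightarrow> ('x, 'a::zero) mpoly \<Rightarrow> bool" where
  "deg_le n p \<equiv> keys p \<subseteq> {\<mu>. mono_deg \<mu> \<le> n}"

lemma homogeneous_deg_le: "homogeneous d p \<Longrightarrow> d \<le> n \<Longrightarrow> deg_le n p"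
  by (auto simp: homogeneous_def)

text \<open>Tuples of polynomials of degree at most \<open>n\<close> have as many coordinates as there are pairs of an index
  and a monomial.\<close>

lemma dependent_vectors:
  fixes v :: "'z \<Rightarrow> 'i::finite \<Rightarrow> ('x::finite, 'a::field) mpoly"
  assumes "finite N" and v: "\<And>z i. z \<in> N \<Longrightarrow> deg_le n (v z i)"
    and card: "CARD('i) * card {\<mu> :: 'x \<Rightarrow>\<^sub>0 nat. mono_deg \<mu> \<le> n} < card N"
  obtains x z where "z \<in> N" "x z \<noteq> 0" "\<And>i. (\<Sum>z\<in>N. Const (x z) * v z i) = 0"
proof -
  let ?C = "UNIV \<times> {\<mu> :: 'x \<Rightarrow>\<^sub>0 nat. mono_deg \<mu> \<le> n} :: ('i \<times> _) set"
  have "finite ?C" by simp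
  moreover have "card ?C < card N" using card by (simp add: card_cartesian_product)
  ultimately obtain x z where x: "z \<in> N" "x z \<noteq> 0"
    "\<And>c. c \<in> ?C \<Longrightarrow> (\<Sum>z\<in>N. (case c of (i, \<mu>) \<Rightarrow> lookup (v z i) \<mu>) * x z) = 0"
    using more_unknowns_than_equations[of ?C N "\<lambda>z (i, \<mu>). lookup (v z i) \<mu>"] \<open>finite N\<close> by blast
  have "(\<Sum>z\<in>N. Const (x z) * v z i) = 0" for i
  proof (rule poly_mapping_eqI)
    fix \<mu>
    show "lookup (\<Sum>z\<in>N. Const (x z) * v z i) \<mu> = lookup 0 \<mu>"
    proof (cases "mono_deg \<mu> \<le> n")
      case True
      then show ?thesis using x(3)[of "(i, \<mu>)"] by (simp add: lookup_sum mult.commute)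
    next
      case False
      then have "lookup (v z i) \<mu> = 0" if "z \<in> N" for z
        using v[OF that, of i] by (auto simp: in_keys_iff)
      then show ?thesis by (simp add: lookup_sum)
    qed
  qed
  with x that show ?thesis by blast
qed

context cubics
begin

lemma LM_witnesses:
  obtains w where "\<And>m i. m \<in> LM I \<Longrightarrow> mono_deg m \<le> n + 3 \<Longrightarrow> deg_le n (w m i)"
    "\<And>m. m \<in> LM I \<Longrightarrow> is_lead_mono (\<Sum>i\<in>UNIV. w m i * h i) m"
proof -
  have "\<forall>m\<in>LM I. \<exists>w. (mono_deg m \<le> n + 3 \<longrightarrow> (\<forall>i. deg_le n (w i))) \<and> is_lead_mono (\<Sum>i\<in>UNIV. w i * h i) m"
  proof
    fix m assume "m \<in> LM I"
    from LM_witness[OF this] obtain w where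
      w: "\<And>i. homogeneous (mono_deg m - 3) (w i)" "mono_deg m \<ge> 3" "is_lead_mono (\<Sum>i\<in>UNIV. w i * h i) m" by blast
    have "deg_le n (w i)" if "mono_deg m \<le> n + 3" for i
      by (rule homogeneous_deg_le[OF w(1)]) (use that in simp)
    with w(3) show "\<exists>w. (mono_deg m \<le> n + 3 \<longrightarrow> (\<forall>i. deg_le n (w i))) \<and> is_lead_mono (\<Sum>i\<in>UNIV. w i * h i) m"
      by blast
  qed
  from bchoice[OF this] that show ?thesis by blast
qed

text \<open>The map $q\mapsto\sum_i q_ih_i$ on quadruples of polynomials of degree at most \<open>n\<close> has a
  source of dimension four times the number of monomials.  If its image contains that many different
  leading monomials, then it is injective.\<close>

lemma no_syzygies:
  assumes card: "4 * card {\<mu> :: 4 \<Rightarrow>\<^sub>0 nat. mono_deg \<mu> \<le> n} \<le> card {m \<in> LM I. mono_deg m \<le> n + 3}"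
    and q: "\<And>i. deg_le n (q i)" "(\<Sum>i\<in>UNIV. q i * h i) = 0"
  shows "q i = 0"
proof (rule ccontr)
  assume "q i \<noteq> 0"
  define M where "M = {m \<in> LM I. mono_deg m \<le> n + 3}"
  have "finite M" unfolding M_def by (rule finite_subset[OF _ finite_mono_deg_le[of "n + 3"]]) auto
  obtain w where w': "\<And>m i. m \<in> LM I \<Longrightarrow> mono_deg m \<le> n + 3 \<Longrightarrow> deg_le (n) (w m i)"
    "\<And>m. m \<in> LM I \<Longrightarrow> is_lead_mono (\<Sum>i\<in>UNIV. w m i * h i) m"
    using LM_witnesses[of "n"] by blast
  have w: "\<And>m i. m \<in> M \<Longrightarrow> deg_le (n) (w m i)" "\<And>m. m \<in> M \<Longrightarrow> is_lead_mono (\<Sum>i\<in>UNIV. w m i * h i) m"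
    using w' by (simp_all add: M_def)
  define v where "v = (\<lambda>z i. case z of None \<Rightarrow> q i | Some m \<Rightarrow> w m i)"
  obtain x z where x: "z \<in> insert None (Some ` M)" "x z \<noteq> 0"
    "\<And>i. (\<Sum>z\<in>insert None (Some ` M). Const (x z) * v z i) = 0"
  proof (rule dependent_vectors[of "insert None (Some ` M)" v n])
    show "finite (insert None (Some ` M))" using \<open>finite M\<close> by simp
    show "deg_le n (v z i)" if "z \<in> insert None (Some ` M)" for z i
      using that q(1) w(1) by (cases z) (simp_all add: v_def image_iff)
    show "CARD(4) * card {\<mu> :: 4 \<Rightarrow>\<^sub>0 nat. mono_deg \<mu> \<le> n} < card (insert None (Some ` M))"
      using card \<open>finite M\<close> by (simp add: card_image M_def)
  qed blast
  have eq: "Const (x None) * q i + (\<Sum>m\<in>M. Const (x (Some m)) * w m i) = 0" for i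
    using x(3)[of i] \<open>finite M\<close> by (simp add: v_def sum.reindex)
  have "(\<Sum>m\<in>M. Const (x (Some m)) * (\<Sum>i\<in>UNIV. w m i * h i))
      = (\<Sum>i\<in>UNIV. (\<Sum>m\<in>M. Const (x (Some m)) * w m i) * h i)"
    by (simp add: sum_distrib_left sum_distrib_right mult.assoc) (rule sum.swap)
  also have "\<dots> = (\<Sum>i\<in>UNIV. (- Const (x None) * q i) * h i)"
    using eq by (intro sum.cong refl arg_cong[of _ _ "\<lambda>a. a * _"]) (simp add: eq_neg_iff_add_eq_0 add.commute)
  also have "\<dots> = - Const (x None) * (\<Sum>i\<in>UNIV. q i * h i)"
    by (simp add: sum_distrib_left sum_negf mult.assoc)
  finally have "(\<Sum>m\<in>M. Const (x (Some m)) * (\<Sum>i\<in>UNIV. w m i * h i)) = 0" using q(2) by simp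
  from lead_monos_independent[OF \<open>finite M\<close> w(2) this] have xM: "x (Some m) = 0" if "m \<in> M" for m
    using that by simp
  then have "Const (x None) * q i = 0" using eq[of i] by simp
  moreover obtain \<mu> where "lookup (q i) \<mu> \<noteq> 0"
    using \<open>q i \<noteq> 0\<close> by (metis lookup_zero poly_mapping_eqI)
  ultimately have "x None = 0" by (metis lookup_Const_times lookup_zero mult_eq_0_iff)
  with x xM show False by auto
qed

text \<open>Among the quadruples of polynomials of degree at most $n+3$, the syzygies $h_je_i-h_ie_j$ with
  coefficients of degree at most \<open>n\<close> span a space of dimension six times the number of monomials:
  a relation between them would, by the assumption, have vanishing coefficients, first those with
  \<open>i = 1\<close>, next those with \<open>i = 2\<close>, and last the one with \<open>i = 3\<close>.  Quadruples that represent elements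
  with different leading monomials are independent modulo all syzygies.\<close>

lemma card_LM_le:
  assumes syz: "\<And>q i. (\<And>i. deg_le n (q i)) \<Longrightarrow> (\<Sum>i\<in>UNIV. q i * h i) = 0 \<Longrightarrow> q i = 0"
  shows "card {m \<in> LM I. mono_deg m \<le> n + 6} + 6 * card {\<mu> :: 4 \<Rightarrow>\<^sub>0 nat. mono_deg \<mu> \<le> n}
    \<le> 4 * card {\<mu> :: 4 \<Rightarrow>\<^sub>0 nat. mono_deg \<mu> \<le> n + 3}"
proof (rule ccontr)
  assume too_many: "\<not> ?thesis"
  define M where "M = {m \<in> LM I. mono_deg m \<le> n + 6}"
  have "finite M" unfolding M_def by (rule finite_subset[OF _ finite_mono_deg_le[of "n + 6"]]) auto
  obtain w where w': "\<And>m i. m \<in> LM I \<Longrightarrow> mono_deg m \<le> n + 3 + 3 \<Longrightarrow> deg_le (n + 3) (w m i)"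
    "\<And>m. m \<in> LM I \<Longrightarrow> is_lead_mono (\<Sum>i\<in>UNIV. w m i * h i) m"
    using LM_witnesses[of "n + 3"] by blast
  have w: "\<And>m i. m \<in> M \<Longrightarrow> deg_le (n + 3) (w m i)" "\<And>m. m \<in> M \<Longrightarrow> is_lead_mono (\<Sum>i\<in>UNIV. w m i * h i) m"
    using w' by (simp_all add: M_def)
  define P :: "(4 \<times> 4) set" where "P = {(1, 2), (1, 3), (1, 4), (2, 3), (2, 4), (3, 4)}"
  define D where "D = {\<mu> :: 4 \<Rightarrow>\<^sub>0 nat. mono_deg \<mu> \<le> n}"
  have "finite D" "finite P" by (simp_all add: D_def P_def)
  have "card P = 6" by (simp add: P_def)
  define koszul where "koszul = (\<lambda>p l. if l = fst p then h (snd p) else if l = snd p then - h (fst p) else 0)"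
  define v where "v = (\<lambda>z l. case z of Inl m \<Rightarrow> w m l | Inr (p, \<mu>) \<Rightarrow> Monom \<mu> * koszul p l)"
  have hom_koszul: "homogeneous 3 (koszul p l)" for p l
    using cubic homogeneous_Const_times[OF cubic, of "-1"] by (simp add: koszul_def Const_uminus)
  obtain x z where x: "z \<in> M <+> (P \<times> D)" "x z \<noteq> 0"
    "\<And>l. (\<Sum>z\<in>M <+> (P \<times> D). Const (x z) * v z l) = 0"
  proof (rule dependent_vectors[of "M <+> (P \<times> D)" v "n + 3"])
    show "finite (M <+> (P \<times> D))" using \<open>finite M\<close> \<open>finite D\<close> \<open>finite P\<close> by simp
    show "deg_le (n + 3) (v z l)" if "z \<in> M <+> (P \<times> D)" for z l
      using that
    proof
      fix m assume "m \<in> M" "z = Inl m"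
      then show ?thesis using w(1) by (simp add: v_def)
    next
      fix y assume "y \<in> P \<times> D" "z = Inr y"
      then obtain p \<mu> where "z = Inr (p, \<mu>)" "mono_deg \<mu> \<le> n" by (auto simp: D_def)
      then show ?thesis
        using homogeneous_deg_le[OF homogeneous_mult[OF homogeneous_Monom hom_koszul]]
        by (simp add: v_def)
    qed
    show "CARD(4) * card {\<mu> :: 4 \<Rightarrow>\<^sub>0 nat. mono_deg \<mu> \<le> n + 3} < card (M <+> (P \<times> D))"
      using too_many \<open>finite M\<close> \<open>finite D\<close> \<open>finite P\<close> \<open>card P = 6\<close>
      by (simp add: card_Plus card_cartesian_product flip: M_def D_def)
  qed blast
  define Q where "Q = (\<lambda>p. \<Sum>\<mu>\<in>D. Const (x (Inr (p, \<mu>))) * Monom \<mu>)"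
  have lookup_Q: "lookup (Q p) \<mu> = (if \<mu> \<in> D then x (Inr (p, \<mu>)) else 0)" for p \<mu>
    using \<open>finite D\<close> by (simp add: Q_def lookup_sum lookup_Monom if_distrib[of "(*) _"] cong: if_cong)
  have Q_deg: "deg_le n (Q p)" for p
    by (auto simp: in_keys_iff lookup_Q D_def split: if_splits)
  define K where "K = (\<lambda>l. \<Sum>p\<in>P. Q p * koszul p l)"
  have eq: "(\<Sum>m\<in>M. Const (x (Inl m)) * w m l) + K l = 0" for l
  proof -
    have "K l = (\<Sum>(p, \<mu>)\<in>P \<times> D. Const (x (Inr (p, \<mu>))) * (Monom \<mu> * koszul p l))"
      by (simp add: K_def Q_def sum_distrib_right sum.cartesian_product mult.assoc)
    with x(3)[of l] show ?thesis
      using \<open>finite M\<close> \<open>finite D\<close> \<open>finite P\<close>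
      by (simp add: sum.Plus v_def o_def case_prod_unfold)
  qed
  have K: "K 1 = Q (1, 2) * h 2 + Q (1, 3) * h 3 + Q (1, 4) * h 4"
    "K 2 = - Q (1, 2) * h 1 + Q (2, 3) * h 3 + Q (2, 4) * h 4"
    "K 3 = - Q (1, 3) * h 1 - Q (2, 3) * h 2 + Q (3, 4) * h 4"
    "K 4 = - Q (1, 4) * h 1 - Q (2, 4) * h 2 - Q (3, 4) * h 3"
    by (simp_all add: K_def P_def koszul_def)
  have "(\<Sum>m\<in>M. Const (x (Inl m)) * (\<Sum>i\<in>UNIV. w m i * h i))
      = (\<Sum>i\<in>UNIV. (\<Sum>m\<in>M. Const (x (Inl m)) * w m i) * h i)"
    by (simp add: sum_distrib_left sum_distrib_right mult.assoc) (rule sum.swap)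
  also have "\<dots> = (\<Sum>i\<in>UNIV. - K i * h i)"
    using eq by (intro sum.cong refl arg_cong[of _ _ "\<lambda>a. a * _"]) (simp add: eq_neg_iff_add_eq_0)
  also have "\<dots> = 0"
    by (simp add: sum_4 K algebra_simps)
  finally have "x (Inl m) = 0" if "m \<in> M" for m
    using lead_monos_independent[OF \<open>finite M\<close> w(2)] that by simp
  then have K0: "K l = 0" for l using eq[of l] by simp
  have Q0: "Q (1, 2) = 0" "Q (1, 3) = 0" "Q (1, 4) = 0"
  proof -
    define q where "q = (\<lambda>i :: 4. if i = 1 then 0 else Q (1, i))"
    have "deg_le n (q i)" for i using Q_deg by (simp add: q_def)
    moreover have "(\<Sum>i\<in>UNIV. q i * h i) = 0" using K(1) K0[of 1] by (simp add: sum_4 q_def)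
    ultimately have "q i = 0" for i by (rule syz)
    from this[of 2] this[of 3] this[of 4] show "Q (1, 2) = 0" "Q (1, 3) = 0" "Q (1, 4) = 0"
      by (simp_all add: q_def)
  qed
  have Q1: "Q (2, 3) = 0" "Q (2, 4) = 0"
  proof -
    define q where "q = (\<lambda>i :: 4. if i = 1 \<or> i = 2 then 0 else Q (2, i))"
    have "deg_le n (q i)" for i using Q_deg by (simp add: q_def)
    moreover have "(\<Sum>i\<in>UNIV. q i * h i) = 0" using K(2) K0[of 2] Q0 by (simp add: sum_4 q_def)
    ultimately have "q i = 0" for i by (rule syz)
    from this[of 3] this[of 4] show "Q (2, 3) = 0" "Q (2, 4) = 0"
      by (simp_all add: q_def)
  qed
  have Q2: "Q (3, 4) = 0"
  proof -
    define q where "q = (\<lambda>i :: 4. if i = 4 then Q (3, i) else 0)"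
    have "deg_le n (q i)" for i using Q_deg by (simp add: q_def)
    moreover have "(\<Sum>i\<in>UNIV. q i * h i) = 0" using K(3) K0[of 3] Q0 Q1 by (simp add: sum_4 q_def)
    ultimately have "q i = 0" for i by (rule syz)
    from this[of 4] show "Q (3, 4) = 0" by (simp add: q_def)
  qed
  have "x (Inr (p, \<mu>)) = 0" if "p \<in> P" "\<mu> \<in> D" for p \<mu>
  proof -
    have "Q p = 0" using that(1) Q0 Q1 Q2 by (auto simp: P_def)
    with lookup_Q[of p \<mu>] that(2) show ?thesis by simp
  qed
  with x(1,2) \<open>\<And>m. m \<in> M \<Longrightarrow> x (Inl m) = 0\<close> show False by (auto elim!: PlusE)
qed

end

lemma card_mono_deg_le: "card {m :: 4 \<Rightarrow>\<^sub>0 nat. mono_deg m \<le> n}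
    = (\<Sum>a<Suc n. \<Sum>b<Suc n. \<Sum>c<Suc n. if a + b + c \<le> n then n + 1 - (a + b + c) else 0)"
proof -
  have "{m :: 4 \<Rightarrow>\<^sub>0 nat. mono_deg m \<le> n} = {m. lookup m 1 + lookup m 2 + lookup m 3 \<le> n
      \<and> lookup m 4 < n + 1 - (lookup m 1 + lookup m 2 + lookup m 3)}"
    by (auto simp: mono_deg_4)
  then show ?thesis
    using card_exponents[of "\<lambda>a b c. a + b + c \<le> n" "Suc n" "\<lambda>a b c. n + 1 - (a + b + c)"] by auto
qed

lemma card_mono_deg_le_2: "card {m :: 4 \<Rightarrow>\<^sub>0 nat. mono_deg m \<le> 2} = 15"
  unfolding card_mono_deg_le by code_simp

lemma card_mono_deg_le_5: "card {m :: 4 \<Rightarrow>\<^sub>0 nat. mono_deg m \<le> 5} = 126"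
  unfolding card_mono_deg_le by code_simp

lemma card_mono_deg_le_8: "card {m :: 4 \<Rightarrow>\<^sub>0 nat. mono_deg m \<le> 8} = 495"
  unfolding card_mono_deg_le by code_simp

section \<open>The two candidate ideals\<close>

text \<open>The monomials outside the two ideals.  A monomial of degree \<open>D\<close> in $x_1,x_2,x_3$ carries the
  string of its multiples by $1,x_4,\dots,x_4^{8-2D}$, which is symmetric around degree 4 as the strong
  Lefschetz property demands; the two forms differ only in the strings of length one.\<close>

definition std_I :: "(4 \<Rightarrow>\<^sub>0 nat) \<Rightarrow> bool" where
  "std_I m \<longleftrightarrow> (let a = lookup m 1; b = lookup m 2; c = lookup m 3; e = lookup m 4 in
    a + b \<le> 2 \<and> a + b + c \<le> 4 \<and> (a + b + c = 4 \<longrightarrow> a + b \<le> 1) \<and> 2 * (a + b + c) + e \<le> 8)"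

definition std_II :: "(4 \<Rightarrow>\<^sub>0 nat) \<Rightarrow> bool" where
  "std_II m \<longleftrightarrow> (let a = lookup m 1; b = lookup m 2; c = lookup m 3; e = lookup m 4 in
    a + b \<le> 2 \<and> a + b + c \<le> 4 \<and> (a + b + c = 4 \<longrightarrow> a = 0) \<and> 2 * (a + b + c) + e \<le> 8)"

lemma card_std_I: "card {m. std_I m \<and> mono_deg m \<le> n}
    = (\<Sum>a<5. \<Sum>b<5. \<Sum>c<5. if a + b \<le> 2 \<and> a + b + c \<le> 4 \<and> (a + b + c = 4 \<longrightarrow> a + b \<le> 1)
        then min (9 - 2 * (a + b + c)) (n + 1 - (a + b + c)) else 0)"
proof -
  have "{m. std_I m \<and> mono_deg m \<le> n} = {m. (let a = lookup m 1; b = lookup m 2; c = lookup m 3 in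
      a + b \<le> 2 \<and> a + b + c \<le> 4 \<and> (a + b + c = 4 \<longrightarrow> a + b \<le> 1))
      \<and> lookup m 4 < min (9 - 2 * (lookup m 1 + lookup m 2 + lookup m 3)) (n + 1 - (lookup m 1 + lookup m 2 + lookup m 3))}"
    by (auto simp: mono_deg_4 std_I_def Let_def)
  then show ?thesis
    using card_exponents[of "\<lambda>a b c. a + b \<le> 2 \<and> a + b + c \<le> 4 \<and> (a + b + c = 4 \<longrightarrow> a + b \<le> 1)" 5
        "\<lambda>a b c. min (9 - 2 * (a + b + c)) (n + 1 - (a + b + c))"] by (auto simp: Let_def)
qed

lemma card_std_II: "card {m. std_II m \<and> mono_deg m \<le> n}
    = (\<Sum>a<5. \<Sum>b<5. \<Sum>c<5. if a + b \<le> 2 \<and> a + b + c \<le> 4 \<and> (a + b + c = 4 \<longrightarrow> a = 0)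
        then min (9 - 2 * (a + b + c)) (n + 1 - (a + b + c)) else 0)"
proof -
  have "{m. std_II m \<and> mono_deg m \<le> n} = {m. (let a = lookup m 1; b = lookup m 2; c = lookup m 3 in
      a + b \<le> 2 \<and> a + b + c \<le> 4 \<and> (a + b + c = 4 \<longrightarrow> a = 0))
      \<and> lookup m 4 < min (9 - 2 * (lookup m 1 + lookup m 2 + lookup m 3)) (n + 1 - (lookup m 1 + lookup m 2 + lookup m 3))}"
    by (auto simp: mono_deg_4 std_II_def Let_def)
  then show ?thesis
    using card_exponents[of "\<lambda>a b c. a + b \<le> 2 \<and> a + b + c \<le> 4 \<and> (a + b + c = 4 \<longrightarrow> a = 0)" 5
        "\<lambda>a b c. min (9 - 2 * (a + b + c)) (n + 1 - (a + b + c))"] by (auto simp: Let_def)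
qed

lemma card_std:
  "card {m. std_I m \<and> mono_deg m \<le> 5} = 66" "card {m. std_I m \<and> mono_deg m \<le> 8} = 81"
  "card {m. std_II m \<and> mono_deg m \<le> 5} = 66" "card {m. std_II m \<and> mono_deg m \<le> 8} = 81"
  unfolding card_std_I card_std_II by code_simp+

lemma std_mono_deg_le: "std_I m \<Longrightarrow> mono_deg m \<le> 8" "std_II m \<Longrightarrow> mono_deg m \<le> 8"
  by (auto simp: std_I_def std_II_def mono_deg_4 Let_def)

text \<open>There are 15, 126 and 495 monomials of degree at most 2, 5 and 8.  Removing the standard ones
  leaves $126-66=60=4\cdot15$ and $495-81=414=4\cdot126-6\cdot15$ monomials in degrees at most 5 and 8.
  The first equality excludes syzygies of low degree, and by the second the Koszul bound is attained
  already by the nonstandard monomials.\<close>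

lemma (in cubics) LM_eqI:
  assumes sub: "{m. \<not> std m} \<subseteq> LM I" and deg: "\<And>m. std m \<Longrightarrow> mono_deg m \<le> 8"
    and card: "card {m. std m \<and> mono_deg m \<le> 5} = 66" "card {m. std m \<and> mono_deg m \<le> 8} = 81"
  shows "LM I = {m. \<not> std m}"
proof -
  have card_nonstd: "card {m. \<not> std m \<and> mono_deg m \<le> n} + card {m. std m \<and> mono_deg m \<le> n}
      = card {m :: 4 \<Rightarrow>\<^sub>0 nat. mono_deg m \<le> n}" for n
    by (subst card_Un_disjoint[symmetric])
      (auto intro: finite_subset[OF _ finite_mono_deg_le[of n]] arg_cong[of _ _ card])
  have n5: "card {m. \<not> std m \<and> mono_deg m \<le> 5} = 60" and n8: "card {m. \<not> std m \<and> mono_deg m \<le> 8} = 414"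
    using card_nonstd[of 5] card_nonstd[of 8] card card_mono_deg_le_5 card_mono_deg_le_8 by auto
  have fin: "finite {m \<in> LM I. mono_deg m \<le> n}" for n
    by (rule finite_subset[OF _ finite_mono_deg_le[of n]]) auto
  have "card {m. \<not> std m \<and> mono_deg m \<le> 5} \<le> card {m \<in> LM I. mono_deg m \<le> 5}"
    using sub by (intro card_mono fin) auto
  then have "4 * card {\<mu> :: 4 \<Rightarrow>\<^sub>0 nat. mono_deg \<mu> \<le> 2} \<le> card {m \<in> LM I. mono_deg m \<le> 2 + 3}"
    by (simp add: n5 card_mono_deg_le_2)
  note syz = no_syzygies[OF this]
  have "card {m \<in> LM I. mono_deg m \<le> 2 + 6} + 6 * card {\<mu> :: 4 \<Rightarrow>\<^sub>0 nat. mono_deg \<mu> \<le> 2}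
      \<le> 4 * card {\<mu> :: 4 \<Rightarrow>\<^sub>0 nat. mono_deg \<mu> \<le> 2 + 3}"
    by (rule card_LM_le) (rule syz)
  then have "card {m \<in> LM I. mono_deg m \<le> 8} \<le> 414"
    by (simp add: card_mono_deg_le_2 card_mono_deg_le_5)
  moreover have "{m. \<not> std m \<and> mono_deg m \<le> 8} \<subseteq> {m \<in> LM I. mono_deg m \<le> 8}"
    using sub by auto
  ultimately have "{m. \<not> std m \<and> mono_deg m \<le> 8} = {m \<in> LM I. mono_deg m \<le> 8}"
    using n8 fin by (intro card_seteq) auto
  then show ?thesis using sub deg by blast
qed

lemma ideal_gen_Monom_eqI:
  assumes "G \<subseteq> N" and "\<And>m. m \<in> N \<Longrightarrow> \<exists>g\<in>G. \<forall>x. lookup g x \<le> lookup m x"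
  shows "ideal_gen (Monom ` G) = (ideal_gen (Monom ` N) :: ('x, 'a::comm_ring_1) mpoly set)"
proof
  show "ideal_gen (Monom ` G) \<subseteq> (ideal_gen (Monom ` N) :: ('x, 'a) mpoly set)"
    using assms(1) by (intro ideal_gen_subset) (auto intro!: ideal_gen_base)
  show "ideal_gen (Monom ` N) \<subseteq> (ideal_gen (Monom ` G) :: ('x, 'a) mpoly set)"
  proof (rule ideal_gen_subset, clarify)
    fix m assume "m \<in> N"
    then obtain g where g: "g \<in> G" "\<forall>x. lookup g x \<le> lookup m x" using assms(2) by blast
    then have "m = (m - g) + g"
      by (intro poly_mapping_eqI) (simp add: lookup_add lookup_minus)
    then have "Monom m = (Monom (m - g) * Monom g :: ('x, 'a) mpoly)" by (metis Monom_add)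
    also have "\<dots> \<in> ideal_gen (Monom ` G)"
      using g(1) by (intro ideal_mult[OF is_ideal_ideal_gen] ideal_gen_base) auto
    finally show "Monom m \<in> (ideal_gen (Monom ` G) :: ('x, 'a) mpoly set)" .
  qed
qed

lemma Monoms_eq: "Monoms V n = Monom ` {m. keys m \<subseteq> V \<and> mono_deg m = n}"
  unfolding Monoms_def by auto

lemma Monom_elt_set_times: "Monom k *o (Monom ` A) = (Monom ` {m. (\<exists>n\<in>A. m = k + n)} :: ('x, 'a::comm_semiring_1) mpoly set)"
  unfolding elt_set_times_def by (auto simp: image_iff simp flip: Monom_add)

lemma Var_eq_Monom:
  "Var 1 = (Monom (mon4 1 0 0 0) :: (4, 'a::comm_semiring_1) mpoly)"
  "Var 2 = (Monom (mon4 0 1 0 0) :: (4, 'a) mpoly)"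
  "Var 3 = (Monom (mon4 0 0 1 0) :: (4, 'a) mpoly)"
  "Var 4 = (Monom (mon4 0 0 0 1) :: (4, 'a) mpoly)"
  by (simp_all add: mon4_def Var_def)

lemma Monom_mon4_power:
  "Monom (mon4 a b c e) ^ n = (Monom (mon4 (n * a) (n * b) (n * c) (n * e)) :: (4, 'a::comm_semiring_1) mpoly)"
proof (induction n)
  case 0
  have "mon4 0 0 0 0 = 0" by (simp add: mon4_def)
  then show ?case by simp
qed (simp add: mon4_add flip: Monom_add)

lemma keys_12: "keys m \<subseteq> {1, 2} \<longleftrightarrow> lookup m 3 = 0 \<and> lookup m (4::4) = (0::nat)"
  unfolding subset_iff in_keys_iff by (auto simp: forall_4)

lemma keys_123: "keys m \<subseteq> {1, 2, 3} \<longleftrightarrow> lookup m (4::4) = (0::nat)"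
  unfolding subset_iff in_keys_iff by (auto simp: forall_4)

lemma shifted_exponents:
  "(\<exists>n\<in>{n. P n}. m = k + n) \<longleftrightarrow> (\<forall>x. lookup k x \<le> lookup m x) \<and> P (m - k)" for m :: "'x \<Rightarrow>\<^sub>0 nat"
proof
  assume "\<exists>n\<in>{n. P n}. m = k + n"
  then show "(\<forall>x. lookup k x \<le> lookup m x) \<and> P (m - k)" by (auto simp: lookup_add)
next
  assume *: "(\<forall>x. lookup k x \<le> lookup m x) \<and> P (m - k)"
  then have "m = k + (m - k)" by (intro poly_mapping_eqI) (simp add: lookup_add lookup_minus)
  with * show "\<exists>n\<in>{n. P n}. m = k + n" by blast
qed

lemmas exponents_simps = Monoms_eq Var_eq_Monom Monom_mon4_power Monom_elt_set_times Monom_add[symmetric]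
  mon4_add keys_12 keys_123 shifted_exponents mono_deg_4 forall_4 lookup_minus

lemma split_exponents: "n \<le> a + b + c \<Longrightarrow> \<exists>a' b' c'. a' \<le> a \<and> b' \<le> b \<and> c' \<le> (c::nat) \<and> a' + b' + c' = n"
  by (intro exI[of _ "min a n"] exI[of _ "min b (n - min a n)"] exI[of _ "n - min a n - min b (n - min a n)"]) auto

lemma gin_form_I_eq: "gin_form_I = (ideal_gen (Monom ` {m. \<not> std_I m}) :: (4, 'a::field) mpoly set)"
proof -
  define G where "G = {m. lookup m 3 = 0 \<and> lookup m 4 = 0 \<and> lookup m 1 + lookup m 2 = 3}
    \<union> {m. lookup m 3 = 2 \<and> lookup m 4 = 0 \<and> lookup m 1 + lookup m 2 = 2}
    \<union> {m. lookup m 3 \<ge> 4 \<and> lookup m 4 = 0 \<and> lookup m 1 + lookup m 2 + lookup m 3 = 5}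
    \<union> {m. lookup m 3 \<ge> 3 \<and> lookup m 4 = 1 \<and> lookup m 1 + lookup m 2 + lookup m 3 = 4}
    \<union> {m. lookup m 3 = 1 \<and> lookup m 4 = 3 \<and> lookup m 1 + lookup m 2 = 2}
    \<union> {m. lookup m 3 = 2 \<and> lookup m 4 = 3 \<and> lookup m 1 + lookup m 2 = 1}
    \<union> {mon4 0 0 3 3}
    \<union> {m. lookup m 4 = 5 \<and> lookup m 1 + lookup m 2 + lookup m 3 = 2}
    \<union> {m. lookup m 4 = 7 \<and> lookup m 1 + lookup m 2 + lookup m 3 = 1}
    \<union> {mon4 0 0 0 9}"
  have "gin_form_I = (ideal_gen (Monom ` G) :: (4, 'a) mpoly set)"
    unfolding gin_form_I_def G_def image_Un image_insert image_empty exponents_simps lookup_mon4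
    by (rule arg_cong[of _ _ ideal_gen])
      (intro arg_cong2[of _ _ _ _ "(\<union>)"] refl arg_cong[of _ _ "(`) Monom"] Collect_cong; auto simp: mon4_eq_iff)
  also have "\<dots> = ideal_gen (Monom ` {m. \<not> std_I m})"
  proof (rule ideal_gen_Monom_eqI)
    show "G \<subseteq> {m. \<not> std_I m}" by (auto simp: G_def std_I_def Let_def)
    fix m assume m: "m \<in> {m. \<not> std_I m}"
    define a b c e where "a = lookup m 1" "b = lookup m 2" "c = lookup m 3" "e = lookup m 4"
    have wit: "\<exists>g\<in>G. \<forall>x. lookup g x \<le> lookup m x" if "mon4 a' b' c' e' \<in> G" "a' \<le> a" "b' \<le> b" "c' \<le> c" "e' \<le> e" for a' b' c' e'
      using that by (intro bexI[of _ "mon4 a' b' c' e'"]) (auto simp: forall_4 a_b_c_e_def)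
    have "(a + b \<ge> 3) \<or> (a + b = 2 \<and> c \<ge> 2) \<or> (a + b \<le> 1 \<and> a + b + c \<ge> 5) \<or> (a + b \<le> 1 \<and> a + b + c = 4 \<and> e \<ge> 1) \<or> (a + b + c = 3 \<and> a + b \<le> 2 \<and> e \<ge> 3) \<or> (a + b + c = 2 \<and> e \<ge> 5) \<or> (a + b + c = 1 \<and> e \<ge> 7) \<or> (a + b + c = 0 \<and> e \<ge> 9)"
      using m unfolding std_I_def Let_def mem_Collect_eq a_b_c_e_def[symmetric] by presburger
    then consider "a + b \<ge> 3" | "a + b = 2 \<and> c \<ge> 2" | "a + b \<le> 1 \<and> a + b + c \<ge> 5" | "a + b \<le> 1 \<and> a + b + c = 4 \<and> e \<ge> 1" | "a + b + c = 3 \<and> a + b \<le> 2 \<and> e \<ge> 3" | "a + b + c = 2 \<and> e \<ge> 5" | "a + b + c = 1 \<and> e \<ge> 7" | "a + b + c = 0 \<and> e \<ge> 9"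
      by blast
    then show "\<exists>g\<in>G. \<forall>x. lookup g x \<le> lookup m x"
    proof cases
      case 1
      then obtain a' b' where "a' \<le> a" "b' \<le> b" "a' + b' = 3"
        using split_exponents[of 3 a b 0] by auto
      then show ?thesis by (intro wit[of a' b' 0 0]) (auto simp: G_def)
    next
      case 2
      then show ?thesis by (intro wit[of a b 2 0]) (auto simp: G_def)
    next
      case 3
      then show ?thesis by (intro wit[of a b "5 - a - b" 0]) (auto simp: G_def)
    next
      case 4
      then show ?thesis by (intro wit[of a b c 1]) (auto simp: G_def)
    next
      case 5
      then have "c = 1 \<and> a + b = 2 \<or> c = 2 \<and> a + b = 1 \<or> c = 3 \<and> a = 0 \<and> b = 0"
        by presburger
      with 5 show ?thesis by (intro wit[of a b c 3]) (auto simp: G_def mon4_eq_iff)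
    next
      case 6
      then show ?thesis by (intro wit[of a b c 5]) (auto simp: G_def)
    next
      case 7
      then show ?thesis by (intro wit[of a b c 7]) (auto simp: G_def)
    next
      case 8
      then show ?thesis by (intro wit[of 0 0 0 9]) (auto simp: G_def)
    qed
  qed
  finally show ?thesis .
qed

lemma gin_form_II_eq: "gin_form_II = (ideal_gen (Monom ` {m. \<not> std_II m}) :: (4, 'a::field) mpoly set)"
proof -
  define G where "G = {m. lookup m 3 = 0 \<and> lookup m 4 = 0 \<and> lookup m 1 + lookup m 2 = 3}
    \<union> {m. lookup m 3 \<ge> 2 \<and> lookup m 1 \<ge> 1 \<and> lookup m 4 = 0 \<and> lookup m 1 + lookup m 2 + lookup m 3 = 4}
    \<union> {mon4 0 2 3 0, mon4 0 1 4 0, mon4 0 0 5 0}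
    \<union> {mon4 0 2 2 1, mon4 0 1 3 1, mon4 0 0 4 1}
    \<union> {m. lookup m 3 = 1 \<and> lookup m 4 = 3 \<and> lookup m 1 + lookup m 2 = 2}
    \<union> {m. lookup m 3 = 2 \<and> lookup m 4 = 3 \<and> lookup m 1 + lookup m 2 = 1}
    \<union> {mon4 0 0 3 3}
    \<union> {m. lookup m 4 = 5 \<and> lookup m 1 + lookup m 2 + lookup m 3 = 2}
    \<union> {m. lookup m 4 = 7 \<and> lookup m 1 + lookup m 2 + lookup m 3 = 1}
    \<union> {mon4 0 0 0 9}"
  have "gin_form_II = (ideal_gen (Monom ` G) :: (4, 'a) mpoly set)"
    unfolding gin_form_II_def G_def image_Un image_insert image_empty exponents_simps lookup_mon4
    by (rule arg_cong[of _ _ ideal_gen])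
      (intro arg_cong2[of _ _ _ _ "(\<union>)"] refl arg_cong[of _ _ "(`) Monom"] Collect_cong; auto simp: mon4_eq_iff)
  also have "\<dots> = ideal_gen (Monom ` {m. \<not> std_II m})"
  proof (rule ideal_gen_Monom_eqI)
    show "G \<subseteq> {m. \<not> std_II m}" by (auto simp: G_def std_II_def Let_def)
    fix m assume m: "m \<in> {m. \<not> std_II m}"
    define a b c e where "a = lookup m 1" "b = lookup m 2" "c = lookup m 3" "e = lookup m 4"
    have wit: "\<exists>g\<in>G. \<forall>x. lookup g x \<le> lookup m x" if "mon4 a' b' c' e' \<in> G" "a' \<le> a" "b' \<le> b" "c' \<le> c" "e' \<le> e" for a' b' c' e'
      using that by (intro bexI[of _ "mon4 a' b' c' e'"]) (auto simp: forall_4 a_b_c_e_def)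
    have "(a + b \<ge> 3) \<or> (a \<ge> 1 \<and> a + b \<le> 2 \<and> a + b + c = 4) \<or> (a \<ge> 1 \<and> a + b \<le> 2 \<and> a + b + c \<ge> 5) \<or> (a = 0 \<and> b \<le> 2 \<and> b + c \<ge> 5) \<or> (a = 0 \<and> b \<le> 2 \<and> b + c = 4 \<and> e \<ge> 1) \<or> (a + b + c = 3 \<and> a + b \<le> 2 \<and> e \<ge> 3) \<or> (a + b + c = 2 \<and> e \<ge> 5) \<or> (a + b + c = 1 \<and> e \<ge> 7) \<or> (a + b + c = 0 \<and> e \<ge> 9)"
      using m unfolding std_II_def Let_def mem_Collect_eq a_b_c_e_def[symmetric] by presburger
    then consider "a + b \<ge> 3" | "a \<ge> 1 \<and> a + b \<le> 2 \<and> a + b + c = 4" | "a \<ge> 1 \<and> a + b \<le> 2 \<and> a + b + c \<ge> 5" | "a = 0 \<and> b \<le> 2 \<and> b + c \<ge> 5" | "a = 0 \<and> b \<le> 2 \<and> b + c = 4 \<and> e \<ge> 1" | "a + b + c = 3 \<and> a + b \<le> 2 \<and> e \<ge> 3" | "a + b + c = 2 \<and> e \<ge> 5" | "a + b + c = 1 \<and> e \<ge> 7" | "a + b + c = 0 \<and> e \<ge> 9"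
      by blast
    then show "\<exists>g\<in>G. \<forall>x. lookup g x \<le> lookup m x"
    proof cases
      case 1
      then obtain a' b' where "a' \<le> a" "b' \<le> b" "a' + b' = 3"
        using split_exponents[of 3 a b 0] by auto
      then show ?thesis by (intro wit[of a' b' 0 0]) (auto simp: G_def)
    next
      case 2
      then show ?thesis by (intro wit[of a b c 0]) (auto simp: G_def)
    next
      case 3
      then show ?thesis by (intro wit[of 1 0 3 0]) (auto simp: G_def)
    next
      case 4
      then consider "b = 0" | "b = 1" | "b = 2" by linarith
      then show ?thesis
        by cases (use 4 in \<open>intro wit[of 0 b "5 - b" 0]; auto simp: G_def\<close>)+
    next
      case 5
      then consider "b = 0" | "b = 1" | "b = 2" by linarith
      then show ?thesis
        by cases (use 5 in \<open>intro wit[of 0 b c 1]; auto simp: G_def\<close>)+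
    next
      case 6
      then have "c = 1 \<and> a + b = 2 \<or> c = 2 \<and> a + b = 1 \<or> c = 3 \<and> a = 0 \<and> b = 0"
        by presburger
      with 6 show ?thesis by (intro wit[of a b c 3]) (auto simp: G_def mon4_eq_iff)
    next
      case 7
      then show ?thesis by (intro wit[of a b c 5]) (auto simp: G_def)
    next
      case 8
      then show ?thesis by (intro wit[of a b c 7]) (auto simp: G_def)
    next
      case 9
      then show ?thesis by (intro wit[of 0 0 0 9]) (auto simp: G_def)
    qed
  qed
  finally show ?thesis .
qed

section \<open>From linear conditions to the initial ideal\<close>

text \<open>The cubics span the binary cubics once $x_3$ and $x_4$ are set to zero if and only if their
  coefficients on this set can be prescribed.\<close>

definition slice3 :: "(4 \<Rightarrow>\<^sub>0 nat) set" where
  "slice3 = {m. mono_deg m = 3 \<and> lookup m 3 = 0 \<and> lookup m 4 = 0}"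

text \<open>The monomials of degree 4 in $x_1,x_2,x_3$ other than $x_3^4$, $x_3^3x_2$, $x_3^3x_1$.\<close>

definition slice4_I :: "(4 \<Rightarrow>\<^sub>0 nat) set" where
  "slice4_I = {m. mono_deg m = 4 \<and> lookup m 4 = 0 \<and> lookup m 3 \<le> 2}"

text \<open>The monomials of degree 4 in $x_1,x_2,x_3$ other than $x_3^4$, $x_3^3x_2$, $x_3^2x_2^2$.\<close>

definition slice4_II :: "(4 \<Rightarrow>\<^sub>0 nat) set" where
  "slice4_II = {m. mono_deg m = 4 \<and> lookup m 4 = 0 \<and> (lookup m 1 > 0 \<or> lookup m 3 \<le> 1)}"

text \<open>The complement in degree \<open>d\<close> consists of the multiples of $x_4^{2d-8}$.  Hence prescribing the
  coefficients on this set means that multiplication by $x_4^{2d-8}$ maps degree $8-d$ of the quotient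
  ring onto degree \<open>d\<close>.\<close>

definition slice :: "nat \<Rightarrow> (4 \<Rightarrow>\<^sub>0 nat) set" where
  "slice d = {m. mono_deg m = d \<and> lookup m 4 + 8 < 2 * d}"

definition position_slices :: "(4 \<Rightarrow>\<^sub>0 nat) set set" where
  "position_slices = {slice3, slice4_II} \<union> slice ` {5..9}"

definition good_position :: "(4, 'a::field) mpoly set \<Rightarrow> bool" where
  "good_position J \<longleftrightarrow> (\<forall>C\<in>position_slices. prescribable J C)"

lemma card_slice4: "card slice4_I = 12" "card slice4_II = 12"
proof -
  have "slice4_I = {m. (lookup m 1 + lookup m 2 + lookup m 3 = 4 \<and> lookup m 3 \<le> 2) \<and> lookup m 4 < 1}"
    by (auto simp: slice4_I_def mono_deg_4)
  then have "card slice4_I = (\<Sum>a<5. \<Sum>b<5. \<Sum>c<5. if a + b + c = (4::nat) \<and> c \<le> 2 then 1 else 0)"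
    using card_exponents[of "\<lambda>a b c. a + b + c = 4 \<and> c \<le> 2" 5 "\<lambda>_ _ _. 1"] by auto
  also have "\<dots> = 12" by code_simp
  finally show "card slice4_I = 12" .
  have "slice4_II = {m. (lookup m 1 + lookup m 2 + lookup m 3 = 4 \<and> (lookup m 1 > 0 \<or> lookup m 3 \<le> 1)) \<and> lookup m 4 < 1}"
    by (auto simp: slice4_II_def mono_deg_4)
  then have "card slice4_II = (\<Sum>a<5. \<Sum>b<5. \<Sum>c<5. if a + b + c = (4::nat) \<and> (a > 0 \<or> c \<le> 1) then 1 else 0)"
    using card_exponents[of "\<lambda>a b c. a + b + c = 4 \<and> (a > 0 \<or> c \<le> 1)" 5 "\<lambda>_ _ _. 1"] by auto
  also have "\<dots> = 12" by code_simp
  finally show "card slice4_II = 12" .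
qed

lemma LM_upward:
  assumes "g \<in> LM J" "is_ideal J" "\<And>x. lookup g x \<le> lookup m x"
  shows "m \<in> LM J"
proof -
  have "m = (m - g) + g"
    using assms(3) by (intro poly_mapping_eqI) (simp add: lookup_add lookup_minus)
  with LM_add[OF assms(2,1)] show ?thesis by metis
qed

context cubics
begin

lemma slice_subset_LM:
  assumes "prescribable I (slice d)"
  shows "slice d \<subseteq> LM I"
proof
  fix m assume m: "m \<in> slice d"
  then show "m \<in> LM I"
    by (intro prescribable_imp_LM[OF assms]) (auto simp: slice_def revlex_less_def)
qed

lemma slice3_subset_LM:
  assumes "prescribable I slice3"
  shows "slice3 \<subseteq> LM I"
proof
  fix m assume m: "m \<in> slice3"
  then show "m \<in> LM I"
    by (intro prescribable_imp_LM[OF assms]) (auto simp: slice3_def revlex_less_def)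
qed

lemma slice4_I_subset_LM:
  assumes "prescribable I slice4_I"
  shows "slice4_I \<subseteq> LM I"
proof
  fix m assume m: "m \<in> slice4_I"
  then show "m \<in> LM I"
    by (intro prescribable_imp_LM[OF assms]) (auto simp: slice4_I_def revlex_less_def)
qed

lemma slice4_II_subset_LM:
  assumes "prescribable I slice4_II" and m: "m \<in> slice4_II" "lookup m 3 = 2"
  shows "m \<in> LM I"
  using m by (intro prescribable_imp_LM[OF assms(1)]) (auto simp: slice4_II_def revlex_less_def mono_deg_4)

text \<open>The twelve products of the cubics with $x_1,x_2,x_3$, taken modulo $x_4$, are independent on
  the twelve coordinates of \<^term>\<open>slice4_II\<close>.  If some combination of them vanishes on the twelve
  coordinates of \<^term>\<open>slice4_I\<close>, it involves only $x_3^3x_1$, $x_3^3x_2$, $x_3^4$, and the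
  coefficient of $x_3^3x_1$ cannot vanish.\<close>

lemma degenerate_lead_mono:
  assumes II: "prescribable I slice4_II" and I: "\<not> prescribable I slice4_I"
  shows "mon4 1 0 3 0 \<in> LM I"
proof -
  define M :: "(4 \<Rightarrow>\<^sub>0 nat) set" where "M = {\<mu>. mono_deg \<mu> = 1 \<and> lookup \<mu> 4 = 0}"
  define N where "N = (UNIV :: 4 set) \<times> M"
  define a where "a = (\<lambda>(i, \<mu>) c. lookup (Monom \<mu> * h i) c)"
  have "finite M" unfolding M_def by (rule finite_subset[OF _ finite_mono_deg_eq[of 1]]) auto
  have fin: "finite slice4_I" "finite slice4_II" "finite N"
    using \<open>finite M\<close> by (auto simp: slice4_I_def slice4_II_def N_def intro: finite_subset[OF _ finite_mono_deg_eq[of 4]])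
  have "M = {m. (lookup m 1 + lookup m 2 + lookup m 3 = 1) \<and> lookup m 4 < 1}"
    by (auto simp: M_def mono_deg_4)
  then have "card M = (\<Sum>a<2. \<Sum>b<2. \<Sum>c<2. if a + b + c = (1::nat) then 1 else 0)"
    using card_exponents[of "\<lambda>a b c. a + b + c = 1" 2 "\<lambda>_ _ _. 1"] by auto
  also have "\<dots> = 3" by code_simp
  finally have "card N = 12" by (simp add: N_def card_cartesian_product)
  have iff: "prescribable I C \<longleftrightarrow> solvable a N C" if "C \<subseteq> {m. mono_deg m = 4 \<and> lookup m 4 = 0}" for C
    unfolding a_def N_def
    by (rule prescribable_iff_solvable[where d = 1]) (use that in \<open>auto simp: M_def lookup_add\<close>)
  have solv: "\<not> solvable a N slice4_I" "solvable a N slice4_II"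
    using iff[of slice4_I] iff[of slice4_II] assms by (auto simp: slice4_I_def slice4_II_def)
  obtain x where x: "\<exists>z\<in>N. x z \<noteq> 0" "\<And>c. c \<in> slice4_I \<Longrightarrow> (\<Sum>z\<in>N. a z c * x z) = 0"
    using not_solvable_imp_kernel[OF fin(1,3) _ solv(1)] card_slice4 \<open>card N = 12\<close> by auto
  define q where "q = (\<lambda>i. \<Sum>\<mu>\<in>M. Const (x (i, \<mu>)) * Monom \<mu>)"
  define g where "g = (\<Sum>i\<in>UNIV. q i * h i)"
  have "homogeneous 1 (q i)" for i
    unfolding q_def
  proof (intro homogeneous_sum homogeneous_Const_times)
    fix \<mu> assume "\<mu> \<in> M"
    then show "homogeneous 1 (Monom \<mu>)" using homogeneous_Monom[of \<mu>] by (simp add: M_def)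
  qed
  then have "homogeneous (1 + 3) g"
    unfolding g_def by (intro homogeneous_sum homogeneous_mult cubic)
  then have hom: "homogeneous 4 g" by simp
  have g: "lookup g c = (\<Sum>z\<in>N. a z c * x z)" for c
  proof -
    have "q i * h i = (\<Sum>\<mu>\<in>M. Const (x (i, \<mu>)) * (Monom \<mu> * h i))" for i
      by (simp add: q_def sum_distrib_right mult.assoc)
    then have "lookup g c = (\<Sum>i\<in>UNIV. \<Sum>\<mu>\<in>M. x (i, \<mu>) * lookup (Monom \<mu> * h i) c)"
      by (simp add: g_def lookup_sum)
    then show ?thesis
      by (simp add: N_def a_def sum.cartesian_product case_prod_unfold mult.commute)
  qed
  have g0: "lookup g c = 0" if "c \<in> slice4_I" for c
    using x(2)[OF that] by (simp add: g)
  have "lookup g (mon4 1 0 3 0) \<noteq> 0"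
  proof
    assume *: "lookup g (mon4 1 0 3 0) = 0"
    \<comment> \<open>The only element of \<^const>\<open>slice4_II\<close> outside \<^const>\<open>slice4_I\<close> is $x_1x_3^3$.\<close>
    have "(\<Sum>z\<in>N. a z c * x z) = 0" if "c \<in> slice4_II" for c
    proof (cases "c \<in> slice4_I")
      case False
      with that have "mon4 1 0 3 0 = c"
        by (auto simp: slice4_I_def slice4_II_def mono_deg_4 mon4_eq_iff)
      with * show ?thesis by (simp add: g)
    qed (use g0 g in auto)
    then have "x z = 0" if "z \<in> N" for z
      using solvable_imp_trivial_kernel[OF fin(2,3) _ solv(2) _ that] card_slice4 \<open>card N = 12\<close> by auto
    with x(1) show False by auto
  qed
  moreover have "revlex_less n (mon4 1 0 3 0)" if "n \<in> keys g" "n \<noteq> mon4 1 0 3 0" for n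
  proof -
    have "mono_deg n = 4" "n \<notin> slice4_I" using that hom g0[of n] by (auto simp: homogeneous_def in_keys_iff)
    with that(2) show ?thesis
      by (auto simp: slice4_I_def revlex_less_def mono_deg_4 mon4_eq_iff[symmetric])
        (auto simp: eq_commute[of n] mon4_eq_iff)
  qed
  ultimately have "is_lead_mono g (mon4 1 0 3 0)" by (auto simp: is_lead_mono_def in_keys_iff)
  with comb_in_I show ?thesis unfolding LM_def g_def by blast
qed

text \<open>Outside degree 4 the three kinds of conditions yield divisors of all nonstandard monomials: cubics in
  $x_1,x_2$, quintics in $x_1,x_2,x_3$, and products of $x_4^{9-2D}$ with a monomial of degree $D\le4$
  in $x_1,x_2,x_3$, which lie in degree $9-D$.  The degree 4 part is left to the two forms.\<close>

lemma nonstandard_subset_LM: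
  assumes pos: "good_position I"
    and four: "\<And>m. \<not> std m \<Longrightarrow> mono_deg m = 4 \<Longrightarrow> lookup m 4 = 0 \<Longrightarrow> lookup m 1 + lookup m 2 \<le> 2 \<Longrightarrow> m \<in> LM I"
    and std: "\<And>a b c e. a + b \<le> 2 \<Longrightarrow> a + b + c \<le> 4 \<Longrightarrow> 2 * (a + b + c) + e \<le> 8 \<Longrightarrow>
      (a + b + c = 4 \<Longrightarrow> std (mon4 a b c 0)) \<Longrightarrow> std (mon4 a b c e)"
  shows "{m. \<not> std m} \<subseteq> LM I"
proof clarify
  fix m assume m: "\<not> std m"
  define a b c e where abce: "a = lookup m 1" "b = lookup m 2" "c = lookup m 3" "e = lookup m 4"
  have m_eq: "m = mon4 a b c e" by (simp add: abce mon4_lookup)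
  have pre: "prescribable I C" if "C \<in> position_slices" for C
    using pos that by (simp add: good_position_def)
  have wit: "m \<in> LM I" if "mon4 a' b' c' e' \<in> LM I" "a' \<le> a" "b' \<le> b" "c' \<le> c" "e' \<le> e" for a' b' c' e'
  proof (rule LM_upward[OF that(1) is_ideal_ideal_gen])
    show "lookup (mon4 a' b' c' e') x \<le> lookup m x" for x
      using that exhaust_4[of x] by (auto simp: abce)
  qed
  have slice: "mon4 a' b' c' e' \<in> LM I" if "a' + b' + c' + e' = d" "e' + 8 < 2 * d" "d \<le> 9" for a' b' c' e' d
    using slice_subset_LM[of d] pre[of "slice d"] that by (auto simp: position_slices_def slice_def mono_deg_4)
  have "a + b \<ge> 3 \<or> a + b + c \<ge> 5 \<or> (a + b \<le> 2 \<and> a + b + c \<le> 4 \<and> 2 * (a + b + c) + e \<ge> 9)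
      \<or> (a + b \<le> 2 \<and> a + b + c = 4 \<and> \<not> std (mon4 a b c 0))"
    using std[of a b c e] m unfolding m_eq by linarith
  then consider "a + b \<ge> 3" | "a + b + c \<ge> 5" | "a + b \<le> 2 \<and> a + b + c \<le> 4 \<and> 2 * (a + b + c) + e \<ge> 9"
    | "a + b \<le> 2 \<and> a + b + c = 4 \<and> \<not> std (mon4 a b c 0)" by blast
  then show "m \<in> LM I"
  proof cases
    case 1
    then obtain a' b' where "a' \<le> a" "b' \<le> b" "a' + b' = 3"
      using split_exponents[of 3 a b 0] by auto
    then show ?thesis
      using slice3_subset_LM[OF pre[of slice3]]
      by (intro wit[of a' b' 0 0]) (auto simp: position_slices_def slice3_def mono_deg_4)
  next
    case 2
    then obtain a' b' c' where "a' \<le> a" "b' \<le> b" "c' \<le> c" "a' + b' + c' = 5"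
      using split_exponents by blast
    then show ?thesis by (intro wit[of a' b' c' 0] slice[of _ _ _ _ 5]) auto
  next
    case 3
    then show ?thesis
      by (intro wit[of a b c "9 - 2 * (a + b + c)"] slice[of _ _ _ _ "9 - (a + b + c)"]) auto
  next
    case 4
    then show ?thesis by (intro wit[of a b c 0] four) (auto simp: mono_deg_4)
  qed
qed

lemma initial_ideal_I:
  assumes pos: "good_position I" and pre: "prescribable I slice4_I"
  shows "initial_ideal I = gin_form_I"
proof -
  have "{m. \<not> std_I m} \<subseteq> LM I"
  proof (rule nonstandard_subset_LM[OF pos])
    fix m assume "\<not> std_I m" "mono_deg m = 4" "lookup m 4 = 0" "lookup m 1 + lookup m 2 \<le> 2"
    then have "m \<in> slice4_I" by (auto simp: std_I_def slice4_I_def mono_deg_4 Let_def)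
    with slice4_I_subset_LM[OF pre] show "m \<in> LM I" by auto
  qed (auto simp: std_I_def Let_def)
  then have "LM I = {m. \<not> std_I m}"
    by (rule LM_eqI) (simp_all add: std_mono_deg_le card_std)
  then show ?thesis by (simp add: initial_ideal_LM gin_form_I_eq)
qed

lemma initial_ideal_II:
  assumes pos: "good_position I" and "\<not> prescribable I slice4_I"
  shows "initial_ideal I = gin_form_II"
proof -
  have pre: "prescribable I slice4_II" using pos by (simp add: good_position_def position_slices_def)
  have "{m. \<not> std_II m} \<subseteq> LM I"
  proof (rule nonstandard_subset_LM[OF pos])
    fix m assume m: "\<not> std_II m" "mono_deg m = 4" "lookup m 4 = 0" "lookup m 1 + lookup m 2 \<le> 2"
    show "m \<in> LM I"
    proof (cases "lookup m 3 = 2")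
      case True
      with m have "m \<in> slice4_II" by (auto simp: std_II_def slice4_II_def mono_deg_4 Let_def)
      with slice4_II_subset_LM[OF pre] True show ?thesis by auto
    next
      case False
      with m have "mon4 1 0 3 0 = m"
        by (auto simp: std_II_def mono_deg_4 Let_def mon4_eq_iff)
      with degenerate_lead_mono[OF pre assms(2)] show ?thesis by simp
    qed
  qed (auto simp: std_II_def Let_def)
  then have "LM I = {m. \<not> std_II m}"
    by (rule LM_eqI) (simp_all add: std_mono_deg_le card_std)
  then show ?thesis by (simp add: initial_ideal_LM gin_form_II_eq)
qed

end

section \<open>Openness of good position\<close>

context function_algebra
begin

text \<open>Good position will be spread from one point in three ways: over matrices, over quadruples of cubics,
  and along a degeneration with one parameter.  The family \<open>H\<close> covers all of them.\<close>

lemma prescribable_open: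
  fixes H :: "'p \<Rightarrow> 4 \<Rightarrow> (4, 'k) mpoly"
  assumes H: "\<And>i. R_poly (\<lambda>x. H x i)" "\<And>x i. x \<in> X \<Longrightarrow> homogeneous 3 (H x i)"
    and C: "\<And>c. c \<in> C \<Longrightarrow> mono_deg c = d + 3"
    and p: "p \<in> X" "prescribable (ideal_gen (range (H p))) C"
  shows "\<exists>F. R F \<and> F p \<noteq> 0 \<and> (\<forall>x\<in>X. F x \<noteq> 0 \<longrightarrow> prescribable (ideal_gen (range (H x))) C)"
proof -
  define N where "N = (UNIV :: 4 set) \<times> {\<mu> :: 4 \<Rightarrow>\<^sub>0 nat. mono_deg \<mu> = d}"
  define a where "a = (\<lambda>x (i, \<mu>) c. lookup (Monom \<mu> * H x i) c)"
  have iff: "prescribable (ideal_gen (range (H x))) C \<longleftrightarrow> solvable (a x) N C" if "x \<in> X" for x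
  proof -
    interpret cubics "H x" by unfold_locales (rule H(2)[OF that])
    show ?thesis unfolding a_def N_def by (rule prescribable_iff_solvable) (use C in auto)
  qed
  have "finite C" by (rule finite_subset[OF _ finite_mono_deg_eq[of "d + 3"]]) (use C in auto)
  moreover have "R (\<lambda>x. a x z c)" for z c
    using R_poly_Monom_times[OF H(1)] by (cases z) (simp add: a_def R_poly_def)
  ultimately obtain F where "R F" "F p \<noteq> 0" "\<And>x. F x \<noteq> 0 \<Longrightarrow> solvable (a x) N C"
    using solvable_open[of C N a p] p iff by (auto simp: N_def)
  with iff show ?thesis by blast
qed

lemma good_position_open:
  fixes H :: "'p \<Rightarrow> 4 \<Rightarrow> (4, 'k) mpoly"
  assumes H: "\<And>i. R_poly (\<lambda>x. H x i)" "\<And>x i. x \<in> X \<Longrightarrow> homogeneous 3 (H x i)"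
    and p: "p \<in> X" "good_position (ideal_gen (range (H p)))"
  shows "\<exists>F. R F \<and> F p \<noteq> 0 \<and> (\<forall>x\<in>X. F x \<noteq> 0 \<longrightarrow> good_position (ideal_gen (range (H x))))"
proof -
  have ex: "\<exists>F. R F \<and> F p \<noteq> 0 \<and> (\<forall>x\<in>X. F x \<noteq> 0 \<longrightarrow> prescribable (ideal_gen (range (H x))) C)"
    if C: "C \<in> position_slices" for C
  proof -
    consider "C = slice3" | "C = slice4_II" | e where "e \<ge> 5" "C = slice e"
      using C unfolding position_slices_def by auto
    then have "\<exists>e\<ge>3. \<forall>c\<in>C. mono_deg c = e"
    proof cases
      case 1
      then show ?thesis by (intro exI[of _ 3]) (simp add: slice3_def)
    next
      case 2
      then show ?thesis by (intro exI[of _ 4]) (simp add: slice4_II_def)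
    next
      case (3 e)
      then show ?thesis by (intro exI[of _ e]) (simp add: slice_def)
    qed
    then obtain e where "e \<ge> 3" "\<And>c. c \<in> C \<Longrightarrow> mono_deg c = e" by blast
    then have deg: "mono_deg c = (e - 3) + 3" if "c \<in> C" for c using that by simp
    have "prescribable (ideal_gen (range (H p))) C"
      using p(2) C by (simp add: good_position_def)
    with p(1) show ?thesis
      using prescribable_open[where H = H and C = C and p = p and d = "e - 3"] H deg by blast
  qed
  from bchoice[OF ballI, OF ex] obtain F where F: "\<forall>C\<in>position_slices. R (F C) \<and> F C p \<noteq> 0
      \<and> (\<forall>x\<in>X. F C x \<noteq> 0 \<longrightarrow> prescribable (ideal_gen (range (H x))) C)" ..
  have fin: "finite position_slices" by (simp add: position_slices_def)
  show ?thesis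
  proof (intro exI[of _ "\<lambda>x. \<Prod>C\<in>position_slices. F C x"] conjI)
    show "R (\<lambda>x. \<Prod>C\<in>position_slices. F C x)" using F by (intro R_prod) auto
    show "(\<Prod>C\<in>position_slices. F C p) \<noteq> 0" using F fin by (simp add: prod_zero_iff)
    show "\<forall>x\<in>X. (\<Prod>C\<in>position_slices. F C x) \<noteq> 0 \<longrightarrow> good_position (ideal_gen (range (H x)))"
      using F fin by (auto simp: prod_zero_iff good_position_def)
  qed
qed

end

section \<open>The generic initial ideal of four cubics in good position\<close>

lemma lin_change_range: "lin_change A ` range f = range (\<lambda>i. lin_change A (f i))"
  by auto

text \<open>Good position holds on a nonempty open set of matrices.  If the coefficients on \<^const>\<open>slice4_I\<close> can be
  prescribed for a single matrix, they can on a nonempty open set, which meets the first one;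
  otherwise they can for no matrix at all, and the degenerate case occurs throughout.\<close>

lemma Gin_of_good_position:
  fixes f :: "4 \<Rightarrow> (4, 'k::field_char_0) mpoly"
  assumes cubic: "\<And>i. homogeneous 3 (f i)" and A0: "A0 \<in> GL"
    and pos: "good_position (lin_change A0 ` ideal_gen (range f))"
  shows "Gin (ideal_gen (range f)) = gin_form_I \<or> Gin (ideal_gen (range f)) = gin_form_II"
proof -
  let ?\<phi> = "\<lambda>(A :: 'k ^ 4 ^ 4) (i, j). A $ i $ j"
  define H where "H = (\<lambda>A i. lin_change A (f i))"
  have image: "lin_change A ` ideal_gen (range f) = ideal_gen (range (H A))" if "A \<in> GL" for A
    using lin_change_ideal_gen[OF that, of "range f"] by (simp add: H_def lin_change_range)
  interpret function_algebra "zariski_fun ?\<phi> GL" GL by (rule function_algebra_zariski_fun)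
  have "zariski_fun ?\<phi> GL (\<lambda>A. A $ i $ j)" for i j
    using zariski_fun_coord[of ?\<phi> GL "(i, j)"] by simp
  then have regular: "R_poly (\<lambda>A. H A i)" for i
    unfolding H_def by (rule R_poly_lin_change) (auto intro: R_poly_const cubic)
  have hom: "homogeneous 3 (H A i)" for A i
    unfolding H_def by (rule homogeneous_lin_change[OF cubic])
  obtain F where F: "zariski_fun ?\<phi> GL F" "F A0 \<noteq> 0"
    "\<And>A. A \<in> GL \<Longrightarrow> F A \<noteq> 0 \<Longrightarrow> good_position (ideal_gen (range (H A)))"
    using good_position_open[where H = H, OF regular hom A0] pos image[OF A0] by auto
  define U where "U = {A \<in> GL. F A \<noteq> 0}"
  have U: "zariski_open_in ?\<phi> GL U" "U \<noteq> {}"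
    using zariski_open_nonzero[OF F(1)] F(2) A0 by (auto simp: U_def)
  show ?thesis
  proof (cases "\<exists>A1\<in>GL. prescribable (ideal_gen (range (H A1))) slice4_I")
    case True
    then obtain A1 where A1: "A1 \<in> GL" "prescribable (ideal_gen (range (H A1))) slice4_I" by blast
    obtain F' where F': "zariski_fun ?\<phi> GL F'" "F' A1 \<noteq> 0"
      "\<And>A. A \<in> GL \<Longrightarrow> F' A \<noteq> 0 \<Longrightarrow> prescribable (ideal_gen (range (H A))) slice4_I"
      using prescribable_open[where H = H and d = 1, OF regular hom _ A1] by (auto simp: slice4_I_def)
    have "{A \<in> GL. F' A \<noteq> 0} \<noteq> {}" using F'(2) A1 by auto
    then obtain A2 where "A2 \<in> GL" "F A2 * F' A2 \<noteq> 0"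
      using GL_opens_meet[OF U zariski_open_nonzero[OF F'(1)]] by (auto simp: U_def)
    define V where "V = {A \<in> GL. F A * F' A \<noteq> 0}"
    have "Gin (ideal_gen (range f)) = gin_form_I"
    proof (rule Gin_eqI)
      show "zariski_open_in ?\<phi> GL V"
        unfolding V_def by (rule zariski_open_nonzero) (rule R_mult[OF F(1) F'(1)])
      show "V \<noteq> {}" using \<open>A2 \<in> GL\<close> \<open>F A2 * F' A2 \<noteq> 0\<close> by (auto simp: V_def)
      fix A assume A: "A \<in> V"
      interpret cubics "H A" by unfold_locales (rule hom)
      show "initial_ideal (lin_change A ` ideal_gen (range f)) = gin_form_I"
        using A F(3) F'(3) image by (auto simp: V_def intro!: initial_ideal_I)
    qed
    then show ?thesis by simp
  next
    case False
    have "Gin (ideal_gen (range f)) = gin_form_II"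
    proof (rule Gin_eqI[OF U])
      fix A assume A: "A \<in> U"
      interpret cubics "H A" by unfold_locales (rule hom)
      show "initial_ideal (lin_change A ` ideal_gen (range f)) = gin_form_II"
        using A F(3) False image by (auto simp: U_def intro!: initial_ideal_II)
    qed
    then show ?thesis by simp
  qed
qed

section \<open>The strong Lefschetz property of a monomial complete intersection\<close>

definition lin_ext :: "(('x \<Rightarrow>\<^sub>0 nat) \<Rightarrow> ('x, 'a) mpoly) \<Rightarrow> ('x, 'a::comm_ring_1) mpoly \<Rightarrow> ('x, 'a) mpoly" where
  "lin_ext g p = (\<Sum>m\<in>keys p. Const (lookup p m) * g m)"

lemma lin_ext_superset:
  assumes "finite F" "keys p \<subseteq> F"
  shows "lin_ext g p = (\<Sum>m\<in>F. Const (lookup p m) * g m)"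
  unfolding lin_ext_def using assms by (intro sum.mono_neutral_left) (auto simp: in_keys_iff)

lemma lin_ext_add: "lin_ext g (p + q) = lin_ext g p + lin_ext g q"
proof -
  define F where "F = keys p \<union> keys q"
  have F: "finite F" "keys p \<subseteq> F" "keys q \<subseteq> F" "keys (p + q) \<subseteq> F"
    using keys_add[of p q] by (auto simp: F_def)
  show ?thesis
    by (simp add: lin_ext_superset[of F] F lookup_add Const_add distrib_right sum.distrib)
qed

lemma lin_ext_Const: "lin_ext g (Const c * p) = Const c * lin_ext g p"
  by (subst lin_ext_superset[OF finite_keys[of p]])
    (auto simp: in_keys_iff lin_ext_def sum_distrib_left Const_mult mult.assoc)

lemma lin_ext_Monom: "lin_ext g (Monom m) = g m"
  by (simp add: lin_ext_def lookup_Monom)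

lemma lin_ext_0: "lin_ext g 0 = 0"
  by (simp add: lin_ext_def)

lemma lin_ext_sum: "lin_ext g (sum f A) = (\<Sum>i\<in>A. lin_ext g (f i))"
  by (induction A rule: infinite_finite_induct) (simp_all add: lin_ext_0 lin_ext_add)

lemma lin_ext_uminus: "lin_ext g (- p) = - lin_ext g p"
  using lin_ext_Const[of g "-1" p] by (simp add: Const_uminus)

lemma lin_ext_diff: "lin_ext g (p - q) = lin_ext g p - lin_ext g q"
  using lin_ext_add[of g p "- q"] by (simp add: lin_ext_uminus)

text \<open>Together with multiplication by the sum of the variables, this operator makes the polynomials
  modulo the $N$-th powers of the variables a representation of sl2, the tensor product of one
  irreducible representation of dimension $N$ for each variable.\<close>

definition lower :: "nat \<Rightarrow> ('x::finite, 'a::field) mpoly \<Rightarrow> ('x, 'a) mpoly" where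
  "lower N = lin_ext (\<lambda>m. \<Sum>i\<in>UNIV. Const (of_nat (lookup m i) * (of_nat N - of_nat (lookup m i)))
     * Monom (m - Poly_Mapping.single i 1))"

abbreviation var_sum :: "('x::finite, 'a::comm_ring_1) mpoly" where
  "var_sum \<equiv> \<Sum>i\<in>UNIV. Var i"

abbreviation power_ideal :: "nat \<Rightarrow> ('x::finite, 'a::comm_ring_1) mpoly set" where
  "power_ideal N \<equiv> ideal_gen (range (\<lambda>i. Var i ^ N))"

lemma Monom_in_power_ideal:
  assumes "N \<le> lookup m i"
  shows "Monom m \<in> (power_ideal N :: ('x::finite, 'a::comm_ring_1) mpoly set)"
proof -
  have "m = (m - Poly_Mapping.single i N) + Poly_Mapping.single i N"
    using assms by (intro poly_mapping_eqI) (auto simp: lookup_add lookup_minus lookup_single when_def)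
  then have "(Monom m :: ('x, 'a) mpoly) = Monom (m - Poly_Mapping.single i N) * Var i ^ N"
    by (metis Monom_add Monom_single)
  then show ?thesis
    by (simp only:) (intro ideal_mult[OF is_ideal_ideal_gen] ideal_gen_base rangeI)
qed

lemma homogeneous_above_socle:
  fixes p :: "('x::finite, 'a::field) mpoly"
  assumes "homogeneous d p" "CARD('x) * (N - 1) < d"
  shows "p \<in> power_ideal N"
proof -
  have "Monom m \<in> (power_ideal N :: ('x, 'a) mpoly set)" if "m \<in> keys p" for m
  proof -
    have "mono_deg m = d" using that assms(1) by (auto simp: homogeneous_def)
    have "\<exists>i. N \<le> lookup m i"
    proof (rule ccontr)
      assume "\<not> ?thesis"
      then have "lookup m i < N" for i by (auto simp: not_le)
      then have "lookup m i \<le> N - 1" for i by (metis Suc_diff_1 less_Suc_eq_le not_less_zero zero_less_iff_neq_zero)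
      then have "mono_deg m \<le> CARD('x) * (N - 1)"
        unfolding mono_deg_UNIV using sum_bounded_above[of UNIV "lookup m" "N - 1"] by simp
      with assms(2) \<open>mono_deg m = d\<close> show False by simp
    qed
    then show ?thesis using Monom_in_power_ideal by blast
  qed
  then have "(\<Sum>m\<in>keys p. Const (lookup p m) * Monom m) \<in> power_ideal N"
    by (intro ideal_sum[OF is_ideal_ideal_gen] ideal_mult[OF is_ideal_ideal_gen])
  then show ?thesis by (simp flip: mpoly_eq_sum)
qed

lemma lower_Monom: "lower N (Monom m) = (\<Sum>i\<in>UNIV. Const (of_nat (lookup m i) * (of_nat N - of_nat (lookup m i)))
     * Monom (m - Poly_Mapping.single i 1))"
  by (simp add: lower_def lin_ext_Monom)

text \<open>A multiple of $x_i^N$ could leave the ideal only when the exponent $m_i=N$ is lowered, and there the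
  factor $m_i(N-m_i)$ vanishes.\<close>

lemma lower_power_ideal:
  fixes p :: "('x::finite, 'a::field) mpoly"
  assumes "p \<in> power_ideal N"
  shows "lower N p \<in> power_ideal N"
proof -
  have step: "lower N (Monom m) \<in> (power_ideal N :: ('x, 'a) mpoly set)" if "N \<le> lookup m i" for m i
    unfolding lower_Monom
  proof (rule ideal_sum[OF is_ideal_ideal_gen])
    fix j
    show "Const (of_nat (lookup m j) * (of_nat N - of_nat (lookup m j))) * Monom (m - Poly_Mapping.single j 1)
        \<in> (power_ideal N :: ('x, 'a) mpoly set)"
    proof (cases "j = i \<and> lookup m i = N")
      case True
      then show ?thesis by (simp add: ideal_zero)
    next
      case False
      then have "N \<le> lookup (m - Poly_Mapping.single j 1) i"
        using that by (auto simp: lookup_minus lookup_single when_def)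
      then show ?thesis by (intro ideal_mult[OF is_ideal_ideal_gen] Monom_in_power_ideal)
    qed
  qed
  obtain q where q: "p = (\<Sum>i\<in>UNIV. q i * Var i ^ N)"
    using assms unfolding ideal_gen_image[OF finite_class.finite_UNIV] by blast
  have "lower N (q i * Var i ^ N) \<in> power_ideal N" for i
  proof -
    have "q i * Var i ^ N = (\<Sum>m\<in>keys (q i). Const (lookup (q i) m) * Monom m) * Var i ^ N"
      by (simp flip: mpoly_eq_sum)
    also have "\<dots> = (\<Sum>m\<in>keys (q i). Const (lookup (q i) m) * Monom (m + Poly_Mapping.single i N))"
      by (simp add: sum_distrib_right Monom_add Monom_single mult.assoc)
    finally have eq: "q i * Var i ^ N = (\<Sum>m\<in>keys (q i). Const (lookup (q i) m) * Monom (m + Poly_Mapping.single i N))" .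
    have "lower N (q i * Var i ^ N)
        = (\<Sum>m\<in>keys (q i). Const (lookup (q i) m) * lower N (Monom (m + Poly_Mapping.single i N)))"
      unfolding eq lower_def by (simp add: lin_ext_sum lin_ext_Const)
    also have "\<dots> \<in> power_ideal N"
      by (intro ideal_sum[OF is_ideal_ideal_gen] ideal_mult[OF is_ideal_ideal_gen] step[of _ i])
        (simp add: lookup_add)
    finally show ?thesis .
  qed
  then show ?thesis
    unfolding q lower_def lin_ext_sum by (intro ideal_sum[OF is_ideal_ideal_gen])
qed

lemma homogeneous_lower:
  fixes p :: "('x::finite, 'a::field) mpoly"
  assumes "homogeneous e p"
  shows "homogeneous (e - 1) (lower N p)"
  unfolding lower_def lin_ext_def
proof (rule homogeneous_sum, rule homogeneous_Const_times, rule homogeneous_sum)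
  fix m i assume "m \<in> keys p"
  then have e: "mono_deg m = e" using assms by (auto simp: homogeneous_def)
  show "homogeneous (e - 1) (Const (of_nat (lookup m i) * (of_nat N - of_nat (lookup m i)))
      * Monom (m - Poly_Mapping.single i 1) :: ('x, 'a) mpoly)"
  proof (cases "lookup m i = 0")
    case False
    then have "m = (m - Poly_Mapping.single i 1) + Poly_Mapping.single i 1"
      by (intro poly_mapping_eqI) (auto simp: lookup_add lookup_minus lookup_single when_def)
    then have "mono_deg m = mono_deg (m - Poly_Mapping.single i 1) + 1"
      by (metis mono_deg_add mono_deg_single)
    with e have "mono_deg (m - Poly_Mapping.single i 1) = e - 1" by simp
    then show ?thesis by (metis homogeneous_Const_times homogeneous_Monom)
  qed simp
qed

text \<open>The commutator of raising and lowering is the weight.  Only the terms that lower and raise the same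
  exponent $m$ survive, with $(m+1)(N-m-1)-m(N-m)=N-1-2m$.\<close>

lemma lower_var_sum:
  fixes p :: "('x::finite, 'a::field) mpoly"
  assumes "homogeneous e p" "N \<ge> 1"
  shows "lower N (var_sum * p) = var_sum * lower N p + Const (of_nat (CARD('x) * (N - 1)) - 2 * of_nat e) * p"
proof -
  have mono: "lower N (var_sum * Monom m) = var_sum * lower N (Monom m)
      + Const (of_nat (CARD('x) * (N - 1)) - 2 * of_nat (mono_deg m)) * (Monom m :: ('x, 'a) mpoly)" for m
  proof -
    define k where "k = (\<lambda>n :: nat. of_nat n * (of_nat N - of_nat n) :: 'a)"
    let ?s = "\<lambda>i :: 'x. Poly_Mapping.single i (1::nat)"
    have diff: "Const (k (lookup (?s j + m) i)) * Monom (?s j + m - ?s i)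
        - Var j * (Const (k (lookup m i)) * Monom (m - ?s i))
        = (if i = j then Const (of_nat N - 1 - 2 * of_nat (lookup m j)) * Monom m else (0 :: ('x, 'a) mpoly))" for i j
    proof (cases "i = j")
      case True
      have "?s j + m - ?s j = m" by simp
      moreover have "Const (k (lookup m j)) * (Var j * Monom (m - ?s j)) = Const (k (lookup m j)) * (Monom m :: ('x, 'a) mpoly)"
      proof (cases "lookup m j = 0")
        case False
        then have "j \<in> keys m" by (simp add: in_keys_iff)
        from Monom_eq_Var_times[OF this] show ?thesis by metis
      qed (simp add: k_def)
      moreover have "k (1 + lookup m j) - k (lookup m j) = of_nat N - 1 - 2 * of_nat (lookup m j)"
        by (simp add: k_def algebra_simps)
      ultimately show ?thesis using True
        by (simp add: lookup_add mult.left_commute[of "Var j"] flip: left_diff_distrib Const_diff)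
    next
      case False
      then have l: "lookup (?s j + m) i = lookup m i"
        by (simp add: lookup_add lookup_single when_def)
      show ?thesis
      proof (cases "lookup m i = 0")
        case True
        then show ?thesis using False l by (simp add: k_def)
      next
        case mi: False
        have "?s j + m - ?s i = ?s j + (m - ?s i)"
          using mi False by (intro poly_mapping_eqI) (auto simp: lookup_add lookup_minus lookup_single when_def)
        then show ?thesis using False
          using l by (simp add: Monom_add Monom_single mult.left_commute[of "Var j"])
      qed
    qed
    have "var_sum * (Monom m :: ('x, 'a) mpoly) = (\<Sum>j\<in>UNIV. Monom (?s j + m))"
      by (simp add: sum_distrib_right Monom_add Monom_single)
    then have "lower N (var_sum * (Monom m :: ('x, 'a) mpoly))
        = (\<Sum>j\<in>UNIV. \<Sum>i\<in>UNIV. Const (k (lookup (?s j + m) i)) * Monom (?s j + m - ?s i))"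
      unfolding lower_def by (simp only: lin_ext_sum lin_ext_Monom k_def)
    moreover have "var_sum * lower N (Monom m :: ('x, 'a) mpoly)
        = (\<Sum>j\<in>UNIV. \<Sum>i\<in>UNIV. Var j * (Const (k (lookup m i)) * Monom (m - ?s i)))"
      unfolding lower_Monom k_def by (simp only: sum_product)
    ultimately have "lower N (var_sum * (Monom m :: ('x, 'a) mpoly)) - var_sum * lower N (Monom m)
        = (\<Sum>j\<in>UNIV. \<Sum>i\<in>UNIV. if i = j then Const (of_nat N - 1 - 2 * of_nat (lookup m j)) * Monom m else 0)"
      by (simp only: diff flip: sum_subtractf)
    also have "\<dots> = Const (\<Sum>j\<in>UNIV. of_nat N - 1 - 2 * of_nat (lookup m j)) * Monom m"
      by (simp add: Const_sum sum_distrib_right)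
    also have "(\<Sum>j\<in>UNIV. of_nat N - 1 - 2 * of_nat (lookup m j) :: 'a)
        = of_nat (CARD('x) * (N - 1)) - 2 * of_nat (mono_deg m)"
      using assms(2) by (simp add: sum_subtractf mono_deg_UNIV sum_distrib_left of_nat_diff)
    finally show ?thesis by (simp add: algebra_simps)
  qed
  have p: "p = (\<Sum>m\<in>keys p. Const (lookup p m) * Monom m)"
    by (rule mpoly_eq_sum) auto
  have "lower N (var_sum * p) = (\<Sum>m\<in>keys p. Const (lookup p m) * lower N (var_sum * Monom m))"
    by (subst p) (simp add: sum_distrib_left lower_def lin_ext_sum mult.left_commute[of _ "Const _"] lin_ext_Const)
  also have "\<dots> = (\<Sum>m\<in>keys p. Const (lookup p m) * (var_sum * lower N (Monom m))
      + Const (lookup p m) * (Const (of_nat (CARD('x) * (N - 1)) - 2 * of_nat e) * Monom m))"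
    using assms(1) by (intro sum.cong refl) (simp only: mono distrib_left homogeneous_def)
  also have "\<dots> = var_sum * (\<Sum>m\<in>keys p. Const (lookup p m) * lower N (Monom m))
      + Const (of_nat (CARD('x) * (N - 1)) - 2 * of_nat e) * (\<Sum>m\<in>keys p. Const (lookup p m) * Monom m)"
    by (simp add: sum.distrib sum_distrib_left mult.left_commute)
  also have "(\<Sum>m\<in>keys p. Const (lookup p m) * lower N (Monom m)) = lower N p"
    by (simp add: lower_def lin_ext_Monom) (simp add: lin_ext_def)
  finally show ?thesis using p by simp
qed

text \<open>By downward induction on the degree one may subtract a multiple of the right power of the
  sum of the variables and assume that this sum annihilates \<open>p\<close>, that is, \<open>p\<close> is a highest weight
  vector, of weight $k=2d-s$ where $s$ is the socle degree.  For such \<open>p\<close> lowering \<open>k\<close> times and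
  raising \<open>k\<close> times is multiplication by $(k!)^2$.\<close>

lemma strong_Lefschetz:
  fixes p :: "('x::finite, 'a::field_char_0) mpoly"
  assumes N: "N \<ge> 1" and p: "homogeneous d p" and d: "CARD('x) * (N - 1) \<le> 2 * d"
  shows "\<exists>q. p - var_sum ^ (2 * d - CARD('x) * (N - 1)) * q \<in> power_ideal N"
proof -
  define s where "s = CARD('x) * (N - 1)"
  define J where "J = (power_ideal N :: ('x, 'a) mpoly set)"
  define L where "L = (var_sum :: ('x, 'a) mpoly)"
  have J: "is_ideal J" by (simp add: J_def)
  have socle: "p \<in> J" if "homogeneous e p" "s < e" for p e
    using homogeneous_above_socle[OF that(1)] that(2) by (simp add: s_def J_def)
  have hL: "homogeneous 1 L" unfolding L_def by (intro homogeneous_sum homogeneous_Var)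
  have hLn: "homogeneous n (L ^ n)" for n using homogeneous_power[OF hL, of n] by simp
  have comm: "lower N (L * p) = L * lower N p + Const (of_nat s - 2 * of_nat e) * p" if "homogeneous e p" for p e
    using lower_var_sum[OF that N] by (simp add: L_def s_def)
  have core: "\<exists>q. homogeneous (s - d) q \<and> p - L ^ (2 * d - s) * q \<in> J"
    if p: "homogeneous d p" and d: "s \<le> 2 * d" "d \<le> s"
      and r: "homogeneous (s - d) (L * r)" and Lp: "L * p - L ^ (2 * Suc d - s) * r \<in> J" for d p r
  proof -
    define k where "k = 2 * d - s"
    have k: "of_nat k = (2 * of_nat d - of_nat s :: 'a)" "k \<le> d" "d - k = s - d" "2 * Suc d - s = k + 2"
      using d by (auto simp: k_def of_nat_diff)
    define p' where "p' = p - L ^ k * (L * r)"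
    have "homogeneous (k + (s - d)) (L ^ k * (L * r))"
      by (rule homogeneous_mult[OF hLn r])
    then have hp': "homogeneous d p'"
      using homogeneous_add[OF p, of "- (L ^ k * (L * r))"] k d
        homogeneous_Const_times[of d "L ^ k * (L * r)" "-1"] by (simp add: p'_def Const_uminus k_def)
    have Lp': "L * p' \<in> J"
      using Lp unfolding k(4) by (simp add: p'_def right_diff_distrib power_add power2_eq_square ac_simps)
    define v where "v = (\<lambda>j. (lower N ^^ j) p')"
    have v_Suc: "v (Suc j) = lower N (v j)" and v0: "v 0 = p'" for j by (simp_all add: v_def)
    have hv: "homogeneous (d - j) (v j)" for j
      by (induction j) (use hp' homogeneous_lower in \<open>force simp: v_Suc v0\<close>)+
    \<comment> \<open>The lowering chain of a highest weight vector: raising undoes the step from j - 1 to j up to this factor.\<close>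
    define \<gamma> where "\<gamma> = (\<lambda>j. of_nat j * (of_nat k - of_nat j + 1) :: 'a)"
    have raise_lower: "L * v (Suc j) - Const (\<gamma> (Suc j)) * v j \<in> J" if "j < k" for j
      using that
    proof (induction j)
      case 0
      have "L * v 1 - Const (\<gamma> 1) * v 0 = lower N (L * p')"
      proof -
        have "of_nat s - 2 * of_nat d = - \<gamma> 1" by (simp add: \<gamma>_def k(1))
        then show ?thesis
          using comm[OF hp'] v_Suc[of 0] by (simp add: v0 Const_uminus)
      qed
      with lower_power_ideal[OF Lp'[unfolded J_def]] show ?case by (simp add: J_def)
    next
      case (Suc j)
      let ?x = "L * v (Suc j) - Const (\<gamma> (Suc j)) * v j"
      have "lower N ?x \<in> J"
        using Suc lower_power_ideal[of ?x N] by (simp add: J_def)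
      also have "lower N ?x = lower N (L * v (Suc j)) - Const (\<gamma> (Suc j)) * v (Suc j)"
        by (simp add: lower_def lin_ext_diff lin_ext_Const v_Suc)
      also have "lower N (L * v (Suc j))
          = L * v (Suc (Suc j)) + Const (of_nat s - 2 * of_nat (d - Suc j)) * v (Suc j)"
        using comm[OF hv[of "Suc j"]] by (simp add: v_Suc)
      also have "of_nat s - 2 * of_nat (d - Suc j) = \<gamma> (Suc j) - \<gamma> (Suc (Suc j))"
        using Suc.prems k by (simp add: \<gamma>_def of_nat_diff algebra_simps)
      finally show ?case by (simp add: Const_diff algebra_simps)
    qed
    have "\<exists>c. c \<noteq> 0 \<and> L ^ j * v j - Const c * p' \<in> J" if "j \<le> k" for j
      using that
    proof (induction j)
      case 0
      then show ?case by (intro exI[of _ 1]) (simp add: v0 ideal_zero[OF J])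
    next
      case (Suc j)
      then obtain c where c: "c \<noteq> 0" "L ^ j * v j - Const c * p' \<in> J" by auto
      have kj: "of_nat k - of_nat (Suc j) + 1 = (of_nat (k - j) :: 'a)"
        using Suc.prems by (simp add: of_nat_diff)
      have "\<gamma> (Suc j) \<noteq> 0"
        unfolding \<gamma>_def kj using Suc.prems by (simp del: of_nat_Suc)
      moreover have "L ^ j * (L * v (Suc j) - Const (\<gamma> (Suc j)) * v j)
          + Const (\<gamma> (Suc j)) * (L ^ j * v j - Const c * p') \<in> J"
        using c raise_lower[of j] Suc.prems by (intro ideal_add[OF J] ideal_mult[OF J]) auto
      then have "L ^ Suc j * v (Suc j) - Const (\<gamma> (Suc j) * c) * p' \<in> J"
        by (simp add: algebra_simps Const_mult)
      ultimately show ?case using c(1) by (intro exI[of _ "\<gamma> (Suc j) * c"]) simp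
    qed
    then obtain c where c: "c \<noteq> 0" "L ^ k * v k - Const c * p' \<in> J" by blast
    define q where "q = Const (inverse c) * v k + L * r"
    have "homogeneous (s - d) q"
      unfolding q_def using hv[of k] r k(3) by (intro homogeneous_add homogeneous_Const_times) auto
    moreover have "p - L ^ k * q \<in> J"
    proof -
      have "p - L ^ k * q = p' - L ^ k * (Const (inverse c) * v k)"
        by (simp add: p'_def q_def algebra_simps)
      also have "p' = Const (inverse c) * (Const c * p')"
        using c(1) by (simp flip: mult.assoc Const_mult)
      finally have "p - L ^ k * q = Const (- inverse c) * (L ^ k * v k - Const c * p')"
        by (simp add: algebra_simps Const_uminus)
      then show ?thesis using c(2) by (simp only: ideal_mult[OF J])
    qed
    ultimately show ?thesis by (auto simp: k_def)
  qed
  have main: "\<exists>q. homogeneous (s - d) q \<and> p - L ^ (2 * d - s) * q \<in> J"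
    if "homogeneous d p" "s \<le> 2 * d" "d \<le> s" for d p
    using that(3,1,2)
  proof (induction arbitrary: p rule: inc_induct)
    case base
    have "L * p \<in> J" by (rule socle[OF homogeneous_mult[OF hL base(1)]]) simp
    with core[OF base(1), of 0] show ?case by simp
  next
    case (step d)
    have "homogeneous (Suc d) (L * p)" using homogeneous_mult[OF hL step.prems(1)] by simp
    with step obtain r where r: "homogeneous (s - Suc d) r" "L * p - L ^ (2 * Suc d - s) * r \<in> J"
      by (metis le_SucI mult_le_mono2 order_trans order_refl)
    have "homogeneous (s - d) (L * r)"
      using homogeneous_mult[OF hL r(1)] step.hyps by (simp add: Suc_diff_Suc)
    with core[OF step.prems _ _ r(2)] step.hyps show ?case by simp
  qed
  show ?thesis
  proof (cases "d \<le> s")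
    case True
    with main[OF p] d show ?thesis unfolding s_def L_def J_def by blast
  next
    case False
    with socle[OF p] show ?thesis unfolding J_def by (intro exI[of _ 0]) simp
  qed
qed

section \<open>The cubes of the variables in good position\<close>

lemma prescribableI:
  assumes J: "is_ideal J" and "finite C"
    and C: "\<And>m. m \<in> C \<Longrightarrow> \<exists>g\<in>J. \<forall>c\<in>C. lookup g c = (if c = m then 1 else 0)"
  shows "prescribable J C"
  unfolding prescribable_def
proof
  fix y
  obtain g where g: "\<And>m. m \<in> C \<Longrightarrow> g m \<in> J" "\<And>m c. m \<in> C \<Longrightarrow> c \<in> C \<Longrightarrow> lookup (g m) c = (if c = m then 1 else 0)"
    using C by metis
  have "(\<Sum>m\<in>C. Const (y m) * g m) \<in> J"
    by (intro ideal_sum[OF J] ideal_mult[OF J] g)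
  moreover have "lookup (\<Sum>m\<in>C. Const (y m) * g m) c = y c" if "c \<in> C" for c
    using that \<open>finite C\<close> g(2) by (simp add: lookup_sum if_distrib[of "(*) _"] cong: if_cong)
  ultimately show "\<exists>g\<in>J. \<forall>c\<in>C. lookup g c = y c" by blast
qed

text \<open>Working modulo the variables in \<open>V\<close> does not affect the coefficients at monomials without them.\<close>

definition kill :: "'x set \<Rightarrow> ('x, 'a::comm_semiring_1) mpoly \<Rightarrow> ('x, 'a) mpoly" where
  "kill V = eval_hom Const (\<lambda>x. if x \<in> V then 0 else Var x)"

lemma kill_simps:
  "kill V (p + q) = kill V p + kill V q" "kill V (p * q) = kill V p * kill V q"
  "kill V (p ^ n) = kill V p ^ n" "kill V (Const c) = Const c"
  "kill V (Var x) = (if x \<in> V then 0 else Var x)"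
  and kill_0 [simp]: "kill V 0 = 0"
  and kill_1 [simp]: "kill V 1 = 1"
  by (simp_all add: kill_def Const.eval_add Const.eval_mult Const.eval_power Const.eval_Const Const.eval_Var)

lemma kill_uminus: "kill V (- p) = - kill V (p :: ('x, 'a::comm_ring_1) mpoly)"
  unfolding kill_def by (rule eval_uminus[OF Const.coeff_hom_axioms])

lemma kill_diff: "kill V (p - q) = kill V p - kill V (q :: ('x, 'a::comm_ring_1) mpoly)"
  using kill_simps(1)[of V p "- q"] by (simp add: kill_uminus)

lemma kill_numeral: "kill V (numeral n) = (numeral n :: ('x, 'a::comm_semiring_1) mpoly)"
  using kill_simps(4)[of V "numeral n"] by simp

lemma lookup_kill:
  assumes "keys c \<inter> V = {}"
  shows "lookup (kill V p) c = lookup p c"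
proof (induction p rule: mpoly_induct)
  case (add p q)
  then show ?case by (simp add: kill_simps lookup_add)
next
  case (monom a m)
  show ?case
  proof (cases "keys m \<inter> V = {}")
    case True
    then have "monom_value (\<lambda>x. if x \<in> V then 0 else Var x) m = (Monom m :: ('a, 'b) mpoly)"
      unfolding Monom_eq_monom_value monom_value_def by (intro prod.cong) auto
    then show ?thesis by (simp add: kill_def Const.eval_term)
  next
    case False
    then obtain x where x: "x \<in> keys m" "x \<in> V" by auto
    then have "monom_value (\<lambda>x. if x \<in> V then 0 else Var x) m = (0 :: ('a, 'b) mpoly)"
      unfolding monom_value_def by (intro prod_zero bexI[of _ x]) (auto simp: in_keys_iff zero_power)
    moreover have "c \<noteq> m" using assms x by auto
    ultimately show ?thesis by (simp add: kill_def Const.eval_term lookup_Monom)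
  qed
qed

lemma lookup_Var_power_times:
  assumes "lookup c i < k"
  shows "lookup (Var i ^ k * p) c = (0 :: 'a::comm_semiring_1)"
  unfolding Monom_single[symmetric]
  by (rule lookup_Monom_times_eq_0) (use assms in \<open>auto simp: lookup_add\<close>)

text \<open>Write $a,b,c,d$ for the original variables.  The new coordinate $x_4$ is $a+b+c+d$, which has the
  strong Lefschetz property, and $x_3=a-b+2c$, $x_2=c$, $x_1=b$.  The coefficients of $x_3$ are neither
  0 nor 1 at $b,c$ and differ from each other, which keeps $a,b,c,d$ pairwise independent modulo $x_3,x_4$;
  the columns below express $a,b,c,d$ in the new coordinates.\<close>

definition base_change :: "'a::field ^ 4 ^ 4" where
  "base_change = (\<chi> i j.
     if j = 1 then (if i = 1 then 1 else if i = 2 then - 2 else if i = 3 then 1 else 0)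
     else if j = 2 then (if i = 1 then 1 else 0)
     else if j = 3 then (if i = 2 then 1 else 0)
     else (if i = 1 then - 2 else if i = 2 then 1 else if i = 3 then - 1 else 1))"

lemma base_change_GL: "base_change \<in> (GL :: ('a::field ^ 4 ^ 4) set)"
proof -
  define B :: "'a ^ 4 ^ 4" where "B = (\<chi> i j.
     if j = 1 then (if i = 2 then 1 else 0)
     else if j = 2 then (if i = 3 then 1 else 0)
     else if j = 3 then (if i = 1 then 1 else if i = 2 then - 1 else if i = 3 then 2 else 0)
     else 1)"
  have "base_change ** B = mat 1"
    by (simp add: vec_eq_iff forall_4 matrix_matrix_mult_def sum_4 base_change_def B_def mat_def)
  then have "invertible (base_change :: 'a ^ 4 ^ 4)" by (auto simp: invertible_right_inverse)
  then show ?thesis by (simp add: GL_def)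
qed

lemma lin_change_base:
  "lin_change base_change (Var 1) = (Var 1 - 2 * Var 2 + Var 3 :: (4, 'a::field) mpoly)"
  "lin_change base_change (Var 2) = (Var 1 :: (4, 'a) mpoly)"
  "lin_change base_change (Var 3) = (Var 2 :: (4, 'a) mpoly)"
  "lin_change base_change (Var 4) = (Var 4 - Var 3 - 2 * Var 1 + Var 2 :: (4, 'a) mpoly)"
  by (simp_all add: lin_change_Var base_change_def sum_4 Const_uminus)

abbreviation base_ideal :: "(4, 'a::field) mpoly set" where
  "base_ideal \<equiv> lin_change base_change ` power_ideal 3"

lemma is_ideal_base_ideal: "is_ideal (base_ideal :: (4, 'a::field) mpoly set)"
  unfolding lin_change_ideal_gen[OF base_change_GL] by simp

lemma lin_change_cube_in_base_ideal:
  "lin_change base_change (Var i) ^ 3 \<in> (base_ideal :: (4, 'a::field) mpoly set)"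
  unfolding lin_change_power[symmetric] by (intro imageI ideal_gen_base rangeI)

lemmas base_ideal_cubes =
  lin_change_cube_in_base_ideal[of 1, unfolded lin_change_base]
  lin_change_cube_in_base_ideal[of 2, unfolded lin_change_base]
  lin_change_cube_in_base_ideal[of 3, unfolded lin_change_base]
  lin_change_cube_in_base_ideal[of 4, unfolded lin_change_base]

lemma prescribable_slice:
  assumes "4 \<le> d"
  shows "prescribable (base_ideal :: (4, 'a::field_char_0) mpoly set) (slice d)"
proof (rule prescribableI[OF is_ideal_base_ideal])
  show "finite (slice d)"
    by (rule finite_subset[OF _ finite_mono_deg_eq[of d]]) (auto simp: slice_def)
  fix m assume m: "m \<in> slice d"
  have "homogeneous d (Monom m :: (4, 'a) mpoly)"
    using m homogeneous_Monom[of m] by (auto simp: slice_def)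
  then obtain p where p: "homogeneous d p" "(Monom m :: (4, 'a) mpoly) = lin_change base_change p"
    by (rule GL_lin_change_onto[OF base_change_GL])
  obtain q where q: "p - var_sum ^ (2 * d - 8) * q \<in> power_ideal 3"
    using strong_Lefschetz[OF _ p(1), of 3] assms by auto
  have "lin_change base_change var_sum = (Var 4 :: (4, 'a) mpoly)"
    by (simp add: sum_4 lin_change_add lin_change_base)
  then have eq: "lin_change base_change (p - var_sum ^ (2 * d - 8) * q)
      = Monom m - Var 4 ^ (2 * d - 8) * lin_change base_change q"
    by (simp add: lin_change_diff lin_change_mult lin_change_power p(2))
  have "Monom m - Var 4 ^ (2 * d - 8) * lin_change base_change q \<in> base_ideal"
    using imageI[OF q, of "lin_change base_change"] unfolding eq .
  moreover have "lookup (Var 4 ^ (2 * d - 8) * lin_change base_change q) c = 0" if "c \<in> slice d" for c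
    by (rule lookup_Var_power_times) (use that in \<open>auto simp: slice_def\<close>)
  ultimately show "\<exists>g\<in>base_ideal. \<forall>c\<in>slice d. lookup g c = (if c = m then 1 else 0 :: 'a)"
    by (intro bexI[of _ "Monom m - Var 4 ^ (2 * d - 8) * lin_change base_change q"])
      (auto simp: lookup_minus lookup_Monom)
qed

lemma kill_witness:
  fixes J :: "('x, 'a::field) mpoly set"
  assumes J: "is_ideal J" and g: "g \<in> J" "kill V g = Const \<kappa> * Monom m + r" and "\<kappa> \<noteq> 0"
    and C: "\<And>c. c \<in> C \<Longrightarrow> keys c \<inter> V = {} \<and> lookup r c = 0"
  shows "\<exists>g\<in>J. \<forall>c\<in>C. lookup g c = (if c = m then 1 else 0)"
proof (intro bexI[of _ "Const (inverse \<kappa>) * g"] ballI)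
  show "Const (inverse \<kappa>) * g \<in> J" by (rule ideal_mult[OF J g(1)])
  fix c assume "c \<in> C"
  then have "lookup g c = lookup (Const \<kappa> * Monom m + r) c"
    using C lookup_kill[of c V g] g(2) by simp
  then show "lookup (Const (inverse \<kappa>) * g) c = (if c = m then 1 else 0)"
    using C[OF \<open>c \<in> C\<close>] \<open>\<kappa> \<noteq> 0\<close> by (simp add: lookup_add lookup_Monom)
qed

lemma Monom_mon4: "Monom (mon4 a b c e) = (Var 1 ^ a * Var 2 ^ b * Var 3 ^ c * Var 4 ^ e :: (4, 'a::comm_semiring_1) mpoly)"
  by (simp add: mon4_def Monom_add Monom_single)

lemma disjoint_keys_34: "keys c \<inter> {3, 4} = {} \<longleftrightarrow> lookup c 3 = 0 \<and> lookup c (4::4) = (0::nat)"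
  and disjoint_keys_4: "keys c \<inter> {4} = {} \<longleftrightarrow> lookup c (4::4) = (0::nat)"
  by (auto simp: in_keys_iff)

text \<open>With $x_3=x_4=0$ the four cubes become $(x_1-2x_2)^3$, $x_1^3$, $x_2^3$ and $(x_2-2x_1)^3$, the cubes
  of pairwise independent linear forms.\<close>

lemma prescribable_slice3: "prescribable (base_ideal :: (4, 'a::field_char_0) mpoly set) slice3"
proof (rule prescribableI[OF is_ideal_base_ideal])
  let ?J = "base_ideal :: (4, 'a) mpoly set"
  let ?h1 = "(Var 1 - 2 * Var 2 + Var 3) ^ 3 :: (4, 'a) mpoly"
  let ?h4 = "(Var 4 - Var 3 - 2 * Var 1 + Var 2) ^ 3 :: (4, 'a) mpoly"
  let ?X = "Var 1 :: (4, 'a) mpoly" and ?Y = "Var 2 :: (4, 'a) mpoly"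
  note J = is_ideal_base_ideal
  note cubes = base_ideal_cubes
  show "finite slice3"
    by (rule finite_subset[OF _ finite_mono_deg_eq[of 3]]) (auto simp: slice3_def)
  fix m assume m: "m \<in> slice3"
  have wit: "\<exists>g\<in>?J. \<forall>c\<in>slice3. lookup g c = (if c = m then 1 else 0)"
    if "g \<in> ?J" "kill {3, 4} g = Const \<kappa> * Monom m" "\<kappa> \<noteq> 0" for g \<kappa>
    by (rule kill_witness[OF J, of g "{3, 4}" \<kappa> m 0]) (use that in \<open>auto simp: disjoint_keys_34 slice3_def simp del: disjoint_insert\<close>)
  have "lookup m 1 + lookup m 2 = 3 \<and> lookup m 3 = 0 \<and> lookup m 4 = 0"
    using m by (auto simp: slice3_def mono_deg_4)
  then have "(lookup m 1 = 3 \<and> lookup m 2 = 0 \<or> lookup m 1 = 0 \<and> lookup m 2 = 3 \<or> lookup m 1 = 2 \<and> lookup m 2 = 1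
      \<or> lookup m 1 = 1 \<and> lookup m 2 = 2) \<and> lookup m 3 = 0 \<and> lookup m 4 = 0"
    by presburger
  then consider "m = mon4 3 0 0 0" | "m = mon4 0 3 0 0" | "m = mon4 2 1 0 0" | "m = mon4 1 2 0 0"
    by (metis mon4_lookup)
  then show "\<exists>g\<in>?J. \<forall>c\<in>slice3. lookup g c = (if c = m then 1 else 0)"
  proof cases
    case 1
    show ?thesis
      by (rule wit[of "?X ^ 3" 1]) (simp_all add: cubes kill_simps 1 Monom_mon4)
  next
    case 2
    show ?thesis
      by (rule wit[of "?Y ^ 3" 1]) (simp_all add: cubes kill_simps 2 Monom_mon4)
  next
    case 3
    show ?thesis
    proof (rule wit[of "?h1 + 2 * ?h4 + 15 * ?X ^ 3 + 6 * ?Y ^ 3" 18])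
      show "kill {3, 4} (?h1 + 2 * ?h4 + 15 * ?X ^ 3 + 6 * ?Y ^ 3) = Const 18 * Monom m"
        unfolding kill_simps kill_diff kill_numeral by (simp add: 3 Monom_mon4) algebra
    qed (simp_all add: cubes ideal_add[OF J] ideal_mult[OF J])
  next
    case 4
    show ?thesis
    proof (rule wit[of "2 * ?h1 + ?h4 + 6 * ?X ^ 3 + 15 * ?Y ^ 3" 18])
      show "kill {3, 4} (2 * ?h1 + ?h4 + 6 * ?X ^ 3 + 15 * ?Y ^ 3) = Const 18 * Monom m"
        unfolding kill_simps kill_diff kill_numeral by (simp add: 4 Monom_mon4) algebra
    qed (simp_all add: cubes ideal_add[OF J] ideal_mult[OF J])
  qed
qed

text \<open>The coefficients below solve the linear equations that express each monomial of
  \<^const>\<open>slice4_II\<close>, up to an integer factor, through $x_3^4$, $x_2x_3^3$, $x_2^2x_3^2$ and the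
  multiples of the four cubes, modulo $x_4$.\<close>

lemma prescribable_slice4_II: "prescribable (base_ideal :: (4, 'a::field_char_0) mpoly set) slice4_II"
proof (rule prescribableI[OF is_ideal_base_ideal])
  let ?J = "base_ideal :: (4, 'a) mpoly set"
  let ?h1 = "(Var 1 - 2 * Var 2 + Var 3) ^ 3 :: (4, 'a) mpoly"
  let ?h4 = "(Var 4 - Var 3 - 2 * Var 1 + Var 2) ^ 3 :: (4, 'a) mpoly"
  let ?X = "Var 1 :: (4, 'a) mpoly" and ?Y = "Var 2 :: (4, 'a) mpoly" and ?Z = "Var 3 :: (4, 'a) mpoly"
  note J = is_ideal_base_ideal
  note cubes = base_ideal_cubes
  note kill_rules = kill_simps kill_diff kill_uminus kill_numeral Const_numeral
  show "finite slice4_II"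
    by (rule finite_subset[OF _ finite_mono_deg_eq[of 4]]) (auto simp: slice4_II_def)
  fix m assume m: "m \<in> slice4_II"
  have wit: "\<exists>g\<in>?J. \<forall>c\<in>slice4_II. lookup g c = (if c = m then 1 else 0)"
    if "kill {4} l1 = l1" "kill {4} l2 = l2" "kill {4} l3 = l3" "kill {4} l4 = l4" "\<kappa> \<noteq> 0" and
      eq: "l1 * (?X - 2 * ?Y + ?Z) ^ 3 + l2 * ?X ^ 3 + l3 * ?Y ^ 3 + l4 * (?Y - 2 * ?X - ?Z) ^ 3
        + Const \<alpha> * ?Z ^ 4 + Const \<beta> * (?Y * ?Z ^ 3) + Const \<gamma> * (?Y ^ 2 * ?Z ^ 2) = Const \<kappa> * Monom m"
    for l1 l2 l3 l4 \<kappa> \<alpha> \<beta> \<gamma>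
  proof (rule kill_witness[OF J])
    let ?r = "Const (- \<alpha>) * Monom (mon4 0 0 4 0) + Const (- \<beta>) * Monom (mon4 0 1 3 0)
      + Const (- \<gamma>) * Monom (mon4 0 2 2 0) :: (4, 'a) mpoly"
    show "l1 * ?h1 + l2 * ?X ^ 3 + l3 * ?Y ^ 3 + l4 * ?h4 \<in> ?J"
      by (intro ideal_add[OF J] ideal_mult[OF J] cubes)
    have "kill {4} (l1 * ?h1 + l2 * ?X ^ 3 + l3 * ?Y ^ 3 + l4 * ?h4)
        = l1 * (?X - 2 * ?Y + ?Z) ^ 3 + l2 * ?X ^ 3 + l3 * ?Y ^ 3 + l4 * (?Y - 2 * ?X - ?Z) ^ 3"
    proof -
      have reorder: "- ?Z - 2 * ?X + ?Y = ?Y - 2 * ?X - ?Z" by simp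
      show ?thesis
        unfolding kill_simps kill_diff kill_numeral that(1-4) by (simp add: reorder)
    qed
    also have "\<dots> = Const \<kappa> * Monom m + ?r"
      by (simp add: Monom_mon4 Const_uminus flip: eq)
    finally show "kill {4} (l1 * ?h1 + l2 * ?X ^ 3 + l3 * ?Y ^ 3 + l4 * ?h4) = Const \<kappa> * Monom m + ?r" .
    show "keys c \<inter> {4} = {} \<and> lookup ?r c = 0" if "c \<in> slice4_II" for c
      using that by (auto simp: disjoint_keys_4 slice4_II_def lookup_add lookup_Monom simp del: disjoint_insert)
  qed (use that in auto)
  define a b c where "a = lookup m 1" "b = lookup m 2" "c = lookup m 3"
  have "a + b + c = 4" "a > 0 \<or> c \<le> 1" "m = mon4 a b c 0"
    using m mon4_lookup[of m] by (auto simp: slice4_II_def mono_deg_4 a_b_c_def)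
  then have cases: "a = 0 \<or> a = 1 \<or> a = 2 \<or> a = 3 \<or> a = 4" "b = 0 \<or> b = 1 \<or> b = 2 \<or> b = 3 \<or> b = 4"
    "c = 4 - a - b" "a + b \<le> 4" "a > 0 \<or> b \<ge> 3" by linarith+
  consider "m = mon4 4 0 0 0" | "m = mon4 3 1 0 0" | "m = mon4 3 0 1 0" | "m = mon4 2 2 0 0" | "m = mon4 2 1 1 0" | "m = mon4 2 0 2 0" | "m = mon4 1 3 0 0" | "m = mon4 1 2 1 0" | "m = mon4 1 1 2 0" | "m = mon4 1 0 3 0" | "m = mon4 0 4 0 0" | "m = mon4 0 3 1 0"
  proof -
    have "a = 4 \<and> b = 0 \<and> c = 0 \<or> a = 3 \<and> b = 1 \<and> c = 0 \<or> a = 3 \<and> b = 0 \<and> c = 1 \<or> a = 2 \<and> b = 2 \<and> c = 0 \<or> a = 2 \<and> b = 1 \<and> c = 1 \<or> a = 2 \<and> b = 0 \<and> c = 2 \<or> a = 1 \<and> b = 3 \<and> c = 0 \<or> a = 1 \<and> b = 2 \<and> c = 1 \<or> a = 1 \<and> b = 1 \<and> c = 2 \<or> a = 1 \<and> b = 0 \<and> c = 3 \<or> a = 0 \<and> b = 4 \<and> c = 0 \<or> a = 0 \<and> b = 3 \<and> c = 1"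
      using cases by (elim disjE) simp_all
    with \<open>m = mon4 a b c 0\<close> that show thesis by blast
  qed
  then show "\<exists>g\<in>?J. \<forall>c\<in>slice4_II. lookup g c = (if c = m then 1 else 0)"
  proof cases
    case 1
    show ?thesis
      by (rule wit[of 0 "?X" 0 0 1 0 0 0], unfold kill_rules 1 Monom_mon4;
        (simp add: Const_uminus)?; algebra?)
  next
    case 2
    show ?thesis
      by (rule wit[of 0 "?Y" 0 0 1 0 0 0], unfold kill_rules 2 Monom_mon4;
        (simp add: Const_uminus)?; algebra?)
  next
    case 3
    show ?thesis
      by (rule wit[of 0 "?Z" 0 0 1 0 0 0], unfold kill_rules 3 Monom_mon4;
        (simp add: Const_uminus)?; algebra?)
  next
    case 4
    show ?thesis
      by (rule wit[of "20 * ?X + 8 * ?Y + 4 * ?Z" "- 4 * ?X - 16 * ?Y" "- 16 * ?X + 77 * ?Y - 108 * ?Z" "2 * ?X - 13 * ?Y + 5 * ?Z" 24 1 "- 12" 54], unfold kill_rules 4 Monom_mon4;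
        (simp add: Const_uminus)?; algebra?)
  next
    case 5
    show ?thesis
      by (rule wit[of "6 * ?X + 2 * ?Y + 2 * ?Z" "- 6 * ?X - 6 * ?Y - 4 * ?Z" "- 6 * ?X + 21 * ?Y - 25 * ?Z" "- 5 * ?Y + 2 * ?Z" 6 0 "- 1" 9], unfold kill_rules 5 Monom_mon4;
        (simp add: Const_uminus)?; algebra?)
  next
    case 6
    show ?thesis
      by (rule wit[of "7 * ?X + 2 * ?Y + 3 * ?Z" "- 23 * ?X + 8 * ?Y - 24 * ?Z" "- 8 * ?X + 23 * ?Y - 24 * ?Z" "- 2 * ?X - 7 * ?Y + 3 * ?Z" 6 0 0 6], unfold kill_rules 6 Monom_mon4;
        (simp add: Const_uminus)?; algebra?)
  next
    case 7
    show ?thesis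
      by (rule wit[of 0 0 "?X" 0 1 0 0 0], unfold kill_rules 7 Monom_mon4;
        (simp add: Const_uminus)?; algebra?)
  next
    case 8
    show ?thesis
      by (rule wit[of "- 3 * ?X - 2 * ?Y - ?Z" "3 * ?X + 2 * ?Z" "12 * ?X - 18 * ?Y + 23 * ?Z" "2 * ?Y - ?Z" 6 0 1 "- 9"], unfold kill_rules 8 Monom_mon4;
        (simp add: Const_uminus)?; algebra?)
  next
    case 9
    show ?thesis
      by (rule wit[of "- 16 * ?X - 8 * ?Y - 8 * ?Z" "32 * ?X - 8 * ?Y + 24 * ?Z" "44 * ?X - 77 * ?Y + 78 * ?Z" "2 * ?X + 13 * ?Y - 7 * ?Z" 12 1 "- 6" "- 12"], unfold kill_rules 9 Monom_mon4;
        (simp add: Const_uminus)?; algebra?)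
  next
    case 10
    show ?thesis
      by (rule wit[of "- 5 * ?X - 2 * ?Y - 3 * ?Z" "21 * ?X - 12 * ?Y + 18 * ?Z" "12 * ?X - 21 * ?Y + 18 * ?Z" "2 * ?X + 5 * ?Y - 3 * ?Z" 2 0 "- 2" 0], unfold kill_rules 10 Monom_mon4;
        (simp add: Const_uminus)?; algebra?)
  next
    case 11
    show ?thesis
      by (rule wit[of 0 0 "?Y" 0 1 0 0 0], unfold kill_rules 11 Monom_mon4;
        (simp add: Const_uminus)?; algebra?)
  next
    case 12
    show ?thesis
      by (rule wit[of 0 0 "?Z" 0 1 0 0 0], unfold kill_rules 12 Monom_mon4;
        (simp add: Const_uminus)?; algebra?)
  qed
qed

lemma good_position_base: "good_position (base_ideal :: (4, 'a::field_char_0) mpoly set)"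
  using prescribable_slice3[where 'a = 'a] prescribable_slice4_II[where 'a = 'a] prescribable_slice[where 'a = 'a]
  by (auto simp: good_position_def position_slices_def)

lemma ideal_gen_unit_multiples:
  fixes f :: "'i \<Rightarrow> ('x, 'a::field) mpoly"
  assumes "\<And>i. c i \<noteq> 0"
  shows "ideal_gen (range (\<lambda>i. Const (c i) * f i)) = ideal_gen (range f)"
proof
  show "ideal_gen (range (\<lambda>i. Const (c i) * f i)) \<subseteq> ideal_gen (range f)"
    by (intro ideal_gen_subset image_subsetI ideal_mult[OF is_ideal_ideal_gen] ideal_gen_base rangeI)
  show "ideal_gen (range f) \<subseteq> ideal_gen (range (\<lambda>i. Const (c i) * f i))"
  proof (intro ideal_gen_subset image_subsetI)
    fix i
    have "f i = Const (inverse (c i)) * (Const (c i) * f i)"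
      using assms[of i] by (simp flip: mult.assoc Const_mult)
    also have "\<dots> \<in> ideal_gen (range (\<lambda>i. Const (c i) * f i))"
      by (intro ideal_mult[OF is_ideal_ideal_gen] ideal_gen_base rangeI)
    finally show "f i \<in> ideal_gen (range (\<lambda>i. Const (c i) * f i))" .
  qed
qed

section \<open>Degeneration of triangular systems to the cubes of the variables\<close>

text \<open>The index of a variable as a number: in the index type 4 equals 0.\<close>

definition position :: "4 \<Rightarrow> nat" where
  "position i = (if i = 1 then 1 else if i = 2 then 2 else if i = 3 then 3 else 4)"

definition weight :: "(4 \<Rightarrow>\<^sub>0 nat) \<Rightarrow> nat" where
  "weight m = (\<Sum>i\<in>UNIV. position i * lookup m i)"

definition torus :: "'a::field \<Rightarrow> 'a ^ 4 ^ 4" where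
  "torus t = (\<chi> i j. if i = j then t ^ position i else 0)"

lemma torus_GL: "t \<noteq> 0 \<Longrightarrow> torus t \<in> GL"
proof -
  assume "t \<noteq> 0"
  then have "torus t ** torus (inverse t) = mat 1"
    by (simp add: vec_eq_iff matrix_matrix_mult_def torus_def mat_def if_distrib[of "\<lambda>x. x * _"]
        if_distrib[of "(*) _"] cong: if_cong flip: power_mult_distrib)
  then show ?thesis by (auto simp: GL_def invertible_right_inverse)
qed

lemma lin_change_torus_Var: "lin_change (torus t) (Var j) = Const (t ^ position j) * Var j"
  by (simp add: lin_change_Var torus_def if_distrib[of Const] if_distrib[of "\<lambda>x. x * _"] cong: if_cong)

lemma lin_change_torus_Monom: "lin_change (torus t) (Monom m) = Const (t ^ weight m) * Monom m"
proof -
  have "lin_change (torus t) (Monom m) = (\<Prod>i\<in>UNIV. (Const (t ^ position i) * Var i) ^ lookup m i)"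
    unfolding lin_change_Monom lin_change_torus_Var by (rule monom_value_superset) auto
  also have "\<dots> = (\<Prod>i\<in>UNIV. Const (t ^ position i) ^ lookup m i) * (\<Prod>i\<in>UNIV. Var i ^ lookup m i)"
    by (simp add: power_mult_distrib prod.distrib)
  also have "(\<Prod>i\<in>UNIV. Const (t ^ position i) ^ lookup m i) = Const (t ^ weight m)"
    by (simp only: weight_def power_sum Const_prod power_mult Const_power)
  also have "(\<Prod>i\<in>UNIV. Var i ^ lookup m i) = Monom m"
    unfolding Monom_eq_monom_value by (rule monom_value_superset[symmetric]) auto
  finally show ?thesis .
qed

lemma weight_ge:
  assumes "keys m \<subseteq> {j. position i \<le> position j}"
  shows "position i * mono_deg m \<le> weight m"
  unfolding weight_def mono_deg_UNIV sum_distrib_left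
  using assms by (intro sum_mono) (auto simp: in_keys_iff subset_iff)

lemma position_inject: "position i = position j \<Longrightarrow> i = j"
  using exhaust_4[of i] exhaust_4[of j] by (elim disjE) (simp_all add: position_def)

lemma weight_eq:
  assumes keys: "keys m \<subseteq> {j. position i \<le> position j}" and eq: "weight m = position i * mono_deg m"
  shows "m = Poly_Mapping.single i (mono_deg m)"
proof (rule keys_subset_singleton, rule subsetI)
  fix j assume j: "j \<in> keys m"
  have le: "position i * lookup m j \<le> position j * lookup m j" for j
    using keys by (auto simp: in_keys_iff subset_iff)
  have "position i * lookup m j = position j * lookup m j"
  proof (rule ccontr)
    assume "position i * lookup m j \<noteq> position j * lookup m j"
    with le[of j] have "position i * lookup m j < position j * lookup m j" by simp
    then have "(\<Sum>j\<in>UNIV. position i * lookup m j) < (\<Sum>j\<in>UNIV. position j * lookup m j)"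
      using le by (intro sum_strict_mono_ex1) auto
    with eq show False by (simp add: weight_def mono_deg_UNIV sum_distrib_left)
  qed
  with j position_inject show "j \<in> {i}" by (auto simp: in_keys_iff)
qed

text \<open>Under the torus action with weights 1, 2, 3, 4 the pure power is the term of lowest weight of
  each form, so that after rescaling the forms tend to multiples of the cubes of the variables.\<close>

lemma triangular_good_position:
  fixes f :: "4 \<Rightarrow> (4, 'k::field_char_0) mpoly"
  assumes cubic: "\<And>i. homogeneous 3 (f i)"
    and triangular: "\<And>i. vars (f i) \<subseteq> {j. position i \<le> position j}"
    and pure: "\<And>i. lookup (f i) (Poly_Mapping.single i 3) \<noteq> 0"
  shows "\<exists>A\<in>GL. good_position (lin_change A ` ideal_gen (range f))"
proof -
  have m: "mono_deg m = 3" "keys m \<subseteq> {j. position i \<le> position j}" if "m \<in> keys (f i)" for m i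
    using cubic[of i] triangular[of i] that by (auto simp: homogeneous_def vars_def)
  have ge: "position i * 3 \<le> weight m" if "m \<in> keys (f i)" for m i
    using weight_ge[OF m(2)[OF that]] m(1)[OF that] by simp
  \<comment> \<open>The image of f i under the torus, divided by its lowest power of t.\<close>
  define F where "F = (\<lambda>t i. \<Sum>m\<in>keys (f i). Const (lookup (f i) m * t ^ (weight m - position i * 3)) * Monom m)"
  define H where "H = (\<lambda>t i. lin_change base_change (F t i))"
  have hF: "homogeneous 3 (F t i)" for t i
    unfolding F_def
  proof (intro homogeneous_sum homogeneous_Const_times)
    fix m assume "m \<in> keys (f i)"
    with m(1) homogeneous_Monom[of m] show "homogeneous 3 (Monom m)" by simp
  qed
  have F_torus: "lin_change (torus t) (f i) = Const (t ^ (position i * 3)) * F t i" for t i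
  proof -
    have "lin_change (torus t) (f i) = lin_change (torus t) (\<Sum>m\<in>keys (f i). Const (lookup (f i) m) * Monom m)"
      by (simp flip: mpoly_eq_sum)
    also have "\<dots> = (\<Sum>m\<in>keys (f i). Const (lookup (f i) m * t ^ weight m) * Monom m)"
      by (simp add: lin_change_sum lin_change_mult lin_change_torus_Monom Const_mult mult.assoc)
    also have "\<dots> = (\<Sum>m\<in>keys (f i). Const (t ^ (position i * 3)) * (Const (lookup (f i) m * t ^ (weight m - position i * 3)) * Monom m))"
    proof (intro sum.cong refl)
      fix m assume "m \<in> keys (f i)"
      then have "t ^ weight m = t ^ (position i * 3) * t ^ (weight m - position i * 3)"
        using ge by (simp flip: power_add)
      then show "Const (lookup (f i) m * t ^ weight m) * Monom m
          = Const (t ^ (position i * 3)) * (Const (lookup (f i) m * t ^ (weight m - position i * 3)) * Monom m)"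
        by (simp add: Const_mult ac_simps)
    qed
    finally show ?thesis by (simp add: F_def sum_distrib_left)
  qed
  have F0: "F 0 i = Const (lookup (f i) (Poly_Mapping.single i 3)) * Var i ^ 3" for i
  proof -
    have s: "Poly_Mapping.single i 3 \<in> keys (f i)" using pure by (simp add: in_keys_iff)
    have "weight m - position i * 3 \<noteq> 0" if "m \<in> keys (f i)" "m \<noteq> Poly_Mapping.single i 3" for m
      using weight_eq[OF m(2)[OF that(1)]] m(1)[OF that(1)] ge[OF that(1)] that(2) by auto
    then have "F 0 i = (\<Sum>m\<in>keys (f i). if m = Poly_Mapping.single i 3 then
        Const (lookup (f i) (Poly_Mapping.single i 3)) * Monom (Poly_Mapping.single i 3) else 0)"
      unfolding F_def
      by (intro sum.cong refl) (auto simp: power_0_left weight_def lookup_single when_def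
          if_distrib[of "(*) _"] cong: if_cong)
    with s show ?thesis by (simp add: Monom_single)
  qed
  have "ideal_gen (range (H 0)) = base_ideal"
  proof -
    have "H 0 = (\<lambda>i. Const (lookup (f i) (Poly_Mapping.single i 3)) * lin_change base_change (Var i ^ 3))"
      by (simp add: H_def F0 lin_change_mult fun_eq_iff)
    then have "ideal_gen (range (H 0)) = ideal_gen (range (\<lambda>i. lin_change base_change (Var i ^ 3)))"
      using ideal_gen_unit_multiples[OF pure] by simp
    then show ?thesis
      by (simp add: lin_change_ideal_gen[OF base_change_GL] lin_change_range)
  qed
  then have H0: "good_position (ideal_gen (range (H 0)))" by (simp add: good_position_base)
  have "poly_fun.R_poly (\<lambda>t. F t i)" for i
    unfolding F_def
    by (intro poly_fun.R_poly_sum poly_fun.R_poly_Const_times poly_fun.R_poly_const poly_fun.R_mult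
        poly_fun.R_const poly_fun.R_power poly_fun_id)
  then have regular: "poly_fun.R_poly (\<lambda>t. H t i)" for i
    unfolding H_def by (rule poly_fun.R_poly_lin_change[OF poly_fun.R_const _ hF])
  have hH: "homogeneous 3 (H t i)" for t i
    unfolding H_def by (rule homogeneous_lin_change[OF hF])
  obtain G where G: "poly_fun G" "G 0 \<noteq> 0" "\<And>t. G t \<noteq> 0 \<Longrightarrow> good_position (ideal_gen (range (H t)))"
    using poly_fun.good_position_open[where H = H and p = 0, OF regular hH UNIV_I H0] by auto
  have "finite ({t. G t = 0} \<union> {0})" using finite_zeros_poly_fun[OF G(1,2)] by simp
  then obtain t where t: "t \<notin> {t. G t = 0} \<union> {0}"
    using ex_new_if_finite[OF infinite_UNIV_char_0] by meson
  then have "t \<noteq> 0" "good_position (ideal_gen (range (H t)))" using G(3) by auto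
  have "ideal_gen (range (H t)) = lin_change base_change ` ideal_gen (range (F t))"
    by (simp add: H_def lin_change_ideal_gen[OF base_change_GL] lin_change_range)
  also have "ideal_gen (range (F t)) = ideal_gen (range (\<lambda>i. lin_change (torus t) (f i)))"
    unfolding F_torus using \<open>t \<noteq> 0\<close> by (intro ideal_gen_unit_multiples[symmetric]) simp
  also have "\<dots> = lin_change (torus t) ` ideal_gen (range f)"
    by (simp add: lin_change_ideal_gen[OF torus_GL[OF \<open>t \<noteq> 0\<close>]] lin_change_range)
  also have "lin_change base_change ` \<dots> = lin_change (base_change ** torus t) ` ideal_gen (range f)"
    by (simp add: image_image lin_change_lin_change)
  finally have "good_position (lin_change (base_change ** torus t) ` ideal_gen (range f))"
    using \<open>good_position (ideal_gen (range (H t)))\<close> by simp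
  moreover have "base_change ** torus t \<in> GL"
    using base_change_GL torus_GL[OF \<open>t \<noteq> 0\<close>] by (auto simp: GL_def intro: invertible_mult)
  ultimately show ?thesis by blast
qed

lemma triangular_Gin:
  fixes f1 f2 f3 f4 :: "(4, 'k::field_char_0) mpoly"
  assumes hom: "homogeneous 3 f1" "homogeneous 3 f2" "homogeneous 3 f3" "homogeneous 3 f4"
    and vars: "vars f1 \<subseteq> {1, 2, 3, 4}" "vars f2 \<subseteq> {2, 3, 4}" "vars f3 \<subseteq> {3, 4}" "vars f4 \<subseteq> {4}"
    and reg: "regular_sequence [f1, f2, f3, f4]"
  shows "Gin (ideal_gen {f1, f2, f3, f4}) = gin_form_I \<or> Gin (ideal_gen {f1, f2, f3, f4}) = gin_form_II"
proof -
  define f where "f = (\<lambda>i :: 4. if i = 1 then f1 else if i = 2 then f2 else if i = 3 then f3 else f4)"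
  have range: "range f = {f1, f2, f3, f4}" by (subst range_4) (simp add: f_def)
  have cubic: "homogeneous 3 (f i)" for i using hom by (simp add: f_def)
  have later: "{2, 3, 4} \<subseteq> {j. position 2 \<le> position j}" "{3, 4} \<subseteq> {j. position 3 \<le> position j}"
    by (auto simp: position_def)
  have tri: "vars (f i) \<subseteq> {j. position i \<le> position j}" for i
    using exhaust_4[of i]
  proof (elim disjE)
    assume "i = 1"
    then show ?thesis by (auto simp: position_def)
  qed (use vars later in \<open>auto simp: f_def\<close>)
  have pure: "lookup (f i) (Poly_Mapping.single i 3) \<noteq> 0" for i
    using exhaust_4[of i] triangular_regular_sequence[OF hom vars reg] by (auto simp: f_def)
  obtain A where A: "A \<in> GL" "good_position (lin_change A ` ideal_gen (range f))"
    using triangular_good_position[where f = f, OF cubic tri pure] by blast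
  have "Gin (ideal_gen (range f)) = gin_form_I \<or> Gin (ideal_gen (range f)) = gin_form_II"
    by (rule Gin_of_good_position[OF cubic A])
  then show ?thesis by (simp only: range)
qed

text \<open>Good position in the coordinates \<^const>\<open>base_change\<close> is an open condition on the cubics that holds
  for the cubes of the variables.\<close>

lemma generic_Gin:
  "generic_forms (\<lambda>_. 3) (\<lambda>f :: 4 \<Rightarrow> (4, 'k::field_char_0) mpoly.
     Gin (ideal_gen {f 1, f 2, f 3, f 4}) = gin_form_I \<or> Gin (ideal_gen {f 1, f 2, f 3, f 4}) = gin_form_II)"
proof -
  define X :: "(4 \<Rightarrow> (4, 'k) mpoly) set" where "X = {f. \<forall>j. homogeneous 3 (f j)}"
  let ?\<phi> = "\<lambda>(f :: 4 \<Rightarrow> (4, 'k) mpoly) (j, m). lookup (f j) m"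
  define H where "H = (\<lambda>(f :: 4 \<Rightarrow> (4, 'k) mpoly) i. lin_change base_change (f i))"
  interpret function_algebra "zariski_fun ?\<phi> X" X by (rule function_algebra_zariski_fun)
  have "R_poly (\<lambda>f. f i)" for i
    unfolding R_poly_def using zariski_fun_coord[of ?\<phi> X "(i, _)"] by simp
  then have regular: "R_poly (\<lambda>f. H f i)" for i
    unfolding H_def by (rule R_poly_lin_change[OF R_const, where d = 3]) (simp add: X_def)
  have hom: "homogeneous 3 (H f i)" if "f \<in> X" for f i
    unfolding H_def using that by (intro homogeneous_lin_change) (simp add: X_def)
  define p :: "4 \<Rightarrow> (4, 'k) mpoly" where "p = (\<lambda>i. Var i ^ 3)"
  have "homogeneous 3 (p i)" for i
    unfolding p_def by (rule homogeneous_power[OF homogeneous_Var, of 3, simplified])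
  then have "p \<in> X" by (simp add: X_def)
  have image: "ideal_gen (range (H f)) = lin_change base_change ` ideal_gen (range f)" for f
    by (simp add: H_def lin_change_ideal_gen[OF base_change_GL] lin_change_range)
  have "good_position (ideal_gen (range (H p)))"
    using good_position_base by (simp add: image p_def)
  then obtain F where F: "zariski_fun ?\<phi> X F" "F p \<noteq> 0"
    "\<And>f. f \<in> X \<Longrightarrow> F f \<noteq> 0 \<Longrightarrow> good_position (ideal_gen (range (H f)))"
    using good_position_open[where H = H and p = p, OF regular hom \<open>p \<in> X\<close>] by auto
  have "Gin (ideal_gen (range f)) = gin_form_I \<or> Gin (ideal_gen (range f)) = gin_form_II"
    if "f \<in> X" "F f \<noteq> 0" for f
    using Gin_of_good_position[OF _ base_change_GL, of f] F(3)[OF that] that(1) by (simp add: X_def image)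
  moreover have "zariski_open_in ?\<phi> X {f \<in> X. F f \<noteq> 0}" "{f \<in> X. F f \<noteq> 0} \<noteq> {}"
    using zariski_open_nonzero[OF F(1)] \<open>p \<in> X\<close> F(2) by auto
  ultimately show ?thesis
    unfolding generic_forms_def X_def[symmetric] range_4[symmetric]
    by (intro exI[of _ "{f \<in> X. F f \<noteq> 0}"]) auto
qed

theorem proposition2p3:
  shows "generic_forms (\<lambda>_. 3)
           (\<lambda>f :: 4 \<Rightarrow> (4, 'k::{alg_closed_field, field_char_0}) mpoly.
              Gin (ideal_gen {f 1, f 2, f 3, f 4}) = gin_form_I
              \<or> Gin (ideal_gen {f 1, f 2, f 3, f 4}) = gin_form_II)
    \<and> (\<forall>f1 f2 f3 f4 :: (4, 'k) mpoly.
         homogeneous 3 f1 \<and> homogeneous 3 f2 \<and> homogeneous 3 f3 \<and> homogeneous 3 f4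
         \<and> vars f1 \<subseteq> {1, 2, 3, 4} \<and> vars f2 \<subseteq> {2, 3, 4} \<and> vars f3 \<subseteq> {3, 4} \<and> vars f4 \<subseteq> {4}
         \<and> regular_sequence [f1, f2, f3, f4]
         \<longrightarrow> Gin (ideal_gen {f1, f2, f3, f4}) = gin_form_I
           \<or> Gin (ideal_gen {f1, f2, f3, f4}) = gin_form_II)"
proof (intro conjI allI impI)
  show "generic_forms (\<lambda>_. 3) (\<lambda>f :: 4 \<Rightarrow> (4, 'k) mpoly.
      Gin (ideal_gen {f 1, f 2, f 3, f 4}) = gin_form_I \<or> Gin (ideal_gen {f 1, f 2, f 3, f 4}) = gin_form_II)"
    by (rule generic_Gin)
qed (elim conjE, rule triangular_Gin)

end
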